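(* Assume that $V\in L^\infty(\Omega)$ satisfies $V(x)\ge H>0$ in $\Omega$, where $H$ is a constant. Then the semigroup generated by $-\mathfrak A$ is exponentially stable. More precisely, there exist constants $C>0$ and $\omega>0$ such that $$\|\Phi(t)\|_{\mathcal H}\le Ce^{-\omega t}\|\Phi(0)\|_{\mathcal H}\quad\text{for all }t\ge0,$$ where $\Phi$ is the mild solution of $\partial_t\Phi(t)+\mathfrak A\Phi(t)=0$ with initial datum $\Phi(0)=\Phi_0\in\mathcal H$.
   Context: Setting. Let $N$ be a positive integer, $\mathbb R^N_+=\{x\in\mathbb R^N: x_N>0\}$, and let $\Omega\subset\overline{\mathbb R^N_+}$ be a bounded $C^2$ domain such that $\partial\Omega\cap\{x_N=0\}$ is a nonempty relatively open subset of $\partial\Omega$. Let $\alpha\in(0,1)$, $w=x_N^\alpha$, and $A=\mathrm{diag}(1,\dots,1,w)$ (with $N-1$ ones). Functions are real valued. Spaces. $H^1(\Omega;w)=\{u\in L^2(\Omega):\int_\Omega\nabla u\cdot A\nabla u\,dx<+\infty\}$ (weak derivatives), with inner product $\int_\Omega(uv+\nabla u\cdot A\nabla v)\,dx$; $H^1_0(\Omega;w)$ is the closure of $C_0^\infty(\Omega)$ in $H^1(\Omega;w)$. With $a(u,v)=\int_\Omega\nabla u\cdot A\nabla v\,dx$, the space $H_0^1(\Omega;w)$ is equipped with the equivalent norm $\|u\|_{H_0^1(\Omega;w)}=a(u,u)^{1/2}$. $\mathcal A u=-\mathrm{div}(A\nabla u)$ with $D(\mathcal A)=\{u\in H_0^1(\Omega;w):\mathcal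 A u\in L^2(\Omega)\}$. $\mathcal H=H_0^1(\Omega;w)\times L^2(\Omega)$ with inner product $\langle(u,v),(z,q)\rangle_{\mathcal H}=a(u,z)+(v,q)_{L^2(\Omega)}$. Operator. $\mathfrak A(u,v)=(-v,\ \mathcal A u+Vv)$ with domain $D(\mathfrak A)=D(\mathcal A)\times H_0^1(\Omega;w)$. $-\mathfrak A$ generates a $C_0$-semigroup of contractions $e^{-t\mathfrak A}$ on $\mathcal H$, and the mild solution is $\Phi(t)=e^{-t\mathfrak A}\Phi_0=(\varphi(t),\partial_t\varphi(t))$, corresponding to the damped wave equation $\partial_{tt}\varphi-\mathrm{div}(A\nabla\varphi)+V\partial_t\varphi=0$ with $\varphi=0$ on $\partial\Omega$. The constants $C,\omega$ do not depend on $\Phi_0$. *)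

theory Defs
  imports "HOL-Analysis.Analysis" "HOL-Library.Function_Algebras"
begin

text \<open>
  Elements of the function spaces below are represented by functions on \<open>\<real>\<^sup>N\<close>; only their
  values on \<open>\<Omega>\<close>, up to Lebesgue null sets, are relevant.
  The distinguished coordinate \<open>x\<^sub>N\<close> is \<open>x $ l\<close> for an arbitrary fixed index \<open>l\<close>.
\<close>

instantiation "fun" :: (type, real_vector) real_vector
begin

definition scaleR_fun :: "real \<Rightarrow> ('a \<Rightarrow> 'b) \<Rightarrow> 'a \<Rightarrow> 'b" where
  "scaleR_fun c f = (\<lambda>x. c *\<^sub>R f x)"

instance
  by standard (auto simp: scaleR_fun_def plus_fun_def fun_eq_iff scaleR_add_right scaleR_add_left)

end


section \<open>Smooth functions and the domain\<close>

definition partial_deriv :: "'n::finite \<Rightarrow> (real^'n \<Rightarrow> real) \<Rightarrow> real^'n \<Rightarrow> real" where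
  "partial_deriv i f x = frechet_derivative f (at x) (axis i 1)"

definition gradient :: "(real^'n \<Rightarrow> real) \<Rightarrow> real^'n::finite \<Rightarrow> real^'n" where
  "gradient f x = (\<chi> i. partial_deriv i f x)"

fun C_k :: "nat \<Rightarrow> (real^'n::finite \<Rightarrow> real) \<Rightarrow> bool" where
  "C_k 0 f \<longleftrightarrow> continuous_on UNIV f"
| "C_k (Suc k) f \<longleftrightarrow> (\<forall>x. f differentiable (at x)) \<and> (\<forall>i. C_k k (partial_deriv i f))"

text \<open>\<open>C\<^sub>0\<^sup>\<infinity>(\<Omega>)\<close>, each function being extended by zero to the whole space.\<close>

definition test_functions :: "(real^'n::finite) set \<Rightarrow> (real^'n \<Rightarrow> real) set" where
  "test_functions \<Omega> =
     {\<phi>. (\<forall>k. C_k k \<phi>) \<and> compact (closure {x. \<phi> x \<noteq> 0}) \<and> closure {x. \<phi> x \<noteq> 0} \<subseteq> \<Omega>}"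

text \<open>
  Near each boundary point, \<open>\<Omega>\<close> is the side \<open>x \<bullet> \<nu> > \<gamma>(x')\<close> of a \<open>C\<^sup>2\<close> graph, where \<open>x'\<close> is the
  orthogonal projection of \<open>x\<close> to the hyperplane orthogonal to the unit vector \<open>\<nu>\<close>.
\<close>

definition C2_boundary :: "(real^'n::finite) set \<Rightarrow> bool" where
  "C2_boundary \<Omega> \<longleftrightarrow>
     (\<forall>p\<in>frontier \<Omega>. \<exists>r>0. \<exists>\<nu> \<gamma>. norm \<nu> = 1 \<and> C_k 2 \<gamma> \<and>
        (\<forall>x\<in>ball p r. x \<in> \<Omega> \<longleftrightarrow> x \<bullet> \<nu> > \<gamma> (x - (x \<bullet> \<nu>) *\<^sub>R \<nu>)))"

text \<open>
  The last condition says that \<open>\<partial>\<Omega>\<close> has a flat part on the degeneracy hyperplane: some nonempty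
  relatively open subset of \<open>\<partial>\<Omega>\<close> lies in \<open>{x\<^sub>N = 0}\<close>. It is implied by openness of the full
  intersection \<open>\<partial>\<Omega> \<inter> {x\<^sub>N = 0}\<close> in \<open>\<partial>\<Omega>\<close>; the latter is not required, because this intersection is
  compact and, for \<open>N \<ge> 2\<close>, would then be a nonempty compact open subset of a hyperplane.
\<close>

definition degenerate_domain :: "'n::finite \<Rightarrow> (real^'n) set \<Rightarrow> bool" where
  "degenerate_domain l \<Omega> \<longleftrightarrow>
     open \<Omega> \<and> connected \<Omega> \<and> \<Omega> \<noteq> {} \<and> bounded \<Omega> \<and> C2_boundary \<Omega> \<and>
     \<Omega> \<subseteq> closure {x. x $ l > 0} \<and>
     (\<exists>\<Gamma>. openin (top_of_set (frontier \<Omega>)) \<Gamma> \<and> \<Gamma> \<noteq> {} \<and> \<Gamma> \<subseteq> {x. x $ l = 0})"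


section \<open>Lebesgue spaces and weak derivatives\<close>

definition L2_on :: "(real^'n::finite) set \<Rightarrow> (real^'n \<Rightarrow> real) set" where
  "L2_on \<Omega> = {u. u \<in> borel_measurable (lebesgue_on \<Omega>) \<and> integrable (lebesgue_on \<Omega>) (\<lambda>x. (u x)\<^sup>2)}"

definition L2_inner :: "(real^'n::finite) set \<Rightarrow> (real^'n \<Rightarrow> real) \<Rightarrow> (real^'n \<Rightarrow> real) \<Rightarrow> real" where
  "L2_inner \<Omega> u v = (\<integral>x. u x * v x \<partial>(lebesgue_on \<Omega>))"

definition Linf_on :: "(real^'n::finite) set \<Rightarrow> (real^'n \<Rightarrow> real) set" where
  "Linf_on \<Omega> =
     {u. u \<in> borel_measurable (lebesgue_on \<Omega>) \<and> (\<exists>M. AE x in lebesgue_on \<Omega>. \<bar>u x\<bar> \<le> M)}"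

definition L1_loc_on :: "(real^'n::finite) set \<Rightarrow> (real^'n \<Rightarrow> real) set" where
  "L1_loc_on \<Omega> = {u. \<forall>K. compact K \<and> K \<subseteq> \<Omega> \<longrightarrow> integrable (lebesgue_on K) u}"

definition has_weak_partial ::
  "(real^'n::finite) set \<Rightarrow> 'n \<Rightarrow> (real^'n \<Rightarrow> real) \<Rightarrow> (real^'n \<Rightarrow> real) \<Rightarrow> bool" where
  "has_weak_partial \<Omega> i u g \<longleftrightarrow>
     u \<in> L1_loc_on \<Omega> \<and> g \<in> L1_loc_on \<Omega> \<and>
     (\<forall>\<phi>\<in>test_functions \<Omega>.
        (\<integral>x. u x * partial_deriv i \<phi> x \<partial>(lebesgue_on \<Omega>)) = - (\<integral>x. g x * \<phi> x \<partial>(lebesgue_on \<Omega>)))"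

text \<open>Weak derivatives are unique up to null sets; the gradient picks some representative.\<close>

definition weak_gradient :: "(real^'n::finite) set \<Rightarrow> (real^'n \<Rightarrow> real) \<Rightarrow> real^'n \<Rightarrow> real^'n" where
  "weak_gradient \<Omega> u x = (\<chi> i. (SOME g. has_weak_partial \<Omega> i u g) x)"


section \<open>Weighted spaces and the degenerate operator\<close>

definition coeffA :: "'n::finite \<Rightarrow> real \<Rightarrow> real^'n \<Rightarrow> real^'n^'n" where
  "coeffA l \<alpha> x = (\<chi> i j. if i = j then (if i = l then (x $ l) powr \<alpha> else 1) else 0)"

definition form_a ::
  "'n::finite \<Rightarrow> real \<Rightarrow> (real^'n) set \<Rightarrow> (real^'n \<Rightarrow> real) \<Rightarrow> (real^'n \<Rightarrow> real) \<Rightarrow> real" where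
  "form_a l \<alpha> \<Omega> u v =
     (\<integral>x. weak_gradient \<Omega> u x \<bullet> (coeffA l \<alpha> x *v weak_gradient \<Omega> v x) \<partial>(lebesgue_on \<Omega>))"

definition H1w :: "'n::finite \<Rightarrow> real \<Rightarrow> (real^'n) set \<Rightarrow> (real^'n \<Rightarrow> real) set" where
  "H1w l \<alpha> \<Omega> =
     {u \<in> L2_on \<Omega>. (\<forall>i. \<exists>g. has_weak_partial \<Omega> i u g) \<and>
        integrable (lebesgue_on \<Omega>)
          (\<lambda>x. weak_gradient \<Omega> u x \<bullet> (coeffA l \<alpha> x *v weak_gradient \<Omega> u x))}"

definition H1w_norm :: "'n::finite \<Rightarrow> real \<Rightarrow> (real^'n) set \<Rightarrow> (real^'n \<Rightarrow> real) \<Rightarrow> real" where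
  "H1w_norm l \<alpha> \<Omega> u = sqrt (L2_inner \<Omega> u u + form_a l \<alpha> \<Omega> u u)"

definition H10w :: "'n::finite \<Rightarrow> real \<Rightarrow> (real^'n) set \<Rightarrow> (real^'n \<Rightarrow> real) set" where
  "H10w l \<alpha> \<Omega> =
     {u \<in> H1w l \<alpha> \<Omega>. \<forall>\<epsilon>>0. \<exists>\<phi>\<in>test_functions \<Omega>. H1w_norm l \<alpha> \<Omega> (u - \<phi>) < \<epsilon>}"

text \<open>\<open>- div (A \<nabla>u) = f\<close> in the sense of distributions on \<open>\<Omega>\<close>.\<close>

definition neg_div_A ::
  "'n::finite \<Rightarrow> real \<Rightarrow> (real^'n) set \<Rightarrow> (real^'n \<Rightarrow> real) \<Rightarrow> (real^'n \<Rightarrow> real) \<Rightarrow> bool" where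
  "neg_div_A l \<alpha> \<Omega> u f \<longleftrightarrow>
     (\<forall>\<phi>\<in>test_functions \<Omega>.
        (\<integral>x. (coeffA l \<alpha> x *v weak_gradient \<Omega> u x) \<bullet> gradient \<phi> x \<partial>(lebesgue_on \<Omega>))
          = (\<integral>x. f x * \<phi> x \<partial>(lebesgue_on \<Omega>)))"

definition dom_A :: "'n::finite \<Rightarrow> real \<Rightarrow> (real^'n) set \<Rightarrow> (real^'n \<Rightarrow> real) set" where
  "dom_A l \<alpha> \<Omega> = {u \<in> H10w l \<alpha> \<Omega>. \<exists>f\<in>L2_on \<Omega>. neg_div_A l \<alpha> \<Omega> u f}"

definition op_A ::
  "'n::finite \<Rightarrow> real \<Rightarrow> (real^'n) set \<Rightarrow> (real^'n \<Rightarrow> real) \<Rightarrow> real^'n \<Rightarrow> real" where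
  "op_A l \<alpha> \<Omega> u = (SOME f. f \<in> L2_on \<Omega> \<and> neg_div_A l \<alpha> \<Omega> u f)"


section \<open>Strongly continuous semigroups on seminormed spaces\<close>

text \<open>
  A normed space of equivalence classes is given by a linear subspace \<open>X\<close> of representatives and
  the seminorm \<open>nrm\<close> on it; two representatives \<open>x\<close>, \<open>y\<close> are identified when \<open>nrm (x - y) = 0\<close>.
\<close>

definition C0_semigroup ::
  "'a::real_vector set \<Rightarrow> ('a \<Rightarrow> real) \<Rightarrow> (real \<Rightarrow> 'a \<Rightarrow> 'a) \<Rightarrow> bool" where
  "C0_semigroup X nrm S \<longleftrightarrow>
     (\<forall>t\<ge>0. \<forall>x\<in>X. S t x \<in> X) \<and>
     (\<forall>t\<ge>0. \<forall>x\<in>X. \<forall>y\<in>X. \<forall>c d.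
        nrm (S t (c *\<^sub>R x + d *\<^sub>R y) - (c *\<^sub>R S t x + d *\<^sub>R S t y)) = 0) \<and>
     (\<forall>t\<ge>0. \<exists>M. \<forall>x\<in>X. nrm (S t x) \<le> M * nrm x) \<and>
     (\<forall>x\<in>X. nrm (S 0 x - x) = 0) \<and>
     (\<forall>s\<ge>0. \<forall>t\<ge>0. \<forall>x\<in>X. nrm (S (s + t) x - S s (S t x)) = 0) \<and>
     (\<forall>x\<in>X. ((\<lambda>t. nrm (S t x - x)) \<longlongrightarrow> 0) (at_right 0))"

text \<open>The graph of the infinitesimal generator: \<open>y = lim\<^sub>h\<^sub>\<rightarrow>\<^sub>0\<^sub>+ (S h x - x) / h\<close>.\<close>

definition generator_graph ::
  "'a::real_vector set \<Rightarrow> ('a \<Rightarrow> real) \<Rightarrow> (real \<Rightarrow> 'a \<Rightarrow> 'a) \<Rightarrow> ('a \<times> 'a) set" where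
  "generator_graph X nrm S =
     {(x, y). x \<in> X \<and> y \<in> X \<and>
        ((\<lambda>h. nrm ((1 / h) *\<^sub>R (S h x - x) - y)) \<longlongrightarrow> 0) (at_right 0)}"

definition is_semigroup_generated_by ::
  "'a::real_vector set \<Rightarrow> ('a \<Rightarrow> real) \<Rightarrow> 'a set \<Rightarrow> ('a \<Rightarrow> 'a) \<Rightarrow> (real \<Rightarrow> 'a \<Rightarrow> 'a) \<Rightarrow> bool" where
  "is_semigroup_generated_by X nrm D B S \<longleftrightarrow>
     C0_semigroup X nrm S \<and>
     generator_graph X nrm S = {(x, y). x \<in> D \<and> y \<in> X \<and> nrm (y - B x) = 0}"

definition is_mild_solution ::
  "'a::real_vector set \<Rightarrow> ('a \<Rightarrow> real) \<Rightarrow> (real \<Rightarrow> 'a \<Rightarrow> 'a) \<Rightarrow> 'a \<Rightarrow> (real \<Rightarrow> 'a) \<Rightarrow> bool" where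
  "is_mild_solution X nrm S \<Phi>\<^sub>0 \<Phi> \<longleftrightarrow> (\<forall>t\<ge>0. \<Phi> t \<in> X \<and> nrm (\<Phi> t - S t \<Phi>\<^sub>0) = 0)"


section \<open>The damped wave operator\<close>

type_synonym 'n state = "(real^'n \<Rightarrow> real) \<times> (real^'n \<Rightarrow> real)"

definition energy_space :: "'n::finite \<Rightarrow> real \<Rightarrow> (real^'n) set \<Rightarrow> 'n state set" where
  "energy_space l \<alpha> \<Omega> = H10w l \<alpha> \<Omega> \<times> L2_on \<Omega>"

definition energy_inner ::
  "'n::finite \<Rightarrow> real \<Rightarrow> (real^'n) set \<Rightarrow> 'n state \<Rightarrow> 'n state \<Rightarrow> real" where
  "energy_inner l \<alpha> \<Omega> x y = form_a l \<alpha> \<Omega> (fst x) (fst y) + L2_inner \<Omega> (snd x) (snd y)"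

definition energy_norm :: "'n::finite \<Rightarrow> real \<Rightarrow> (real^'n) set \<Rightarrow> 'n state \<Rightarrow> real" where
  "energy_norm l \<alpha> \<Omega> x = sqrt (energy_inner l \<alpha> \<Omega> x x)"

definition dom_wave :: "'n::finite \<Rightarrow> real \<Rightarrow> (real^'n) set \<Rightarrow> 'n state set" where
  "dom_wave l \<alpha> \<Omega> = dom_A l \<alpha> \<Omega> \<times> H10w l \<alpha> \<Omega>"

definition op_wave ::
  "'n::finite \<Rightarrow> real \<Rightarrow> (real^'n) set \<Rightarrow> (real^'n \<Rightarrow> real) \<Rightarrow> 'n state \<Rightarrow> 'n state" where
  "op_wave l \<alpha> \<Omega> V = (\<lambda>(u, v). (- v, op_A l \<alpha> \<Omega> u + (\<lambda>x. V x * v x)))"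

end

theory Submission
  imports Defs
begin

text \<open>
  For a datum in the domain of the generator, the energy of \<open>(u, v) = \<Phi>(t)\<close> decreases at rate \<open>(V v, v)\<close>,
  which controls the kinetic part only. Adding \<open>\<epsilon> ((u, v) + 1/2 (V u, u))\<close> to half the energy gives
  a functional whose derivative is \<open>- (V v, v) + \<epsilon> (\<parallel>v\<parallel>\<^sup>2 - a(u, u))\<close>, and by the Poincare inequality it
  is comparable with the energy for small \<open>\<epsilon>\<close>; so it decays exponentially. The Poincare inequality comes from
  \<open>\<integral> \<phi>\<^sup>2 = - 2 \<integral> x\<^sub>N \<phi> \<partial>\<^sub>N\<phi>\<close>, in which \<open>x\<^sub>N\<close> compensates the weight \<open>x\<^sub>N\<^sup>\<alpha>\<close>. The estimate extends to all
  data because the domain is dense: its orthogonal complement in the complete energy space is null by the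
  Riesz representation theorem in \<open>H\<^sub>0\<^sup>1(\<Omega>; w)\<close>.
\<close>

section \<open>Seminormed spaces and strongly continuous semigroups\<close>

text \<open>The spaces consist of representatives, so every norm is a seminorm and every semigroup
  law holds up to null vectors; the argument runs modulo the relation \<open>eqv\<close>. The
  semigroup is known only through the axioms of \<open>C0_semigroup\<close> and the graph of its
  generator, a limit from the right at 0. Along an orbit this yields right derivatives only, so
  monotonicity needs a one-sided criterion together with continuity of the orbit. Left continuity
  requires a bound on \<open>S t\<close> uniform on compact time intervals, whereas the axioms give
  one bound for each t; this is where uniform boundedness, and with it completeness, enters. The
  functional is polarised to a second inner product, equivalent to the energy. Equivalence preserves
  completeness, strong continuity and the generator, so decay becomes an abstract statement: 2 (x,
  Bx) \<le> - c (x, x) on a dense domain gives the rate c / 2. The summand with V makes the terms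
  coupling V u and v cancel in the derivative, and the upper bound of V enters the constants only
  through the comparison of the functional with the energy.\<close>

definition seminorm_complete :: "'a::real_vector set \<Rightarrow> ('a \<Rightarrow> real) \<Rightarrow> bool" where
  "seminorm_complete X p \<longleftrightarrow>
     (\<forall>f. (\<forall>n. f n \<in> X) \<and> (\<forall>e>0. \<exists>N::nat. \<forall>m\<ge>N. \<forall>n\<ge>N. p (f m - f n) < e) \<longrightarrow>
        (\<exists>x\<in>X. (\<lambda>n. p (f n - x)) \<longlonglongrightarrow> 0))"

lemma seminorm_completeD:
  assumes "seminorm_complete X p" "\<And>n. f n \<in> X"
    and "\<And>e. e > 0 \<Longrightarrow> \<exists>N::nat. \<forall>m\<ge>N. \<forall>n\<ge>N. p (f m - f n) < e"
  shows "\<exists>x\<in>X. (\<lambda>n. p (f n - x)) \<longlonglongrightarrow> 0"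
  using assms(1)[unfolded seminorm_complete_def, rule_format, of f] assms(2,3) by auto

section \<open>Seminorms on a space of representatives, and uniform boundedness\<close>

locale seminormed =
  fixes X :: "'a::real_vector set" and p :: "'a \<Rightarrow> real"
  assumes sub: "subspace X"
    and p_triangle: "x \<in> X \<Longrightarrow> y \<in> X \<Longrightarrow> p (x + y) \<le> p x + p y"
    and p_scale: "x \<in> X \<Longrightarrow> p (c *\<^sub>R x) = \<bar>c\<bar> * p x"
begin

lemma mem [simp, intro]:
  shows "0 \<in> X" and "x \<in> X \<Longrightarrow> y \<in> X \<Longrightarrow> x + y \<in> X"
    and "x \<in> X \<Longrightarrow> y \<in> X \<Longrightarrow> x - y \<in> X" and "x \<in> X \<Longrightarrow> c *\<^sub>R x \<in> X"
    and "x \<in> X \<Longrightarrow> - x \<in> X"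
  using sub by (auto simp: subspace_0 subspace_add subspace_diff subspace_scale subspace_neg)

lemma p_zero [simp]: "p 0 = 0"
  using p_scale[of 0 0] by simp

lemma p_minus: "x \<in> X \<Longrightarrow> p (- x) = p x"
  using p_scale[of x "-1"] by simp

lemma p_nonneg: "x \<in> X \<Longrightarrow> 0 \<le> p x"
  using p_triangle[of x "- x"] p_minus[of x] by simp

lemma p_diff: "x \<in> X \<Longrightarrow> y \<in> X \<Longrightarrow> p (x - y) \<le> p x + p y"
  using p_triangle[of x "- y"] p_minus[of y] by simp

lemma p_commute: "x \<in> X \<Longrightarrow> y \<in> X \<Longrightarrow> p (x - y) = p (y - x)"
  using p_minus[of "x - y"] by simp

lemma p_trans: "x \<in> X \<Longrightarrow> y \<in> X \<Longrightarrow> z \<in> X \<Longrightarrow> p (x - z) \<le> p (x - y) + p (y - z)"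
  using p_triangle[of "x - y" "y - z"] by simp

lemma p_diff_lower: "x \<in> X \<Longrightarrow> y \<in> X \<Longrightarrow> \<bar>p x - p y\<bar> \<le> p (x - y)"
  using p_triangle[of "x - y" y] p_triangle[of "y - x" x] p_commute[of x y] by auto

text \<open>Membership of both sides is built in, so that chains of such identities compose by
  transitivity without side conditions.\<close>

definition eqv :: "'a \<Rightarrow> 'a \<Rightarrow> bool" where
  "eqv x y \<longleftrightarrow> x \<in> X \<and> y \<in> X \<and> p (x - y) = 0"

lemma eqv_refl: "x \<in> X \<Longrightarrow> eqv x x"
  by (simp add: eqv_def)

lemma eqv_sym: "eqv x y \<Longrightarrow> eqv y x"
  using p_commute by (auto simp: eqv_def)

lemma eqv_trans [trans]: "eqv x y \<Longrightarrow> eqv y z \<Longrightarrow> eqv x z"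
  using p_trans[of x y z] p_nonneg[of "x - z"] by (auto simp: eqv_def)

lemma eqv_scale: "eqv x y \<Longrightarrow> eqv (c *\<^sub>R x) (c *\<^sub>R y)"
  using p_scale[of "x - y" c] by (auto simp: eqv_def scaleR_diff_right)

lemma eqv_diff: "eqv x y \<Longrightarrow> eqv x' y' \<Longrightarrow> eqv (x - x') (y - y')"
  using p_diff[of "x - y" "x' - y'"] p_nonneg[of "(x - y) - (x' - y')"]
  by (auto simp: eqv_def algebra_simps)

lemma eqv_p: "eqv x y \<Longrightarrow> p x = p y"
  using p_diff_lower[of x y] by (auto simp: eqv_def)

text \<open>Sokal's proof of the uniform boundedness principle: it constructs the bad vector directly
  and so avoids the Baire category theorem.\<close>

lemma near_optimal_vector:
  assumes q: "\<And>c x. x \<in> X \<Longrightarrow> q (c *\<^sub>R x) = \<bar>c\<bar> * q x"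
    and bnd: "\<And>x. x \<in> X \<Longrightarrow> q x \<le> B * p x"
    and C: "0 \<le> C" and x0: "x0 \<in> X" "q x0 > C * p x0"
  shows "\<exists>M z. M > C \<and> z \<in> X \<and> p z = 1 \<and> q z \<ge> 2 / 3 * M \<and> (\<forall>x\<in>X. q x \<le> M * p x)"
proof -
  define A where "A = {M. 0 \<le> M \<and> (\<forall>x\<in>X. q x \<le> M * p x)}"
  have px0: "p x0 > 0"
    using bnd[OF x0(1)] x0(2) p_nonneg[OF x0(1)] by (cases "p x0 = 0") auto
  have "max B 0 \<in> A"
    unfolding A_def using bnd p_nonneg
    by (auto intro!: order_trans[OF bnd] mult_right_mono)
  then have ne: "A \<noteq> {}" by auto
  have bb: "bdd_below A" unfolding A_def by (auto intro!: bdd_belowI[of _ 0])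
  \<comment> \<open>M is the operator norm of q, the least admissible constant. It is itself
    admissible, and it exceeds C because x0 violates the bound with C.\<close>
  define M where "M = Inf A"
  have M0: "0 \<le> M" unfolding M_def using ne by (intro cInf_greatest) (auto simp: A_def)
  have Mb: "q x \<le> M * p x" if "x \<in> X" for x
  proof (cases "p x = 0")
    case True then show ?thesis using bnd[OF that] by simp
  next
    case False
    then have "p x > 0" using p_nonneg[OF that] by simp
    have "q x / p x \<le> M"
      unfolding M_def using ne \<open>p x > 0\<close> that
      by (intro cInf_greatest) (auto simp: A_def divide_simps)
    then show ?thesis using \<open>p x > 0\<close> by (simp add: divide_simps)
  qed
  have "M > C"
  proof (rule ccontr)
    assume "\<not> M > C"
    then have "M * p x0 \<le> C * p x0" using px0 by simp
    then show False using Mb[OF x0(1)] x0(2) by simp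
  qed
  \<comment> \<open>A factor below 1 is violated by some vector, because M is minimal. It must also
    exceed 1/2, the share of a step that the tail of the series in the next proof can undo.\<close>
  then have "2 / 3 * M < M" using C by simp
  then have "2 / 3 * M \<notin> A" unfolding M_def using cInf_lower[OF _ bb] by fastforce
  then obtain x where x: "x \<in> X" "q x > 2 / 3 * M * p x"
    unfolding A_def using M0 by force
  have px: "p x > 0"
    using bnd[OF x(1)] x(2) p_nonneg[OF x(1)] by (cases "p x = 0") auto
  define z where "z = (1 / p x) *\<^sub>R x"
  have "p z = 1" "z \<in> X" "q z \<ge> 2 / 3 * M"
    unfolding z_def using px x by (auto simp: p_scale q divide_simps)
  then show ?thesis using \<open>M > C\<close> Mb by blast
qed

text \<open>If no common bound exists, some index \<open>n k\<close> has a norm \<open>M k\<close>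
  above any prescribed \<open>c k\<close>, with a nearly extremal unit vector. Steps of length
  3^-(k+1) along these vectors, with suitable signs, converge to one vector at which the k-th chosen
  seminorm is at least k.\<close>

theorem uniform_boundedness:
  assumes compl: "seminorm_complete X p"
    and q_tri: "\<And>n x y. x \<in> X \<Longrightarrow> y \<in> X \<Longrightarrow> q n (x + y) \<le> q n x + q n y"
    and q_scale: "\<And>n c x. x \<in> X \<Longrightarrow> q n (c *\<^sub>R x) = \<bar>c\<bar> * q n x"
    and bnd: "\<And>n. \<exists>B. \<forall>x\<in>X. q n x \<le> B * p x"
    and ptw: "\<And>x. x \<in> X \<Longrightarrow> \<exists>C. \<forall>n. q n x \<le> C"
  shows "\<exists>C. \<forall>n. \<forall>x\<in>X. q n x \<le> C * p x"
proof (rule ccontr)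
  assume neg: "\<not> ?thesis"
  \<comment> \<open>Chosen for the final estimate: step k contributes at least 2/3 of M k *
    3^-(k+1), the later steps remove at most 1/2 of that quantity, and the remaining sixth has to be
    at least k.\<close>
  define c :: "nat \<Rightarrow> real" where "c k = 6 * 3 ^ Suc k * real k" for k
  have "\<exists>n M z. M > c k \<and> z \<in> X \<and> p z = 1 \<and> q n z \<ge> 2 / 3 * M \<and> (\<forall>x\<in>X. q n x \<le> M * p x)" for k
  proof -
    obtain n x0 where x0: "x0 \<in> X" "q n x0 > c k * p x0"
      using neg by (meson not_le)
    obtain B where "\<forall>x\<in>X. q n x \<le> B * p x" using bnd by blast
    then show ?thesis
      using near_optimal_vector[of "q n" B "c k" x0, OF q_scale _ _ x0] by (auto simp: c_def)
  qed
  then obtain n M z where nz: "\<And>k. M k > c k" "\<And>k. z k \<in> X" "\<And>k. p (z k) = 1"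
      "\<And>k. q (n k) (z k) \<ge> 2 / 3 * M k" "\<And>k x. x \<in> X \<Longrightarrow> q (n k) x \<le> M k * p x"
    by metis
  have M_nonneg: "0 \<le> M k" for k
  proof -
    have "0 \<le> c k" by (simp add: c_def)
    then show ?thesis using nz(1)[of k] by linarith
  qed
  define Q where "Q k = q (n k)" for k
  define a where "a k = ((1 / 3) ^ Suc k) *\<^sub>R z k" for k
  have a: "a k \<in> X" "p (a k) = (1 / 3) ^ Suc k" "Q k (a k) \<ge> 2 / 3 * M k * (1 / 3) ^ Suc k" for k
    using nz(2,3,4)[of k] by (auto simp: a_def Q_def p_scale q_scale field_simps)
  \<comment> \<open>Twice a k is the difference of x + a k and x - a k, so one of these two has
    seminorm at least that of a k, whatever x is. The sign of the step follows that choice.\<close>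
  define x where "x = rec_nat 0 (\<lambda>k xk. if Q k (xk + a k) \<ge> Q k (a k) then xk + a k else xk - a k)"
  have xS: "x (Suc k) = (if Q k (x k + a k) \<ge> Q k (a k) then x k + a k else x k - a k)" for k
    by (simp add: x_def)
  have xX: "x k \<in> X" for k
  proof (induction k)
    case 0 show ?case by (simp add: x_def)
  next
    case (Suc k) then show ?case using a(1)[of k] by (auto simp: xS)
  qed
  have Qx: "Q k (x (Suc k)) \<ge> Q k (a k)" for k
  proof -
    have "2 *\<^sub>R a k = (x k + a k) + (- 1) *\<^sub>R (x k - a k)" by (simp add: scaleR_2)
    then have "2 * Q k (a k) \<le> Q k (x k + a k) + Q k (x k - a k)"
      using q_tri[of "x k + a k" "(-1) *\<^sub>R (x k - a k)" "n k"] q_scale[of "x k - a k" "n k" "-1"]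
        q_scale[of "a k" "n k" 2] xX[of k] a(1)[of k] mem(2,3,4) unfolding Q_def by simp
    then show ?thesis by (auto simp: xS)
  qed
  have step: "p (x (Suc k) - x k) = (1 / 3) ^ Suc k" for k
    using a[of k] p_minus[OF a(1)[of k]] by (auto simp: xS)
  \<comment> \<open>Geometric series: all steps from index k on have total length at most 1/2 *
    3^-k. Read at k + 1, this is half the length of the step just made.\<close>
  have dist: "p (x (k + m) - x k) \<le> 1 / 2 * (1 / 3) ^ k * (1 - (1 / 3) ^ m)" for k m
  proof (induction m)
    case 0 show ?case by simp
  next
    case (Suc m)
    have "p (x (k + Suc m) - x k) \<le> p (x (Suc (k + m)) - x (k + m)) + p (x (k + m) - x k)"
      using p_trans[OF xX xX xX] by simp
    also have "\<dots> \<le> (1 / 3) ^ Suc (k + m) + 1 / 2 * (1 / 3) ^ k * (1 - (1 / 3) ^ m)"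
      using Suc step by (metis add_left_mono)
    also have "\<dots> = 1 / 2 * (1 / 3) ^ k * (1 - (1 / 3) ^ Suc m)"
      by (simp add: power_add field_simps)
    finally show ?case .
  qed
  have dist': "p (x m - x k) \<le> 1 / 2 * (1 / 3) ^ k" if "m \<ge> k" for m k
  proof -
    have "p (x m - x k) \<le> 1 / 2 * (1 / 3) ^ k * (1 - (1 / 3) ^ (m - k))"
      using dist[of k "m - k"] that by simp
    also have "\<dots> \<le> 1 / 2 * (1 / 3) ^ k * 1" by (intro mult_left_mono) auto
    finally show ?thesis by simp
  qed
  have "\<exists>N. \<forall>m\<ge>N. \<forall>k\<ge>N. p (x m - x k) < e" if "e > 0" for e
  proof -
    obtain N where N: "(1 / 3 :: real) ^ N < e" using real_arch_pow_inv[of e "1/3"] \<open>e > 0\<close> by auto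
    have "p (x m - x k) < e" if "m \<ge> N" "k \<ge> N" for m k
      using p_trans[OF xX[of m] xX[of N] xX[of k]] dist'[OF that(1)] dist'[OF that(2)]
        p_commute[OF xX[of k] xX[of N]] N by simp
    then show ?thesis by blast
  qed
  then obtain L where L: "L \<in> X" "(\<lambda>n. p (x n - L)) \<longlonglongrightarrow> 0"
    using seminorm_completeD[of X p x, OF compl xX] by meson
  have Ld: "p (L - x k) \<le> 1 / 2 * (1 / 3) ^ k" for k
  proof (rule LIMSEQ_le_const)
    show "(\<lambda>m. p (x m - L) + 1 / 2 * (1 / 3) ^ k) \<longlonglongrightarrow> 1 / 2 * (1 / 3) ^ k"
      using tendsto_add[OF L(2) tendsto_const] by simp
    have "p (L - x k) \<le> p (x m - L) + 1 / 2 * (1 / 3) ^ k" if "m \<ge> k" for m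
      using p_trans[OF L(1) xX[of m] xX[of k]] dist'[OF that] p_commute[OF L(1) xX[of m]] by simp
    then show "\<exists>N. \<forall>m\<ge>N. p (L - x k) \<le> p (x m - L) + 1 / 2 * (1 / 3) ^ k" by blast
  qed
  have big: "Q k L \<ge> real k" for k
  proof -
    have "x (Suc k) = L + (- 1) *\<^sub>R (L - x (Suc k))" by simp
    then have "Q k (x (Suc k)) \<le> Q k L + Q k (L - x (Suc k))"
      using q_tri[of L "(-1) *\<^sub>R (L - x (Suc k))" "n k"] q_scale[of "L - x (Suc k)" "n k" "-1"]
        L(1) xX[of "Suc k"] mem(3,4) unfolding Q_def by simp
    moreover have "Q k (L - x (Suc k)) \<le> M k * p (L - x (Suc k))"
      unfolding Q_def using nz(5) L(1) xX by blast
    moreover have "M k * p (L - x (Suc k)) \<le> M k * (1 / 2 * (1 / 3) ^ Suc k)"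
      by (rule mult_left_mono[OF Ld M_nonneg])
    ultimately have "Q k L \<ge> M k * (1 / 6 * (1 / 3) ^ Suc k)"
      using Qx[of k] a(3)[of k] by (simp add: algebra_simps)
    moreover have "M k * (1 / 6 * (1 / 3) ^ Suc k) \<ge> c k * (1 / 6 * (1 / 3) ^ Suc k)"
      using nz(1)[of k] by (intro mult_right_mono) auto
    moreover have "c k * (1 / 6 * (1 / 3) ^ Suc k) = real k"
      by (simp add: c_def power_divide)
    ultimately show ?thesis by linarith
  qed
  obtain C where C: "\<forall>n. q n L \<le> C" using ptw[OF L(1)] by blast
  obtain k where "real k > C" using reals_Archimedean2 by blast
  then show False using big[of k] C unfolding Q_def by (meson not_le order_trans)
qed

end

section \<open>Orbits of strongly continuous semigroups\<close>

locale C0_semigroup_on = seminormed X p for X :: "'a::real_vector set" and p +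
  fixes S :: "real \<Rightarrow> 'a \<Rightarrow> 'a"
  assumes C0: "C0_semigroup X p S"
begin

lemma S_mem [simp]: "t \<ge> 0 \<Longrightarrow> x \<in> X \<Longrightarrow> S t x \<in> X"
  using C0 by (simp add: C0_semigroup_def)

lemma S_lin: "t \<ge> 0 \<Longrightarrow> x \<in> X \<Longrightarrow> y \<in> X \<Longrightarrow> eqv (S t (c *\<^sub>R x + d *\<^sub>R y)) (c *\<^sub>R S t x + d *\<^sub>R S t y)"
  using C0 by (auto simp: C0_semigroup_def eqv_def)

lemma S_diff: "t \<ge> 0 \<Longrightarrow> x \<in> X \<Longrightarrow> y \<in> X \<Longrightarrow> eqv (S t (x - y)) (S t x - S t y)"
  using S_lin[of t x y 1 "-1"] by simp

lemma S_scale: "t \<ge> 0 \<Longrightarrow> x \<in> X \<Longrightarrow> eqv (S t (c *\<^sub>R x)) (c *\<^sub>R S t x)"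
  using S_lin[of t x x c 0] by simp

lemma S_bounded: "t \<ge> 0 \<Longrightarrow> \<exists>M. \<forall>x\<in>X. p (S t x) \<le> M * p x"
  using C0 by (simp add: C0_semigroup_def)

lemma S_zero: "x \<in> X \<Longrightarrow> eqv (S 0 x) x"
  using C0 by (auto simp: C0_semigroup_def eqv_def)

lemma S_add: "s \<ge> 0 \<Longrightarrow> t \<ge> 0 \<Longrightarrow> x \<in> X \<Longrightarrow> eqv (S (s + t) x) (S s (S t x))"
  using C0 by (auto simp: C0_semigroup_def eqv_def)

lemma S_lim: "x \<in> X \<Longrightarrow> ((\<lambda>t. p (S t x - x)) \<longlongrightarrow> 0) (at_right 0)"
  using C0 by (simp add: C0_semigroup_def)

lemma S_near_zero: "x \<in> X \<Longrightarrow> e > 0 \<Longrightarrow> \<exists>d>0. \<forall>t. 0 \<le> t \<and> t < d \<longrightarrow> p (S t x - x) < e"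
proof -
  assume x: "x \<in> X" and e: "e > 0"
  have "eventually (\<lambda>t. p (S t x - x) < e) (at_right 0)"
    using order_tendstoD(2)[OF S_lim[OF x] e] .
  then obtain d where d: "d > 0" "\<forall>t>0. t < d \<longrightarrow> p (S t x - x) < e"
    unfolding eventually_at_right_field by auto
  have "p (S 0 x - x) < e" using S_zero[OF x] e by (simp add: eqv_def)
  then have "\<forall>t. 0 \<le> t \<and> t < d \<longrightarrow> p (S t x - x) < e" using d(2) by (metis less_eq_real_def)
  then show ?thesis using d(1) by blast
qed

text \<open>Otherwise the bounds of S blow up along times \<open>\<tau> n\<close> tending to 0. For
  fixed x, strong continuity controls all but finitely many of the values p (S (\<tau> n) x), so
  uniform boundedness contradicts the blow-up.\<close>

lemma locally_bounded:
  assumes compl: "seminorm_complete X p"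
  shows "\<exists>d>0. \<exists>M. \<forall>t. 0 \<le> t \<and> t \<le> d \<longrightarrow> (\<forall>x\<in>X. p (S t x) \<le> M * p x)"
proof (rule ccontr)
  assume neg: "\<not> ?thesis"
  have "\<exists>t x. 0 \<le> t \<and> t \<le> 1 / real (Suc n) \<and> x \<in> X \<and> p (S t x) > real n * p x" for n
    using neg by (metis not_le of_nat_0_less_iff zero_less_Suc zero_less_divide_1_iff)
  then obtain \<tau> y where ty: "\<And>n. 0 \<le> \<tau> n" "\<And>n. \<tau> n \<le> 1 / real (Suc n)" "\<And>n. y n \<in> X"
      "\<And>n. p (S (\<tau> n) (y n)) > real n * p (y n)" by metis
  have "\<exists>C. \<forall>n. \<forall>x\<in>X. p (S (\<tau> n) x) \<le> C * p x"
  proof (rule uniform_boundedness[OF compl])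
    fix n x z assume X: "x \<in> X" "z \<in> X"
    have "p (S (\<tau> n) (x + z)) = p (S (\<tau> n) x + S (\<tau> n) z)"
      using eqv_p[OF S_lin[of "\<tau> n" x z 1 1]] X ty(1) by simp
    also have "\<dots> \<le> p (S (\<tau> n) x) + p (S (\<tau> n) z)" using X ty(1) by (intro p_triangle) auto
    finally show "p (S (\<tau> n) (x + z)) \<le> p (S (\<tau> n) x) + p (S (\<tau> n) z)" .
  next
    fix n c x assume X: "x \<in> X"
    show "p (S (\<tau> n) (c *\<^sub>R x)) = \<bar>c\<bar> * p (S (\<tau> n) x)"
      using eqv_p[OF S_scale[of "\<tau> n" x c]] X ty(1)[of n] p_scale[of "S (\<tau> n) x" c] by simp
  next
    fix n show "\<exists>B. \<forall>x\<in>X. p (S (\<tau> n) x) \<le> B * p x" using S_bounded ty(1) by blast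
  next
    fix x assume X: "x \<in> X"
    obtain d where d: "d > 0" "\<And>t. 0 \<le> t \<Longrightarrow> t < d \<Longrightarrow> p (S t x - x) < 1"
      using S_near_zero[OF X, of 1] by auto
    obtain N where N: "1 / real (Suc N) < d" using d(1) nat_approx_posE by blast
    have late: "p (S (\<tau> n) x) \<le> p x + 1" if "n \<ge> N" for n
    proof -
      have "1 / real (Suc n) \<le> 1 / real (Suc N)" using that by (simp add: field_simps)
      then have "\<tau> n < d" using ty(2)[of n] N by linarith
      then show ?thesis
        using d(2)[OF ty(1)] p_diff_lower[of "S (\<tau> n) x" x] X ty(1)[of n] by fastforce
    qed
    have "p (S (\<tau> n) x) \<le> p x + 1 + (\<Sum>k<N. p (S (\<tau> k) x))" for n
    proof (cases "n < N")
      case True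
      have "p (S (\<tau> n) x) \<le> (\<Sum>k<N. p (S (\<tau> k) x))"
        using True X ty(1) by (intro member_le_sum) (auto intro!: p_nonneg)
      then show ?thesis using p_nonneg[OF X] by simp
    next
      case False
      have "0 \<le> (\<Sum>k<N. p (S (\<tau> k) x))" using X ty(1) by (intro sum_nonneg) (auto intro!: p_nonneg)
      then show ?thesis using late[of n] False by simp
    qed
    then show "\<exists>C. \<forall>n. p (S (\<tau> n) x) \<le> C" by blast
  qed
  then obtain C where C: "\<And>n x. x \<in> X \<Longrightarrow> p (S (\<tau> n) x) \<le> C * p x" by blast
  obtain n where n: "real n > C" using reals_Archimedean2 by blast
  have "real n * p (y n) < C * p (y n)" using C[OF ty(3)] ty(4) by (meson order_less_le_trans)
  then show False using mult_right_mono[of C "real n" "p (y n)"] n p_nonneg[OF ty(3)[of n]] by linarith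
qed

lemma bounded_on_intervals:
  assumes compl: "seminorm_complete X p" and T: "T \<ge> 0"
  shows "\<exists>M\<ge>0. \<forall>t\<in>{0..T}. \<forall>x\<in>X. p (S t x) \<le> M * p x"
proof -
  obtain d M0 where d: "d > 0" "\<And>t x. 0 \<le> t \<Longrightarrow> t \<le> d \<Longrightarrow> x \<in> X \<Longrightarrow> p (S t x) \<le> M0 * p x"
    using locally_bounded[OF compl] by blast
  \<comment> \<open>With M at least 1 its powers increase, so times that need fewer steps of length
    d obey the larger bound too.\<close>
  define M where "M = max M0 1"
  have M: "p (S t x) \<le> M * p x" if "0 \<le> t" "t \<le> d" "x \<in> X" for t x
    using d(2)[OF that] mult_right_mono[of M0 M "p x"] p_nonneg[OF that(3)]
    by (simp add: M_def)
  have M1: "M \<ge> 1" by (simp add: M_def)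
  have *: "\<forall>t. 0 \<le> t \<and> t \<le> real n * d \<longrightarrow> (\<forall>x\<in>X. p (S t x) \<le> M ^ Suc n * p x)" for n
  proof (induction n)
    case 0 show ?case using M[of 0] d(1) by auto
  next
    case (Suc n)
    show ?case
    proof (intro allI impI ballI)
      fix t x assume t: "0 \<le> t \<and> t \<le> real (Suc n) * d" and x: "x \<in> X"
      show "p (S t x) \<le> M ^ Suc (Suc n) * p x"
      proof (cases "t \<le> d")
        case True
        have "M * p x \<le> M ^ Suc (Suc n) * p x"
          using M1 p_nonneg[OF x] by (intro mult_right_mono) (auto intro!: self_le_power simp del: power_Suc)
        then show ?thesis using M[of t x] True t x by linarith
      next
        case False
        have "p (S t x) = p (S d (S (t - d) x))"
          using eqv_p[OF S_add[of d "t - d" x]] False d(1) x by simp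
        also have "\<dots> \<le> M * p (S (t - d) x)" using M False d(1) x by simp
        also have "\<dots> \<le> M * (M ^ Suc n * p x)"
          using Suc.IH[rule_format, of "t - d" x] False t x M1
          by (intro mult_left_mono) (auto simp: algebra_simps)
        finally show ?thesis by (simp add: mult.assoc)
      qed
    qed
  qed
  obtain n where "T < real n * d" using d(1) reals_Archimedean3 by blast
  then have "\<forall>t\<in>{0..T}. \<forall>x\<in>X. p (S t x) \<le> M ^ Suc n * p x" using *[of n] by auto
  moreover have "M ^ Suc n \<ge> 0" using M1 by simp
  ultimately show ?thesis by blast
qed

text \<open>For t \<le> s the increment is, up to \<open>eqv\<close>, S t applied to S (s - t) x -
  x. A bound on S t that is uniform in t therefore reduces continuity from both sides to continuity
  at time 0.\<close>

lemma continuous_orbit: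
  assumes compl: "seminorm_complete X p" and T: "T \<ge> 0" and x: "x \<in> X"
  shows "continuous_on {0..T} (\<lambda>t. p (S t x))"
proof -
  obtain M where M: "M \<ge> 0" "\<And>t x. 0 \<le> t \<Longrightarrow> t \<le> T \<Longrightarrow> x \<in> X \<Longrightarrow> p (S t x) \<le> M * p x"
    using bounded_on_intervals[OF compl T] by (metis atLeastAtMost_iff)
  have main: "\<bar>p (S s x) - p (S t x)\<bar> \<le> M * p (S (s - t) x - x)" if "0 \<le> t" "t \<le> s" "s \<le> T" for s t
  proof -
    have "eqv (S s x) (S t (S (s - t) x))" using S_add[of t "s - t" x] that x by simp
    then have "eqv (S s x - S t x) (S t (S (s - t) x) - S t x)"
      using that x by (intro eqv_diff) (auto intro: eqv_refl)
    also have "eqv (S t (S (s - t) x) - S t x) (S t (S (s - t) x - x))"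
      using that x by (intro eqv_sym[OF S_diff]) auto
    finally have "p (S s x - S t x) = p (S t (S (s - t) x - x))" by (rule eqv_p)
    also have "\<dots> \<le> M * p (S (s - t) x - x)" using M(2) that x by simp
    finally show ?thesis using p_diff_lower[of "S s x" "S t x"] that x by simp
  qed
  show ?thesis
  proof (rule continuous_onI)
    fix t e :: real assume t: "t \<in> {0..T}" and e: "e > 0"
    have "e / (M + 1) > 0" using e M(1) by simp
    then obtain d where d: "d > 0" "\<And>h. 0 \<le> h \<Longrightarrow> h < d \<Longrightarrow> p (S h x - x) < e / (M + 1)"
      using S_near_zero[OF x] by blast
    have small: "M * p (S h x - x) \<le> e" if "0 \<le> h" "h < d" for h
    proof -
      have "M * p (S h x - x) \<le> M * (e / (M + 1))"
        using d(2)[OF that] M(1) by (intro mult_left_mono) auto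
      also have "\<dots> \<le> e" using M(1) e by (simp add: divide_simps)
      finally show ?thesis .
    qed
    have "dist (p (S s x)) (p (S t x)) \<le> e" if "s \<in> {0..T}" "dist s t < d" for s
    proof (cases "t \<le> s")
      case True
      then show ?thesis using main[of t s] small[of "s - t"] that t by (auto simp: dist_real_def)
    next
      case False
      then show ?thesis using main[of s t] small[of "t - s"] that t by (auto simp: dist_real_def)
    qed
    then show "\<exists>d>0. \<forall>x'\<in>{0..T}. dist x' t < d \<longrightarrow> dist (p (S x' x)) (p (S t x)) \<le> e"
      using d(1) by blast
  qed
qed

text \<open>S t commutes with the difference quotients up to \<open>eqv\<close>, and its bound for
  this fixed t carries the limit over. An orbit starting in the domain can thus be differentiated at
  every time.\<close>

lemma generator_graph_invariant:
  assumes xy: "(x, y) \<in> generator_graph X p S" and t: "t \<ge> 0"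
  shows "(S t x, S t y) \<in> generator_graph X p S"
proof -
  have X: "x \<in> X" "y \<in> X" and lim: "((\<lambda>h. p ((1 / h) *\<^sub>R (S h x - x) - y)) \<longlongrightarrow> 0) (at_right 0)"
    using xy by (auto simp: generator_graph_def)
  obtain M where M: "\<And>x. x \<in> X \<Longrightarrow> p (S t x) \<le> M * p x" using S_bounded[OF t] by blast
  have *: "p ((1 / h) *\<^sub>R (S h (S t x) - S t x) - S t y) \<le> M * p ((1 / h) *\<^sub>R (S h x - x) - y)"
    if h: "h > 0" for h
  proof -
    have "eqv (S h (S t x)) (S (h + t) x)" using eqv_sym[OF S_add[of h t x]] h t X by simp
    also have "eqv (S (h + t) x) (S t (S h x))" using S_add[of t h x] h t X by (simp add: add.commute)
    finally have 1: "eqv (S h (S t x)) (S t (S h x))" .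
    have "eqv (S h (S t x) - S t x) (S t (S h x) - S t x)"
      using 1 t X by (intro eqv_diff eqv_refl) auto
    also have "eqv (S t (S h x) - S t x) (S t (S h x - x))"
      using h t X by (intro eqv_sym[OF S_diff]) auto
    finally have "eqv ((1 / h) *\<^sub>R (S h (S t x) - S t x)) ((1 / h) *\<^sub>R S t (S h x - x))"
      by (rule eqv_scale)
    also have "eqv ((1 / h) *\<^sub>R S t (S h x - x)) (S t ((1 / h) *\<^sub>R (S h x - x)))"
      using h t X by (intro eqv_sym[OF S_scale]) auto
    finally have "eqv ((1 / h) *\<^sub>R (S h (S t x) - S t x) - S t y) (S t ((1 / h) *\<^sub>R (S h x - x)) - S t y)"
      using t X by (intro eqv_diff eqv_refl) auto
    also have "eqv (S t ((1 / h) *\<^sub>R (S h x - x)) - S t y) (S t ((1 / h) *\<^sub>R (S h x - x) - y))"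
      using h t X by (intro eqv_sym[OF S_diff]) auto
    finally have "p ((1 / h) *\<^sub>R (S h (S t x) - S t x) - S t y) = p (S t ((1 / h) *\<^sub>R (S h x - x) - y))"
      by (rule eqv_p)
    also have "\<dots> \<le> M * p ((1 / h) *\<^sub>R (S h x - x) - y)" using M h X by simp
    finally show ?thesis .
  qed
  have "((\<lambda>h. p ((1 / h) *\<^sub>R (S h (S t x) - S t x) - S t y)) \<longlongrightarrow> 0) (at_right 0)"
  proof (rule tendsto_sandwich[where f = "\<lambda>_. 0"])
    show "\<forall>\<^sub>F h in at_right 0. 0 \<le> p ((1 / h) *\<^sub>R (S h (S t x) - S t x) - S t y)"
      using t X by (intro eventually_at_rightI[of 0 1]) (auto intro!: p_nonneg)
    show "\<forall>\<^sub>F h in at_right 0. p ((1 / h) *\<^sub>R (S h (S t x) - S t x) - S t y)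
            \<le> M * p ((1 / h) *\<^sub>R (S h x - x) - y)"
      using * by (intro eventually_at_rightI[of 0 1]) auto
    show "((\<lambda>h. M * p ((1 / h) *\<^sub>R (S h x - x) - y)) \<longlongrightarrow> 0) (at_right 0)"
      using tendsto_mult_right_zero[OF lim] by simp
  qed simp
  then show ?thesis using X t by (simp add: generator_graph_def)
qed

end

text \<open>A small slope e > 0 is allowed first. The set of points where the graph lies below the
  line of slope e through the starting point is closed; at its last point s < b a right derivative
  \<le> 0 < e would put points beyond s into the set. Hence s = b, and e tends to 0.\<close>

lemma right_derivative_nonpos_imp_le:
  fixes f :: "real \<Rightarrow> real"
  assumes ab: "a \<le> b" and cont: "continuous_on {a..b} f"
    and der: "\<And>t. a \<le> t \<Longrightarrow> t < b \<Longrightarrow> \<exists>D\<le>0. ((\<lambda>h. (f (t + h) - f t) / h) \<longlongrightarrow> D) (at_right 0)"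
  shows "f b \<le> f a"
proof -
  have main: "f b - f a \<le> e * (b - a)" if e: "e > 0" for e
  proof -
    define A where "A = {t \<in> {a..b}. f t - e * t \<le> f a - e * a}"
    have "closed A" unfolding A_def
      by (intro continuous_on_closed_Collect_le continuous_intros cont)
    moreover have "bounded A" unfolding A_def by (rule bounded_subset[of "{a..b}"]) auto
    moreover have "a \<in> A" using ab by (auto simp: A_def)
    ultimately obtain s where s: "s \<in> A" "\<And>t. t \<in> A \<Longrightarrow> t \<le> s"
      using compact_attains_sup[of A] by (auto simp: compact_eq_bounded_closed)
    have "s = b"
    proof (rule ccontr)
      assume "s \<noteq> b"
      then have sb: "a \<le> s" "s < b" using s(1) by (auto simp: A_def)
      then obtain D where D: "D \<le> 0" "((\<lambda>h. (f (s + h) - f s) / h) \<longlongrightarrow> D) (at_right 0)"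
        using der by blast
      have "\<forall>\<^sub>F h in at_right 0. (f (s + h) - f s) / h < e"
        using order_tendstoD(2)[OF D(2), of e] D(1) e by simp
      then obtain d where d: "d > 0" "\<forall>h>0. h < d \<longrightarrow> (f (s + h) - f s) / h < e"
        unfolding eventually_at_right_field by auto
      define h where "h = min (d / 2) (b - s)"
      have h: "h > 0" "h < d" "s + h \<le> b" using d(1) sb by (auto simp: h_def min_def)
      then have "f (s + h) - f s < e * h" using d(2) by (simp add: divide_simps)
      then have "s + h \<in> A" using s(1) h sb by (auto simp: A_def algebra_simps)
      then show False using s(2) h(1) by fastforce
    qed
    then show ?thesis using s(1) by (simp add: A_def algebra_simps)
  qed
  show ?thesis
  proof (rule field_le_epsilon)
    fix e :: real assume e: "e > 0"
    have "e / (b - a + 1) > 0" using e ab by simp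
    then have "f b - f a \<le> e / (b - a + 1) * (b - a)" by (rule main)
    also have "\<dots> \<le> e" using e ab by (simp add: divide_simps)
    finally show "f b \<le> f a + e" by simp
  qed
qed

section \<open>Semi-inner products: projection, Riesz representation, and decay of
  semigroups\<close>

locale semi_inner =
  fixes X :: "'a::real_vector set" and ip :: "'a \<Rightarrow> 'a \<Rightarrow> real"
  assumes sub: "subspace X"
    and ip_sym: "x \<in> X \<Longrightarrow> y \<in> X \<Longrightarrow> ip x y = ip y x"
    and ip_add: "x \<in> X \<Longrightarrow> y \<in> X \<Longrightarrow> z \<in> X \<Longrightarrow> ip (x + y) z = ip x z + ip y z"
    and ip_scale: "x \<in> X \<Longrightarrow> z \<in> X \<Longrightarrow> ip (c *\<^sub>R x) z = c * ip x z"
    and ip_nonneg: "x \<in> X \<Longrightarrow> 0 \<le> ip x x"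
begin

abbreviation nrm :: "'a \<Rightarrow> real" where "nrm x \<equiv> sqrt (ip x x)"

lemma memX [simp, intro]:
  shows "0 \<in> X" and "x \<in> X \<Longrightarrow> y \<in> X \<Longrightarrow> x + y \<in> X"
    and "x \<in> X \<Longrightarrow> y \<in> X \<Longrightarrow> x - y \<in> X" and "x \<in> X \<Longrightarrow> c *\<^sub>R x \<in> X"
  using sub by (auto simp: subspace_0 subspace_add subspace_diff subspace_scale)

lemma ip_add_right: "x \<in> X \<Longrightarrow> y \<in> X \<Longrightarrow> z \<in> X \<Longrightarrow> ip z (x + y) = ip z x + ip z y"
  using ip_add ip_sym by simp

lemma ip_scale_right: "x \<in> X \<Longrightarrow> z \<in> X \<Longrightarrow> ip z (c *\<^sub>R x) = c * ip z x"
  using ip_scale ip_sym by simp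

lemma ip_diff: "x \<in> X \<Longrightarrow> y \<in> X \<Longrightarrow> z \<in> X \<Longrightarrow> ip (x - y) z = ip x z - ip y z"
  using ip_add[of x "(-1) *\<^sub>R y" z] ip_scale[of y z "-1"] memX(4)[of y "-1"] by simp

lemma ip_diff_right: "x \<in> X \<Longrightarrow> y \<in> X \<Longrightarrow> z \<in> X \<Longrightarrow> ip z (x - y) = ip z x - ip z y"
  using ip_diff ip_sym by simp

lemmas ip_simps = ip_add ip_add_right ip_scale ip_scale_right ip_diff ip_diff_right

lemma nrm_sq: "x \<in> X \<Longrightarrow> (nrm x)\<^sup>2 = ip x x"
  using ip_nonneg by simp

lemma Cauchy_Schwarz_sq:
  assumes X: "x \<in> X" "y \<in> X" shows "(ip x y)\<^sup>2 \<le> ip x x * ip y y"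
proof -
  have q: "0 \<le> ip x x + 2 * t * ip x y + t\<^sup>2 * ip y y" for t
    using ip_nonneg[of "x + t *\<^sub>R y"] X ip_sym[of x y]
    by (simp add: ip_simps power2_eq_square algebra_simps)
  show ?thesis
  proof (cases "ip y y = 0")
    case True
    have "ip x y = 0"
    proof (rule ccontr)
      assume "ip x y \<noteq> 0"
      \<comment> \<open>If y is null the expression is affine in t, and this t gives it the value
        -1.\<close>
      then show False using q[of "- (ip x x + 1) / (2 * ip x y)"] True ip_nonneg[OF X(1)]
        by (simp add: field_simps)
    qed
    then show ?thesis using True by simp
  next
    case False
    then have pos: "ip y y > 0" using ip_nonneg[OF X(2)] by simp
    \<comment> \<open>The value of the quadratic at its minimum t = - (x, y) / (y, y).\<close>
    have "0 \<le> ip x x - (ip x y)\<^sup>2 / ip y y"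
      using q[of "- ip x y / ip y y"] pos by (simp add: power2_eq_square field_simps)
    then show ?thesis using pos by (simp add: field_simps)
  qed
qed

lemma Cauchy_Schwarz: "x \<in> X \<Longrightarrow> y \<in> X \<Longrightarrow> \<bar>ip x y\<bar> \<le> nrm x * nrm y"
  using real_sqrt_le_mono[OF Cauchy_Schwarz_sq[of x y]] by (simp add: real_sqrt_mult)

sublocale seminormed X nrm
proof
  show "subspace X" by (rule sub)
next
  fix x y assume X: "x \<in> X" "y \<in> X"
  have "ip (x + y) (x + y) = ip x x + 2 * ip x y + ip y y"
    using X ip_sym[of x y] by (simp add: ip_simps)
  also have "\<dots> \<le> (nrm x)\<^sup>2 + 2 * (nrm x * nrm y) + (nrm y)\<^sup>2"
    using Cauchy_Schwarz[OF X] X by (simp add: nrm_sq)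
  also have "\<dots> = (nrm x + nrm y)\<^sup>2" by (simp add: power2_eq_square algebra_simps)
  finally show "nrm (x + y) \<le> nrm x + nrm y"
    using X ip_nonneg by (intro real_le_lsqrt) auto
next
  fix x c assume "x \<in> X"
  then have "ip (c *\<^sub>R x) (c *\<^sub>R x) = c\<^sup>2 * ip x x" by (simp add: ip_simps power2_eq_square)
  then show "nrm (c *\<^sub>R x) = \<bar>c\<bar> * nrm x" by (simp add: real_sqrt_mult)
qed

lemma tendsto_ip:
  assumes "\<And>n. f n \<in> X" "z \<in> X" "x \<in> X" and lim: "(\<lambda>n. nrm (f n - z)) \<longlonglongrightarrow> 0"
  shows "(\<lambda>n. ip (f n) x) \<longlonglongrightarrow> ip z x"
proof (rule LIM_zero_cancel, rule Lim_null_comparison)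
  show "\<forall>\<^sub>F n in sequentially. norm (ip (f n) x - ip z x) \<le> nrm (f n - z) * nrm x"
  proof (rule always_eventually, rule allI)
    fix n
    show "norm (ip (f n) x - ip z x) \<le> nrm (f n - z) * nrm x"
      using Cauchy_Schwarz[of "f n - z" x] assms(1-3) by (simp add: ip_diff)
  qed
  show "(\<lambda>n. nrm (f n - z) * nrm x) \<longlonglongrightarrow> 0"
    using tendsto_mult_left_zero[OF lim] .
qed

text \<open>A minimising sequence of \<open>\<parallel>d\<parallel>\<^sup>2 - 2 f d\<close> over \<open>D\<close> is Cauchy by the parallelogram law; its limit
  satisfies the Euler equation.\<close>

lemma minimizer:
  assumes compl: "seminorm_complete X nrm"
    and D: "subspace D" "D \<subseteq> X"
    and f_add: "\<And>x y. x \<in> D \<Longrightarrow> y \<in> D \<Longrightarrow> f (x + y) = f x + f y"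
    and f_scale: "\<And>c x. x \<in> D \<Longrightarrow> f (c *\<^sub>R x) = c * f x"
    and f_bnd: "\<And>x. x \<in> D \<Longrightarrow> \<bar>f x\<bar> \<le> B * nrm x"
  shows "\<exists>z\<in>X. \<exists>d. (\<forall>n::nat. d n \<in> D) \<and> (\<lambda>n. nrm (d n - z)) \<longlonglongrightarrow> 0 \<and> (\<forall>x\<in>D. ip z x = f x)"
proof -
  have Dm: "x + y \<in> D" "x - y \<in> D" "c *\<^sub>R x \<in> D" if "x \<in> D" "y \<in> D" for x y c
    using D(1) that by (auto simp: subspace_add subspace_diff subspace_scale)
  have DX: "x \<in> D \<Longrightarrow> x \<in> X" for x using D by blast
  define J where "J d = ip d d - 2 * f d" for d
  have lower: "J d \<ge> - B\<^sup>2" if "d \<in> D" for d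
  proof -
    have "J d \<ge> (nrm d)\<^sup>2 - 2 * (B * nrm d)"
      using f_bnd[OF that] nrm_sq[OF DX[OF that]] by (simp add: J_def)
    moreover have "0 \<le> (nrm d - B)\<^sup>2" by simp
    ultimately show ?thesis by (simp add: power2_eq_square algebra_simps)
  qed
  define I where "I = Inf (J ` D)"
  have D0: "0 \<in> D" using D(1) by (simp add: subspace_0)
  have bb: "bdd_below (J ` D)" using lower by (intro bdd_belowI2) auto
  have I: "I \<le> J d" if "d \<in> D" for d
    unfolding I_def using bb that by (intro cInf_lower) auto
  have "\<exists>d\<in>D. J d < I + 1 / real (Suc n)" for n
    using cInf_lessD[of "J ` D" "I + 1 / real (Suc n)"] D0 unfolding I_def by auto
  then obtain d where d: "\<And>n. d n \<in> D" "\<And>n. J (d n) < I + 1 / real (Suc n)" by metis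
  \<comment> \<open>The linear terms cancel, which leaves the parallelogram law. The midpoint lies
    in D, so its value is at least the infimum I and two near-minimisers must be close.\<close>
  have par: "ip (x - y) (x - y) = 2 * J x + 2 * J y - 4 * J ((1 / 2) *\<^sub>R (x + y))"
    if "x \<in> D" "y \<in> D" for x y
    using DX[OF that(1)] DX[OF that(2)] that ip_sym[of x y]
      f_scale[OF Dm(1)[OF that], of "1/2", unfolded scaleR_add_right] f_add[OF that]
    by (simp add: J_def ip_simps scaleR_add_right) (simp add: field_simps)
  have sq: "ip (d m - d n) (d m - d n) \<le> 2 / real (Suc m) + 2 / real (Suc n)" for m n
    using par[OF d(1) d(1), of m n] d(2)[of m] d(2)[of n]
      I[OF Dm(3)[OF Dm(1)[OF d(1) d(1)] D0], of "1/2" m n] by simp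
  have "\<exists>N. \<forall>m\<ge>N. \<forall>n\<ge>N. nrm (d m - d n) < e" if e: "e > 0" for e
  proof -
    obtain N where N: "1 / real (Suc N) < e\<^sup>2 / 4" using nat_approx_posE[of "e\<^sup>2 / 4"] e by auto
    have "nrm (d m - d n) < e" if "m \<ge> N" "n \<ge> N" for m n
    proof -
      have "2 / real (Suc m) \<le> 2 / real (Suc N)" "2 / real (Suc n) \<le> 2 / real (Suc N)"
        using that by (auto intro!: divide_left_mono)
      moreover have "2 / real (Suc N) < e\<^sup>2 / 2" using N by simp
      ultimately have "ip (d m - d n) (d m - d n) < e\<^sup>2" using sq[of m n] by linarith
      then show ?thesis using e by (metis real_sqrt_less_mono real_sqrt_unique less_eq_real_def)
    qed
    then show ?thesis by blast
  qed
  \<comment> \<open>D need not be closed, so the limit is found in X only. The sequence d is kept in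
    the conclusion as the record that z lies in the closure of D.\<close>
  then obtain z where z: "z \<in> X" "(\<lambda>n. nrm (d n - z)) \<longlonglongrightarrow> 0"
    using seminorm_completeD[of X nrm d, OF compl DX[OF d(1)]] by meson
  have "ip z x = f x" if x: "x \<in> D" for x
  proof -
    have conv: "(\<lambda>n. ip (d n) x) \<longlonglongrightarrow> ip z x"
      by (rule tendsto_ip[OF DX[OF d(1)] z(1) DX[OF x] z(2)])
    \<comment> \<open>Moving \<open>d n\<close> by a multiple of x stays inside D, where the
      functional cannot fall below I.\<close>
    have key: "- (1 / real (Suc n)) \<le> 2 * t * (ip (d n) x - f x) + t\<^sup>2 * ip x x" for n t
    proof -
      have "J (d n + t *\<^sub>R x) = J (d n) + 2 * t * (ip (d n) x - f x) + t\<^sup>2 * ip x x"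
        using DX[OF d(1)[of n]] DX[OF x] d(1)[of n] x ip_sym[of "d n" x] Dm(3)[OF x x, of t]
        by (simp add: J_def ip_simps f_add f_scale power2_eq_square algebra_simps)
      moreover have "I \<le> J (d n + t *\<^sub>R x)" by (intro I Dm(1) d(1) Dm(3)[OF x x])
      ultimately show ?thesis using d(2)[of n] by simp
    qed
    have lim: "0 \<le> 2 * t * (ip z x - f x) + t\<^sup>2 * ip x x" for t
    proof (rule LIMSEQ_le)
      show "(\<lambda>n. - (1 / real (Suc n))) \<longlonglongrightarrow> 0"
        using tendsto_minus[OF LIMSEQ_inverse_real_of_nat] by (simp add: inverse_eq_divide)
      show "(\<lambda>n. 2 * t * (ip (d n) x - f x) + t\<^sup>2 * ip x x) \<longlonglongrightarrow> 2 * t * (ip z x - f x) + t\<^sup>2 * ip x x"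
        by (intro tendsto_intros conv)
    qed (use key in auto)
    define r where "r = ip z x - f x"
    show ?thesis
    proof (rule ccontr)
      assume "ip z x \<noteq> f x"
      then have r: "r \<noteq> 0" by (simp add: r_def)
      \<comment> \<open>The choice t = - r / k makes the quadratic negative; the summand 1 keeps k
        positive even when x is null.\<close>
      define k where "k = ip x x + 1"
      have k: "k > 0" "ip x x < k" using ip_nonneg[OF DX[OF x]] by (auto simp: k_def)
      have "0 \<le> 2 * (- r / k) * r + (- r / k)\<^sup>2 * ip x x" using lim unfolding r_def by blast
      also have "\<dots> \<le> 2 * (- r / k) * r + (- r / k)\<^sup>2 * k"
        using k by (intro add_left_mono mult_left_mono) auto
      also have "\<dots> = - r\<^sup>2 / k" using k by (simp add: power2_eq_square field_simps)
      also have "\<dots> < 0" using k r by simp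
      finally show False by simp
    qed
  qed
  then show ?thesis using z d(1) by blast
qed

lemma Riesz:
  assumes "seminorm_complete X nrm"
    and "\<And>x y. x \<in> X \<Longrightarrow> y \<in> X \<Longrightarrow> f (x + y) = f x + f y"
    and "\<And>c x. x \<in> X \<Longrightarrow> f (c *\<^sub>R x) = c * f x"
    and "\<And>x. x \<in> X \<Longrightarrow> \<bar>f x\<bar> \<le> B * nrm x"
  shows "\<exists>z\<in>X. \<forall>x\<in>X. ip z x = f x"
  using minimizer[of X f B] assms sub by blast

text \<open>Projection onto the closure of D: the vector z that represents (x, -) on D is a limit of
  elements of D, and x - z is orthogonal to D, hence null.\<close>

lemma dense_if_orthogonal_null:
  assumes compl: "seminorm_complete X nrm" and D: "subspace D" "D \<subseteq> X"
    and orth: "\<And>z. z \<in> X \<Longrightarrow> (\<And>x. x \<in> D \<Longrightarrow> ip z x = 0) \<Longrightarrow> ip z z = 0"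
    and x: "x \<in> X" and e: "e > 0"
  shows "\<exists>d\<in>D. nrm (x - d) < e"
proof -
  obtain z d where z: "z \<in> X" "\<And>n::nat. d n \<in> D" "(\<lambda>n. nrm (d n - z)) \<longlonglongrightarrow> 0"
      "\<And>y. y \<in> D \<Longrightarrow> ip z y = ip x y"
    using minimizer[OF compl D, of "ip x" "nrm x"] Cauchy_Schwarz[OF x] x D(2)
    by (force simp: ip_simps subset_iff)
  have 0: "nrm (x - z) = 0"
  proof -
    have "ip (x - z) (x - z) = 0"
      using z x D(2) by (intro orth) (auto simp: ip_diff subset_iff)
    then show ?thesis by simp
  qed
  obtain n where n: "nrm (d n - z) < e"
    using eventually_happens'[OF sequentially_bot order_tendstoD(2)[OF z(3) e]] by blast
  have "nrm (x - d n) \<le> nrm (x - z) + nrm (z - d n)" using z x D(2) by (intro p_trans) auto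
  also have "\<dots> < e" using 0 n p_commute[of z "d n"] z(1) z(2)[of n] D(2) by auto
  finally show ?thesis using z(2) by blast
qed

lemma right_derivative_ip:
  assumes C0: "C0_semigroup X nrm S" and xy: "(x, y) \<in> generator_graph X nrm S"
  shows "((\<lambda>h. (ip (S h x) (S h x) - ip x x) / h) \<longlongrightarrow> 2 * ip x y) (at_right 0)"
proof -
  interpret C0_semigroup_on X nrm S using C0 by unfold_locales
  have X: "x \<in> X" "y \<in> X" and lim: "((\<lambda>h. nrm ((1 / h) *\<^sub>R (S h x - x) - y)) \<longlongrightarrow> 0) (at_right 0)"
    using xy by (auto simp: generator_graph_def)
  define r where "r h = nrm ((1 / h) *\<^sub>R (S h x - x) - y)" for h
  have est: "\<bar>(ip (S h x) (S h x) - ip x x) / h - 2 * ip x y\<bar>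
      \<le> r h * (nrm (S h x - x) + 2 * nrm x) + nrm y * nrm (S h x - x)" if h: "h > 0" for h
  proof -
    define a where "a = S h x - x"
    have a: "a \<in> X" "S h x = a + x" using X h by (auto simp: a_def)
    define w where "w = (1 / h) *\<^sub>R a - y"
    have w: "w \<in> X" using a X by (simp add: w_def)
    have ax: "nrm (a + 2 *\<^sub>R x) \<le> nrm a + 2 * nrm x"
      using p_triangle[of a "2 *\<^sub>R x"] p_scale[of x 2] a X by simp
    \<comment> \<open>With S h x = a + x the increment of the squared norm is (a, a + 2 x), and a /
      h = w + y with w tending to 0. The limit 2 (x, y) splits off from (y, a + 2 x).\<close>
    have "(ip (S h x) (S h x) - ip x x) / h - 2 * ip x y = ip w (a + 2 *\<^sub>R x) + ip y a"
      using a X h ip_sym[of a x] ip_sym[of y x] ip_sym[of y a]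
      by (simp add: w_def ip_simps field_simps)
    also have "\<bar>\<dots>\<bar> \<le> nrm w * nrm (a + 2 *\<^sub>R x) + nrm y * nrm a"
      using Cauchy_Schwarz[OF w, of "a + 2 *\<^sub>R x"] Cauchy_Schwarz[OF X(2) a(1)] a X by simp
    also have "\<dots> \<le> nrm w * (nrm a + 2 * nrm x) + nrm y * nrm a"
      using ax p_nonneg[OF w] by (intro add_right_mono mult_left_mono) auto
    finally show ?thesis by (simp add: r_def w_def a_def)
  qed
  have lim0: "((\<lambda>h. r h * (nrm (S h x - x) + 2 * nrm x) + nrm y * nrm (S h x - x)) \<longlongrightarrow>
      0 * (0 + 2 * nrm x) + nrm y * 0) (at_right 0)"
    using lim S_lim[OF X(1)] unfolding r_def by (intro tendsto_intros) auto
  show ?thesis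
  proof (rule LIM_zero_cancel, rule Lim_null_comparison)
    show "((\<lambda>h. r h * (nrm (S h x - x) + 2 * nrm x) + nrm y * nrm (S h x - x)) \<longlongrightarrow> 0) (at_right 0)"
      using lim0 by simp
    show "\<forall>\<^sub>F h in at_right 0. norm ((ip (S h x) (S h x) - ip x x) / h - 2 * ip x y)
        \<le> r h * (nrm (S h x - x) + 2 * nrm x) + nrm y * nrm (S h x - x)"
      using est by (intro eventually_at_rightI[of 0 1]) auto
  qed
qed

text \<open>For a datum in the domain, exp (c s) times the squared norm of the orbit has a
  nonpositive right derivative. A general datum is approximated at fixed t, where boundedness of S t
  alone controls the error.\<close>

theorem exponential_decay:
  assumes compl: "seminorm_complete X nrm" and C0: "C0_semigroup X nrm S"
    and diss: "\<And>x y. (x, y) \<in> generator_graph X nrm S \<Longrightarrow> 2 * ip x y \<le> - c * ip x x"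
    and dense: "\<And>x e. x \<in> X \<Longrightarrow> e > 0 \<Longrightarrow> \<exists>d\<in>Domain (generator_graph X nrm S). nrm (x - d) < e"
    and x: "x \<in> X" and t: "t \<ge> 0"
  shows "nrm (S t x) \<le> exp (- (c / 2) * t) * nrm x"
proof -
  interpret C0_semigroup_on X nrm S using C0 by unfold_locales
  have D: "nrm (S t x) \<le> exp (- (c / 2) * t) * nrm x" if "x \<in> Domain (generator_graph X nrm S)" for x
  proof -
    obtain y where xy: "(x, y) \<in> generator_graph X nrm S" using \<open>x \<in> _\<close> by blast
    then have x: "x \<in> X" by (simp add: generator_graph_def)
    define F where "F s = ip (S s x) (S s x)" for s
    define g where "g s = exp (c * s) * F s" for s
    have F: "F s = (nrm (S s x))\<^sup>2" if "s \<ge> 0" for s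
      using nrm_sq[of "S s x"] that x by (simp add: F_def)
    have "continuous_on {0..t} (\<lambda>s. exp (c * s) * (nrm (S s x))\<^sup>2)"
      by (intro continuous_intros continuous_orbit[OF compl t x])
    then have contg: "continuous_on {0..t} g"
      by (rule continuous_on_eq) (simp add: g_def F)
    have "g t \<le> g 0"
    proof (rule right_derivative_nonpos_imp_le[OF t contg])
      fix s assume s: "0 \<le> s" "s < t"
      define z where "z = S s x"
      have zy: "(z, S s y) \<in> generator_graph X nrm S"
        unfolding z_def by (rule generator_graph_invariant[OF xy s(1)])
      have Fs: "F (s + h) = ip (S h z) (S h z)" if "h > 0" for h
      proof -
        have "nrm (S (h + s) x) = nrm (S h z)"
          unfolding z_def using eqv_p[OF S_add[of h s x]] that s(1) x by simp
        then show ?thesis using s(1) that by (simp add: F_def add.commute)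
      qed
      have lim: "((\<lambda>h. (F (s + h) - F s) / h) \<longlongrightarrow> 2 * ip z (S s y)) (at_right 0)"
      proof (rule Lim_transform_eventually[OF right_derivative_ip[OF C0 zy]])
        show "\<forall>\<^sub>F h in at_right 0. (ip (S h z) (S h z) - ip z z) / h = (F (s + h) - F s) / h"
          using Fs by (intro eventually_at_rightI[of 0 1]) (auto simp: F_def z_def)
      qed
      have e: "((\<lambda>h. (exp (c * h) - 1) / h) \<longlongrightarrow> c) (at_right 0)"
      proof -
        have "((\<lambda>h. exp (c * h)) has_real_derivative c) (at 0)"
          by (auto intro!: derivative_eq_intros)
        then have "((\<lambda>h. (exp (c * h) - 1) / h) \<longlongrightarrow> c) (at 0)"
          by (simp add: DERIV_def)
        then show ?thesis by (rule tendsto_mono[rotated]) (simp add: at_le)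
      qed
      have e1: "((\<lambda>h. exp (c * h)) \<longlongrightarrow> 1) (at_right 0)"
        by (rule tendsto_eq_intros | simp)+
      \<comment> \<open>The product rule, written out for difference quotients because only limits
        from the right exist.\<close>
      have "((\<lambda>h. exp (c * s) * (exp (c * h) * ((F (s + h) - F s) / h) + (exp (c * h) - 1) / h * F s))
          \<longlongrightarrow> exp (c * s) * (1 * (2 * ip z (S s y)) + c * F s)) (at_right 0)"
        by (intro tendsto_intros lim e e1)
      moreover have "exp (c * s) * (exp (c * h) * ((F (s + h) - F s) / h) + (exp (c * h) - 1) / h * F s)
          = (g (s + h) - g s) / h" for h
        by (cases "h = 0") (simp_all add: g_def field_simps exp_add)
      ultimately have "((\<lambda>h. (g (s + h) - g s) / h) \<longlongrightarrow> exp (c * s) * (1 * (2 * ip z (S s y)) + c * F s)) (at_right 0)"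
        by (simp only:)
      moreover have "exp (c * s) * (1 * (2 * ip z (S s y)) + c * F s) \<le> 0"
        using diss[OF zy] by (intro mult_nonneg_nonpos) (auto simp: F_def z_def)
      ultimately show "\<exists>D\<le>0. ((\<lambda>h. (g (s + h) - g s) / h) \<longlongrightarrow> D) (at_right 0)" by blast
    qed
    moreover have "F 0 = (nrm x)\<^sup>2" using F[of 0] eqv_p[OF S_zero[OF x]] by simp
    ultimately have "exp (c * t) * (nrm (S t x))\<^sup>2 \<le> (nrm x)\<^sup>2" by (simp add: g_def F[OF t])
    then have "(nrm (S t x))\<^sup>2 \<le> exp (- c * t) * (nrm x)\<^sup>2" by (simp add: exp_minus field_simps)
    also have "\<dots> = (exp (- (c / 2) * t) * nrm x)\<^sup>2"
      by (simp add: power_mult_distrib flip: exp_double)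
    finally show ?thesis
      using p_nonneg[OF x] by (intro power2_le_imp_le[of "nrm (S t x)"]) auto
  qed
  obtain M0 where M0: "\<And>x. x \<in> X \<Longrightarrow> nrm (S t x) \<le> M0 * nrm x" using S_bounded[OF t] by blast
  define M where "M = max M0 0"
  have M: "nrm (S t x) \<le> M * nrm x" if "x \<in> X" for x
    using M0[OF that] mult_right_mono[of M0 M "nrm x"] p_nonneg[OF that] by (simp add: M_def)
  define E where "E = exp (- (c / 2) * t)"
  show ?thesis
  proof (rule field_le_epsilon)
    fix e :: real assume e: "e > 0"
    have pos: "M + E > 0" by (simp add: E_def M_def add_nonneg_pos)
    then have "e / (M + E) > 0" using e by simp
    then obtain d where d: "d \<in> Domain (generator_graph X nrm S)" "nrm (x - d) < e / (M + E)"
      using dense[OF x] by blast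
    have dX: "d \<in> X" using d(1) by (auto simp: generator_graph_def)
    have "nrm (S t x) \<le> nrm (S t x - S t d) + nrm (S t d)"
      using p_triangle[of "S t x - S t d" "S t d"] x dX t by simp
    also have "nrm (S t x - S t d) = nrm (S t (x - d))"
      using eqv_p[OF S_diff[OF t x dX]] by simp
    also have "\<dots> \<le> M * nrm (x - d)" using M x dX by simp
    also have "nrm (S t d) \<le> E * nrm d" using D[OF d(1)] by (simp add: E_def)
    also have "\<dots> \<le> E * (nrm x + nrm (x - d))"
      using p_diff_lower[OF x dX] by (intro mult_left_mono) (auto simp: E_def)
    finally have "nrm (S t x) \<le> E * nrm x + (M + E) * nrm (x - d)" by (simp add: algebra_simps)
    also have "(M + E) * nrm (x - d) \<le> e"
      using d(2) pos by (simp add: field_simps)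
    finally show "nrm (S t x) \<le> exp (- (c / 2) * t) * nrm x + e" by (simp add: E_def)
  qed
qed

end

section \<open>Passage to an equivalent seminorm\<close>

context
  fixes X :: "'a::real_vector set" and p q :: "'a \<Rightarrow> real" and a b :: real
  assumes sub: "subspace X" and a: "a > 0" and b: "b \<ge> 0"
    and low: "\<And>x. x \<in> X \<Longrightarrow> a * p x \<le> q x" and up: "\<And>x. x \<in> X \<Longrightarrow> q x \<le> b * p x"
    and pos: "\<And>x. x \<in> X \<Longrightarrow> 0 \<le> p x"
begin

private lemma mems:
  shows "x \<in> X \<Longrightarrow> y \<in> X \<Longrightarrow> x + y \<in> X"
    and "x \<in> X \<Longrightarrow> y \<in> X \<Longrightarrow> x - y \<in> X" and "x \<in> X \<Longrightarrow> c *\<^sub>R x \<in> X"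
  using sub by (auto simp: subspace_0 subspace_add subspace_diff subspace_scale)

private lemma zero_iff: "x \<in> X \<Longrightarrow> p x = 0 \<longleftrightarrow> q x = 0"
  using low[of x] up[of x] pos[of x] a by (auto simp: mult_le_0_iff)

private lemma q_nonneg: "x \<in> X \<Longrightarrow> 0 \<le> q x"
  using low[of x] pos[of x] a mult_nonneg_nonneg[of a "p x"] by linarith

private lemma lim_iff:
  assumes "\<forall>\<^sub>F h in F. f h \<in> X"
  shows "((\<lambda>h. p (f h)) \<longlongrightarrow> 0) F \<longleftrightarrow> ((\<lambda>h. q (f h)) \<longlongrightarrow> 0) F"
proof
  assume "((\<lambda>h. p (f h)) \<longlongrightarrow> 0) F"
  then have "((\<lambda>h. b * p (f h)) \<longlongrightarrow> 0) F" by (rule tendsto_mult_right_zero)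
  then show "((\<lambda>h. q (f h)) \<longlongrightarrow> 0) F"
  proof (rule Lim_null_comparison[rotated])
    show "\<forall>\<^sub>F h in F. norm (q (f h)) \<le> b * p (f h)"
      using assms by eventually_elim (simp add: up q_nonneg)
  qed
next
  assume "((\<lambda>h. q (f h)) \<longlongrightarrow> 0) F"
  then have "((\<lambda>h. (1 / a) * q (f h)) \<longlongrightarrow> 0) F" by (rule tendsto_mult_right_zero)
  then show "((\<lambda>h. p (f h)) \<longlongrightarrow> 0) F"
  proof (rule Lim_null_comparison[rotated])
    show "\<forall>\<^sub>F h in F. norm (p (f h)) \<le> (1 / a) * q (f h)"
      using assms by eventually_elim (use a low pos in \<open>simp add: field_simps\<close>)
  qed
qed

lemma seminorm_complete_equiv: "seminorm_complete X p \<Longrightarrow> seminorm_complete X q"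
  unfolding seminorm_complete_def
proof (intro allI impI)
  fix f :: "nat \<Rightarrow> 'a"
  assume c: "\<forall>f. (\<forall>n. f n \<in> X) \<and> (\<forall>e>0. \<exists>N::nat. \<forall>m\<ge>N. \<forall>n\<ge>N. p (f m - f n) < e) \<longrightarrow>
        (\<exists>x\<in>X. (\<lambda>n. p (f n - x)) \<longlonglongrightarrow> 0)"
    and f: "(\<forall>n. f n \<in> X) \<and> (\<forall>e>0. \<exists>N::nat. \<forall>m\<ge>N. \<forall>n\<ge>N. q (f m - f n) < e)"
  have "\<exists>N::nat. \<forall>m\<ge>N. \<forall>n\<ge>N. p (f m - f n) < e" if "e > 0" for e
  proof -
    have "a * e > 0" using a that by simp
    then obtain N :: nat where N: "\<forall>m\<ge>N. \<forall>n\<ge>N. q (f m - f n) < a * e" using f by blast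
    have "p (f m - f n) < e" if "m \<ge> N" "n \<ge> N" for m n
      using N that low[of "f m - f n"] f mems(2) a
      by (meson mult_less_cancel_left_pos order_le_less_trans)
    then show ?thesis by blast
  qed
  then have "\<exists>x\<in>X. (\<lambda>n. p (f n - x)) \<longlonglongrightarrow> 0"
    using f by (intro c[rule_format]) simp
  then obtain x where x: "x \<in> X" "(\<lambda>n. p (f n - x)) \<longlonglongrightarrow> 0" by blast
  then show "\<exists>x\<in>X. (\<lambda>n. q (f n - x)) \<longlonglongrightarrow> 0"
    using lim_iff[of "\<lambda>n. f n - x" sequentially] f mems(2) by auto
qed

lemma C0_semigroup_equiv:
  assumes "C0_semigroup X p S" shows "C0_semigroup X q S"
proof -
  have S: "\<And>t x. t \<ge> 0 \<Longrightarrow> x \<in> X \<Longrightarrow> S t x \<in> X" using assms by (simp add: C0_semigroup_def)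
  have 1: "q (S t (c *\<^sub>R x + d *\<^sub>R y) - (c *\<^sub>R S t x + d *\<^sub>R S t y)) = 0"
    if "t \<ge> 0" "x \<in> X" "y \<in> X" for t x y c d
  proof (rule zero_iff[THEN iffD1])
    show "p (S t (c *\<^sub>R x + d *\<^sub>R y) - (c *\<^sub>R S t x + d *\<^sub>R S t y)) = 0"
      using assms that unfolding C0_semigroup_def by blast
  qed (intro mems S that)
  have 2: "\<exists>M. \<forall>x\<in>X. q (S t x) \<le> M * q x" if t: "t \<ge> 0" for t
  proof -
    obtain M where M: "\<forall>x\<in>X. p (S t x) \<le> M * p x"
      using assms t unfolding C0_semigroup_def by blast
    have "q (S t x) \<le> b * \<bar>M\<bar> / a * q x" if x: "x \<in> X" for x
    proof -
      have "q (S t x) \<le> b * p (S t x)" using up S t x by blast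
      also have "\<dots> \<le> b * (\<bar>M\<bar> * (q x / a))"
      proof (intro mult_left_mono b)
        have "p (S t x) \<le> M * p x" using M x by blast
        also have "\<dots> \<le> \<bar>M\<bar> * p x" using pos[OF x] by (intro mult_right_mono) auto
        also have "\<dots> \<le> \<bar>M\<bar> * (q x / a)"
          using low[OF x] a by (intro mult_left_mono) (auto simp: field_simps)
        finally show "p (S t x) \<le> \<bar>M\<bar> * (q x / a)" .
      qed
      finally show ?thesis by simp
    qed
    then show ?thesis by blast
  qed
  have 3: "q (S 0 x - x) = 0" "q (S (s + t) x - S s (S t x)) = 0"
    if "x \<in> X" "s \<ge> 0" "t \<ge> 0" for x s t
  proof -
    have "p (S 0 x - x) = 0" "p (S (s + t) x - S s (S t x)) = 0"
      using assms that unfolding C0_semigroup_def by blast+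
    moreover have "S 0 x - x \<in> X" "S (s + t) x - S s (S t x) \<in> X"
      using that by (auto intro!: mems S)
    ultimately show "q (S 0 x - x) = 0" "q (S (s + t) x - S s (S t x)) = 0"
      using zero_iff by blast+
  qed
  have 4: "((\<lambda>t. q (S t x - x)) \<longlongrightarrow> 0) (at_right 0)" if "x \<in> X" for x
  proof -
    have "\<forall>\<^sub>F t in at_right 0. S t x - x \<in> X"
      using S that mems by (intro eventually_at_rightI[of 0 1]) auto
    moreover have "((\<lambda>t. p (S t x - x)) \<longlongrightarrow> 0) (at_right 0)"
      using assms that unfolding C0_semigroup_def by blast
    ultimately show ?thesis by (rule lim_iff[THEN iffD1])
  qed
  show ?thesis unfolding C0_semigroup_def using S 1 2 3(1)[OF _ order_refl order_refl] 3(2) 4 by simp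
qed

text \<open>The generator is prescribed in the energy norm, whereas decay is proved in the norm of
  the Lyapunov functional; this identifies the two graphs.\<close>

lemma generator_graph_equiv:
  assumes "C0_semigroup X p S" shows "generator_graph X q S = generator_graph X p S"
proof -
  have S: "\<And>t x. t \<ge> 0 \<Longrightarrow> x \<in> X \<Longrightarrow> S t x \<in> X" using assms by (simp add: C0_semigroup_def)
  have "((\<lambda>h. p ((1 / h) *\<^sub>R (S h x - x) - y)) \<longlongrightarrow> 0) (at_right 0) \<longleftrightarrow>
      ((\<lambda>h. q ((1 / h) *\<^sub>R (S h x - x) - y)) \<longlongrightarrow> 0) (at_right 0)" if "x \<in> X" "y \<in> X" for x y
    using S that mems by (intro lim_iff eventually_at_rightI[of 0 1]) auto
  then show ?thesis unfolding generator_graph_def by auto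
qed

end

section \<open>Smooth functions\<close>

lemma partial_deriv_eq:
  assumes "(f has_derivative f') (at x)" shows "partial_deriv i f x = f' (axis i 1)"
  using frechet_derivative_at[OF assms] by (simp add: partial_deriv_def)

lemma partial_deriv_add:
  assumes "f differentiable (at x)" "g differentiable (at x)"
  shows "partial_deriv i (\<lambda>x. f x + g x) x = partial_deriv i f x + partial_deriv i g x"
  using partial_deriv_eq[OF has_derivative_add[OF frechet_derivative_works[THEN iffD1, OF assms(1)] frechet_derivative_works[THEN iffD1, OF assms(2)]]]
  by (simp add: partial_deriv_def)

lemma partial_deriv_cmult:
  assumes "f differentiable (at x)"
  shows "partial_deriv i (\<lambda>x. c * f x) x = c * partial_deriv i f x"
  using partial_deriv_eq[OF has_derivative_mult_right[OF frechet_derivative_works[THEN iffD1, OF assms]]]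
  by (simp add: partial_deriv_def)

lemma partial_deriv_mult:
  assumes "f differentiable (at x)" "g differentiable (at x)"
  shows "partial_deriv i (\<lambda>x. f x * g x) x = f x * partial_deriv i g x + partial_deriv i f x * g x"
  using partial_deriv_eq[OF has_derivative_mult[OF frechet_derivative_works[THEN iffD1, OF assms(1)] frechet_derivative_works[THEN iffD1, OF assms(2)]]]
  by (simp add: partial_deriv_def)

lemma partial_deriv_coord:
  fixes h h' :: "real \<Rightarrow> real"
  assumes "\<And>t. (h has_real_derivative h' t) (at t)"
  shows "(\<lambda>x::real^'n::finite. h (c * x $ i + d)) differentiable (at x)"
    and "partial_deriv m (\<lambda>x::real^'n. h (c * x $ i + d)) x = (if m = i then c else 0) * h' (c * x $ i + d)"
proof -
  have "((\<lambda>x::real^'n. c * x $ i + d) has_derivative (\<lambda>v. c * v $ i)) (at x)"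
  proof -
    have "((\<lambda>x::real^'n. x $ i) has_derivative (\<lambda>v. v $ i)) (at x)"
      by (rule bounded_linear_imp_has_derivative[OF bounded_linear_vec_nth])
    from has_derivative_add[OF has_derivative_mult_right[OF this, of c] has_derivative_const[of d]]
    show ?thesis by simp
  qed
  then have *: "((\<lambda>x::real^'n. h (c * x $ i + d)) has_derivative (\<lambda>v. h' (c * x $ i + d) * (c * v $ i))) (at x)"
    by (rule has_derivative_compose)
      (use assms[of "c * x $ i + d"] in \<open>simp add: has_field_derivative_def\<close>)
  then show "(\<lambda>x::real^'n. h (c * x $ i + d)) differentiable (at x)" by (rule differentiableI)
  show "partial_deriv m (\<lambda>x::real^'n. h (c * x $ i + d)) x = (if m = i then c else 0) * h' (c * x $ i + d)"
    using partial_deriv_eq[OF *, of m] by (auto simp: axis_def)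
qed

lemma C_k_Suc_imp: "C_k (Suc k) f \<Longrightarrow> C_k k f"
proof (induction k arbitrary: f)
  case 0
  then show ?case
    by (auto simp: continuous_on_eq_continuous_at intro: differentiable_imp_continuous_within)
next
  case (Suc k)
  then show ?case by (metis C_k.simps(2))
qed

lemma C_k_add: "C_k k f \<Longrightarrow> C_k k g \<Longrightarrow> C_k k (\<lambda>x. f x + g x)"
proof (induction k arbitrary: f g)
  case 0 then show ?case by (auto intro: continuous_on_add)
next
  case (Suc k)
  then have "partial_deriv i (\<lambda>x. f x + g x) = (\<lambda>x. partial_deriv i f x + partial_deriv i g x)" for i
    by (auto simp: partial_deriv_add)
  then show ?case using Suc by auto
qed

lemma C_k_cmult: "C_k k f \<Longrightarrow> C_k k (\<lambda>x. c * f x)"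
proof (induction k arbitrary: f)
  case 0 then show ?case by (auto intro: continuous_on_mult_left)
next
  case (Suc k)
  then have "partial_deriv i (\<lambda>x. c * f x) = (\<lambda>x. c * partial_deriv i f x)" for i
    by (auto simp: partial_deriv_cmult)
  then show ?case using Suc by auto
qed

lemma C_k_mult: "C_k k f \<Longrightarrow> C_k k g \<Longrightarrow> C_k k (\<lambda>x. f x * g x)"
proof (induction k arbitrary: f g)
  case 0 then show ?case by (auto intro: continuous_on_mult)
next
  case (Suc k)
  then have "partial_deriv i (\<lambda>x. f x * g x) = (\<lambda>x. f x * partial_deriv i g x + partial_deriv i f x * g x)" for i
    by (auto simp: partial_deriv_mult)
  then show ?case
    using Suc.prems C_k_Suc_imp[OF Suc.prems(1)] C_k_Suc_imp[OF Suc.prems(2)]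
    by (auto intro!: C_k_add Suc.IH)
qed

text \<open>The whole sequence of successive derivatives is a parameter because each differentiation
  passes from h j to its successor; the induction on k keeps j arbitrary.\<close>

lemma C_k_coord:
  fixes h :: "nat \<Rightarrow> real \<Rightarrow> real"
  assumes "\<And>j t. (h j has_real_derivative h (Suc j) t) (at t)"
  shows "C_k k (\<lambda>x::real^'n::finite. h j (c * x $ i + d))"
proof (induction k arbitrary: j)
  case 0
  have "continuous_on UNIV (h j)"
    using assms DERIV_isCont continuous_at_imp_continuous_on by blast
  then show ?case
    by (auto intro!: continuous_on_compose2[of UNIV "h j"] continuous_intros)
next
  case (Suc k)
  have "partial_deriv m (\<lambda>x::real^'n. h j (c * x $ i + d))
      = (\<lambda>x. (if m = i then c else 0) * h (Suc j) (c * x $ i + d))" for m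
    using partial_deriv_coord(2)[of "h j" "h (Suc j)", OF assms] by blast
  then show ?case
    using partial_deriv_coord(1)[of "h j" "h (Suc j)", OF assms] C_k_cmult[OF Suc] by auto
qed

lemma C_k_const: "C_k k (\<lambda>x::real^'n::finite. c)"
proof (induction k arbitrary: c)
  case (Suc k)
  have "partial_deriv i (\<lambda>x::real^'n. c) = (\<lambda>x. 0)" for i
    using partial_deriv_eq[OF has_derivative_const, of i c] by auto
  then show ?case using Suc by auto
qed simp

lemma C_k_prod:
  assumes "finite I" "\<And>i. i \<in> I \<Longrightarrow> C_k k (f i)" shows "C_k k (\<lambda>x. \<Prod>i\<in>I. f i x)"
  using assms by (induction I rule: finite_induct) (auto intro: C_k_const C_k_mult)

text \<open>The derivatives of \<open>t \<mapsto> exp (- 1 / t)\<close> are of the form \<open>P (1 / t) * exp (- 1 / t)\<close> with a polynomial \<open>P\<close>.\<close>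

definition flat_exp :: "real poly \<Rightarrow> real \<Rightarrow> real" where
  "flat_exp P t = (if t > 0 then poly P (1 / t) * exp (- (1 / t)) else 0)"

lemma tendsto_poly_exp: "((\<lambda>y. poly P y * exp (- y)) \<longlongrightarrow> (0::real)) at_top"
proof -
  have "((\<lambda>y. \<Sum>k\<le>degree P. coeff P k * (y ^ k / exp y)) \<longlongrightarrow> (\<Sum>k\<le>degree P. coeff P k * 0)) at_top"
    by (intro tendsto_intros tendsto_power_div_exp_0)
  then show ?thesis
    by (simp add: poly_altdef sum_distrib_right exp_minus divide_inverse mult.assoc)
qed

lemma flat_exp_tendsto_0: "((\<lambda>t. flat_exp P t) \<longlongrightarrow> 0) (at 0)"
proof -
  have "((\<lambda>t. poly P (inverse t) * exp (- inverse t)) \<longlongrightarrow> 0) (at_right 0)"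
    by (rule filterlim_compose[OF tendsto_poly_exp filterlim_inverse_at_top_right])
  then have r: "((\<lambda>t. flat_exp P t) \<longlongrightarrow> 0) (at_right 0)"
    by (rule Lim_transform_eventually)
      (auto simp: flat_exp_def inverse_eq_divide intro!: eventually_at_rightI[of 0 1])
  have l: "((\<lambda>t. flat_exp P t) \<longlongrightarrow> 0) (at_left 0)"
    by (rule Lim_transform_eventually[OF tendsto_const])
      (auto simp: flat_exp_def intro!: eventually_at_leftI[of "-1" 0])
  show ?thesis using l r by (rule filterlim_split_at)
qed

text \<open>With y = 1 / t, the derivative of P(y) exp (- y) in t is y^2 (P(y) - P'(y)) exp (- y).
  At the origin the difference quotient is again such a function, with polynomial y P, and so tends
  to 0.\<close>

lemma flat_exp_deriv:
  "(flat_exp P has_real_derivative flat_exp ([:0, 0, 1:] * (P - pderiv P)) t) (at t)"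
proof -
  consider "t > 0" | "t < 0" | "t = 0" by linarith
  then show ?thesis
  proof cases
    case 1
    have "((\<lambda>t. poly P (1 / t) * exp (- (1 / t))) has_real_derivative
        flat_exp ([:0, 0, 1:] * (P - pderiv P)) t) (at t)"
      using 1 by (auto intro!: derivative_eq_intros DERIV_chain2[OF poly_DERIV]
          simp: flat_exp_def field_simps power2_eq_square)
    then show ?thesis
      by (rule has_field_derivative_transform_within_open[where S = "{0<..}"])
        (use 1 in \<open>auto simp: flat_exp_def\<close>)
  next
    case 2
    have "((\<lambda>t. 0) has_real_derivative flat_exp ([:0, 0, 1:] * (P - pderiv P)) t) (at t)"
      using 2 by (simp add: flat_exp_def)
    then show ?thesis
      by (rule has_field_derivative_transform_within_open[where S = "{..<0}"])
        (use 2 in \<open>auto simp: flat_exp_def\<close>)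
  next
    case 3
    have "flat_exp P h / h = flat_exp (pCons 0 P) h" for h
      by (simp add: flat_exp_def)
    then have "((\<lambda>h. (flat_exp P (0 + h) - flat_exp P 0) / h) \<longlongrightarrow> 0) (at 0)"
      using flat_exp_tendsto_0[of "pCons 0 P"] by (simp add: flat_exp_def[of P 0])
    then show ?thesis using 3 by (simp add: DERIV_def flat_exp_def)
  qed
qed

lemma C_k_flat_exp: "C_k k (\<lambda>x::real^'n::finite. flat_exp P (c * x $ i + d))"
proof -
  define R :: "nat \<Rightarrow> real poly" where "R = rec_nat P (\<lambda>_ Q. [:0, 0, 1:] * (Q - pderiv Q))"
  have "(flat_exp (R j) has_real_derivative flat_exp (R (Suc j)) t) (at t)" for j t
    using flat_exp_deriv[of "R j" t] by (simp add: R_def)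
  from C_k_coord[of "\<lambda>j. flat_exp (R j)", OF this, of k 0 c i d] show ?thesis
    by (simp add: R_def)
qed

text \<open>Test functions that approximate the indicator of an open box. As
  \<open>flat_exp 1 t\<close> is exp (- 1 / t) for t > 0, stretching its argument drives each factor
  to 1 inside the box, while the product vanishes outside it for every n.\<close>

definition bump :: "real^'n::finite \<Rightarrow> real^'n \<Rightarrow> nat \<Rightarrow> real^'n \<Rightarrow> real" where
  "bump a b n x = (\<Prod>i\<in>UNIV. flat_exp 1 (real (Suc n) * (x $ i - a $ i)) * flat_exp 1 (real (Suc n) * (b $ i - x $ i)))"

lemma flat_exp_1_bounds: "0 \<le> flat_exp 1 t" "flat_exp 1 t \<le> 1"
  by (auto simp: flat_exp_def)

lemma bump_bounds: "0 \<le> bump a b n x" "bump a b n x \<le> 1"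
  unfolding bump_def
  by (auto intro!: prod_nonneg prod_le_1 mult_nonneg_nonneg mult_le_one flat_exp_1_bounds)

lemma bump_outside: "x \<notin> box a b \<Longrightarrow> bump a b n x = 0"
proof -
  assume "x \<notin> box a b"
  then obtain i where "\<not> (a $ i < x $ i \<and> x $ i < b $ i)" by (auto simp: mem_box_cart)
  then have "flat_exp 1 (real (Suc n) * (x $ i - a $ i)) * flat_exp 1 (real (Suc n) * (b $ i - x $ i)) = 0"
    by (auto simp: flat_exp_def zero_less_mult_iff)
  then show ?thesis unfolding bump_def by (intro prod_zero) auto
qed

lemma flat_exp_1_limit: "t > 0 \<Longrightarrow> (\<lambda>n. flat_exp 1 (real (Suc n) * t)) \<longlonglongrightarrow> 1"
proof -
  assume t: "t > 0"
  have "(\<lambda>n. exp (- (inverse (real (Suc n)) / t))) \<longlonglongrightarrow> exp (- (0 / t))"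
    by (intro tendsto_intros LIMSEQ_inverse_real_of_nat) (use t in auto)
  moreover have "flat_exp 1 (real (Suc n) * t) = exp (- (inverse (real (Suc n)) / t))" for n
    using t mult_pos_pos[of "real (Suc n)" t] by (simp add: flat_exp_def divide_inverse del: of_nat_Suc)
  ultimately show ?thesis by simp
qed

lemma bump_limit: "(\<lambda>n. bump a b n x) \<longlonglongrightarrow> indicator (box a b) x"
proof (cases "x \<in> box a b")
  case True
  have "(\<lambda>n. bump a b n x) \<longlonglongrightarrow> (\<Prod>i\<in>(UNIV::'a set). 1 * 1)"
    unfolding bump_def by (intro tendsto_intros flat_exp_1_limit) (use True in \<open>auto simp: mem_box_cart\<close>)
  then show ?thesis using True by simp
next
  case False then show ?thesis by (simp add: bump_outside)
qed

lemma C_k_bump: "C_k k (bump a b n)"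
proof -
  have "C_k k (\<lambda>x. flat_exp 1 (real (Suc n) * (x $ i - a $ i)))"
       "C_k k (\<lambda>x. flat_exp 1 (real (Suc n) * (b $ i - x $ i)))" for i
    using C_k_flat_exp[of k 1 "real (Suc n)" i "- real (Suc n) * a $ i"]
      C_k_flat_exp[of k 1 "- real (Suc n)" i "real (Suc n) * b $ i"]
    by (simp_all add: right_diff_distrib algebra_simps del: of_nat_Suc)
  then show ?thesis unfolding bump_def by (intro C_k_prod C_k_mult) auto
qed

lemma bump_test_function: "cbox a b \<subseteq> \<Omega> \<Longrightarrow> bump a b n \<in> test_functions \<Omega>"
proof -
  assume "cbox a b \<subseteq> \<Omega>"
  moreover have "{x. bump a b n x \<noteq> 0} \<subseteq> box a b" using bump_outside by blast
  then have "closure {x. bump a b n x \<noteq> 0} \<subseteq> cbox a b"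
    by (intro closure_minimal) (use box_subset_cbox in auto)
  moreover from this have "compact (closure {x. bump a b n x \<noteq> 0})"
    by (meson bounded_cbox bounded_subset closed_closure compact_eq_bounded_closed)
  ultimately show ?thesis unfolding test_functions_def using C_k_bump by auto
qed

section \<open>Integration by parts\<close>

lemma compact_support_integrable:
  fixes f :: "'a::euclidean_space \<Rightarrow> real"
  assumes "compact K" "continuous_on UNIV f" "\<And>x. x \<notin> K \<Longrightarrow> f x = 0"
  shows "integrable lborel f"
proof -
  have "integrable lborel (\<lambda>x. indicator K x *\<^sub>R f x)"
    by (intro borel_integrable_compact assms(1) continuous_on_subset[OF assms(2)]) auto
  moreover have "(\<lambda>x. indicator K x *\<^sub>R f x) = f" using assms(3) by (fastforce simp: indicator_def)
  ultimately show ?thesis by simp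
qed

lemma C_k_1:
  "C_k 1 f \<Longrightarrow> f differentiable (at x)" "C_k 1 f \<Longrightarrow> continuous_on UNIV f"
  "C_k 1 f \<Longrightarrow> continuous_on UNIV (partial_deriv i f)"
  using C_k_Suc_imp[of 0 f] unfolding One_nat_def by auto

lemma partial_deriv_outside:
  assumes "closed K" "\<And>x. x \<notin> K \<Longrightarrow> f x = 0" "x \<notin> K"
  shows "partial_deriv i f x = 0"
proof -
  have "(f has_derivative (\<lambda>_. 0)) (at x)"
    by (rule has_derivative_transform_within_open[of "\<lambda>_. 0" _ _ _ "- K"])
      (use assms in auto)
  then show ?thesis by (simp add: partial_deriv_eq)
qed

lemma line_derivative:
  assumes "f differentiable (at (x + t *\<^sub>R axis i 1))"
  shows "((\<lambda>t. f (x + t *\<^sub>R axis i 1)) has_real_derivative partial_deriv i f (x + t *\<^sub>R axis i 1)) (at t)"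
proof -
  have d: "(f has_derivative frechet_derivative f (at (x + t *\<^sub>R axis i 1))) (at (x + t *\<^sub>R axis i 1))"
    using assms by (rule frechet_derivative_works[THEN iffD1])
  have "((\<lambda>t. x + t *\<^sub>R axis i 1) has_derivative (\<lambda>h. h *\<^sub>R axis i 1)) (at t)"
    by (auto intro!: derivative_eq_intros)
  from has_derivative_compose[OF this d]
  have "((\<lambda>t. f (x + t *\<^sub>R axis i 1)) has_derivative
      (\<lambda>h. frechet_derivative f (at (x + t *\<^sub>R axis i 1)) (h *\<^sub>R axis i 1))) (at t)" .
  moreover have "frechet_derivative f (at (x + t *\<^sub>R axis i 1)) (h *\<^sub>R axis i 1)
      = partial_deriv i f (x + t *\<^sub>R axis i 1) * h" for h
    using linear_scale[OF has_derivative_linear[OF d]] by (simp add: partial_deriv_def)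
  ultimately show ?thesis by (simp add: has_field_derivative_def)
qed

text \<open>The difference quotients integrate to zero by translation invariance, and they converge dominatedly.\<close>

lemma integral_partial_deriv_zero:
  fixes f :: "real^'n::finite \<Rightarrow> real"
  assumes f: "C_k 1 f" and K: "compact K" "\<And>x. x \<notin> K \<Longrightarrow> f x = 0"
  shows "(\<integral>x. partial_deriv i f x \<partial>lborel) = 0"
proof -
  define e :: "real^'n" where "e = axis i 1"
  define h where "h n = 1 / real (Suc n)" for n
  have h: "0 < h n" "h n \<le> 1" for n by (auto simp: h_def)
  have hlim: "h \<longlonglongrightarrow> 0"
    unfolding h_def using LIMSEQ_inverse_real_of_nat by (simp add: inverse_eq_divide)
  have cont: "continuous_on UNIV f" "continuous_on UNIV (partial_deriv i f)"
    using C_k_1 f by blast+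
  then have [measurable]: "f \<in> borel_measurable borel" "partial_deriv i f \<in> borel_measurable borel"
    by (auto intro: borel_measurable_continuous_onI)
  have intf: "integrable lborel f" using compact_support_integrable[OF K(1) cont(1) K(2)] by blast
  have dzero: "partial_deriv i f x = 0" if "x \<notin> K" for x
    by (rule partial_deriv_outside[OF compact_imp_closed[OF K(1)] K(2) that])
  obtain B where B: "\<And>x. \<bar>partial_deriv i f x\<bar> \<le> B"
  proof -
    have "compact (partial_deriv i f ` K)"
      by (intro compact_continuous_image continuous_on_subset[OF cont(2)] K(1)) auto
    then obtain B where "\<forall>x\<in>K. \<bar>partial_deriv i f x\<bar> \<le> B"
      unfolding compact_eq_bounded_closed bounded_iff by auto
    then have "\<bar>partial_deriv i f x\<bar> \<le> max B 0" for x
      using dzero[of x] by (cases "x \<in> K") (auto simp: le_max_iff_disj)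
    then show thesis using that by blast
  qed
  obtain R where R: "K \<subseteq> cball 0 R"
    using compact_imp_bounded[OF K(1)] that by (auto simp: bounded_iff subset_iff)
  define q where "q n x = (f (x + h n *\<^sub>R e) - f x) / h n" for n x
  have tr: "(\<integral>x. f (x + c) \<partial>lborel) = (\<integral>x. f x \<partial>lborel)" "integrable lborel (\<lambda>x. f (x + c))" for c
  proof -
    have "(\<integral>x. f x \<partial>lborel) = (\<integral>x. f x \<partial>distr lborel borel ((+) c))" by (simp add: lborel_distr_plus)
    also have "\<dots> = (\<integral>x. f (c + x) \<partial>lborel)" by (rule integral_distr) auto
    finally show "(\<integral>x. f (x + c) \<partial>lborel) = (\<integral>x. f x \<partial>lborel)" by (simp add: add.commute)
    have "integrable (distr lborel borel ((+) c)) f" using intf by (simp add: lborel_distr_plus)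
    then have "integrable lborel (\<lambda>x. f (c + x))" by (subst (asm) integrable_distr_eq) auto
    then show "integrable lborel (\<lambda>x. f (x + c))" by (simp add: add.commute)
  qed
  have q0: "(\<integral>x. q n x \<partial>lborel) = 0" for n
    unfolding q_def using tr intf by (simp add: Bochner_Integration.integral_diff)
  \<comment> \<open>By the mean value theorem the quotient is a value of the partial derivative at
    distance less than 1 from x. This gives the bound B and a common support in the ball of radius R
    + 1.\<close>
  have mv: "\<exists>s. 0 < s \<and> s < h n \<and> q n x = partial_deriv i f (x + s *\<^sub>R e)" for n x
  proof -
    have "\<exists>s. 0 < s \<and> s < h n \<and> f (x + h n *\<^sub>R e) - f (x + 0 *\<^sub>R e) = (h n - 0) * partial_deriv i f (x + s *\<^sub>R e)"
      using h(1) unfolding e_def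
      by (intro MVT2[where f = "\<lambda>t. f (x + t *\<^sub>R axis i 1)"] line_derivative C_k_1(1)[OF f])
    then show ?thesis using h(1)[of n] unfolding q_def by (auto simp: field_simps)
  qed
  have dom: "\<bar>q n x\<bar> \<le> B * indicator (cball 0 (R + 1)) x" for n x
  proof (cases "x \<in> cball 0 (R + 1)")
    case True then show ?thesis using mv[of n x] B by auto
  next
    case False
    obtain s where s: "0 < s" "s < h n" "q n x = partial_deriv i f (x + s *\<^sub>R e)" using mv by blast
    have "norm (s *\<^sub>R e) \<le> 1" using s h[of n] by (simp add: e_def)
    then have "x + s *\<^sub>R e \<notin> K"
      using False R norm_triangle_ineq4[of "x + s *\<^sub>R e" "s *\<^sub>R e"] by (auto simp: subset_iff)
    then show ?thesis using s(3) dzero False by simp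
  qed
  have lim: "(\<lambda>n. q n x) \<longlonglongrightarrow> partial_deriv i f x" for x
  proof -
    have "((\<lambda>t. f (x + t *\<^sub>R axis i 1)) has_real_derivative partial_deriv i f x) (at 0)"
      using line_derivative[of f x 0 i] C_k_1(1)[OF f] by simp
    then have "((\<lambda>t. (f (x + t *\<^sub>R e) - f x) / t) \<longlongrightarrow> partial_deriv i f x) (at 0)"
      by (simp add: DERIV_def e_def)
    moreover have "filterlim h (at 0) sequentially"
      using hlim h(1) by (auto simp: filterlim_at intro!: always_eventually) (metis less_irrefl)
    ultimately show ?thesis unfolding q_def by (rule filterlim_compose)
  qed
  have "(\<lambda>n. \<integral>x. q n x \<partial>lborel) \<longlonglongrightarrow> (\<integral>x. partial_deriv i f x \<partial>lborel)"
  proof (rule integral_dominated_convergence[where w = "\<lambda>x. B * indicator (cball 0 (R + 1)) x"])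
    have "integrable lborel (\<lambda>x. indicator (cball 0 (R + 1)) x *\<^sub>R B :: real)"
      by (intro borel_integrable_compact continuous_intros) auto
    then show "integrable lborel (\<lambda>x::real^'n. B * indicator (cball 0 (R + 1)) x)"
      by (simp add: mult.commute)
  qed (use dom lim in \<open>auto simp: q_def\<close>)
  then show ?thesis using q0 by (simp add: LIMSEQ_const_iff)
qed

text \<open>Compact support is asked of one factor only, so that the other may be the coordinate
  function x_l in the Poincare inequality.\<close>

lemma integration_by_parts:
  fixes f g :: "real^'n::finite \<Rightarrow> real"
  assumes f: "C_k 1 f" and g: "C_k 1 g" and K: "compact K" "\<And>x. x \<notin> K \<Longrightarrow> f x = 0"
  shows "(\<integral>x. f x * partial_deriv i g x \<partial>lborel) = - (\<integral>x. partial_deriv i f x * g x \<partial>lborel)"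
proof -
  have "(\<integral>x. partial_deriv i (\<lambda>x. f x * g x) x \<partial>lborel) = 0"
    by (rule integral_partial_deriv_zero[OF C_k_mult[OF f g] K(1)]) (simp add: K(2))
  moreover have "partial_deriv i (\<lambda>x. f x * g x) = (\<lambda>x. f x * partial_deriv i g x + partial_deriv i f x * g x)"
    using partial_deriv_mult C_k_1(1) f g by blast
  moreover have "integrable lborel (\<lambda>x. f x * partial_deriv i g x)"
    by (rule compact_support_integrable[OF K(1) continuous_on_mult[OF C_k_1(2)[OF f] C_k_1(3)[OF g]]])
      (simp add: K(2))
  moreover have "integrable lborel (\<lambda>x. partial_deriv i f x * g x)"
    by (rule compact_support_integrable[OF K(1) continuous_on_mult[OF C_k_1(3)[OF f] C_k_1(2)[OF g]]])
      (simp add: partial_deriv_outside[OF compact_imp_closed[OF K(1)] K(2)])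
  ultimately show ?thesis by simp
qed

section \<open>The fundamental lemma of the calculus of variations\<close>

text \<open>Open boxes are stable under intersection and generate the Borel sets, so Dynkin's
  argument extends the vanishing to Borel sets; the integral over the whole space serves the
  complements. Lebesgue sets differ from Borel sets by null sets, and integrating over {h > 0} and
  {h < 0} shows that both are null.\<close>

lemma AE_zero_if_box_integrals_zero:
  fixes h :: "'a::euclidean_space \<Rightarrow> real"
  assumes h: "integrable lebesgue h"
    and box: "\<And>c d. (\<integral>x\<in>box c d. h x \<partial>lebesgue) = 0" and univ: "(\<integral>x. h x \<partial>lebesgue) = 0"
  shows "AE x in lebesgue. h x = 0"
proof -
  define G where "G = range (\<lambda>(a, b). box a b :: 'a set)"
  have si: "set_integrable lebesgue A h" if "A \<in> sets lebesgue" for A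
    using h that unfolding set_integrable_def by (rule integrable_mult_indicator[rotated])
  have borel: "(\<integral>x\<in>A. h x \<partial>lebesgue) = 0" if "A \<in> sets borel" for A
  proof -
    have "Int_stable G"
      unfolding Int_stable_def G_def by (auto simp: box_Int_box)
    moreover have "G \<subseteq> Pow UNIV" by simp
    moreover have "A \<in> sigma_sets UNIV G"
      using that borel_eq_box by (metis G_def sets_measure_of subset_UNIV Pow_UNIV)
    ultimately show ?thesis
    proof (induction rule: sigma_sets_induct_disjoint)
      case (basic A) then show ?case using box by (auto simp: G_def)
    next
      case empty show ?case by (simp add: set_lebesgue_integral_def)
    next
      case (compl A)
      then have A: "A \<in> sets lebesgue"
        using borel_eq_box by (metis G_def sets_measure_of subset_UNIV Pow_UNIV sets_completionI_sets sets_lborel)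
      have "(\<integral>x\<in>A \<union> (UNIV - A). h x \<partial>lebesgue) = (\<integral>x\<in>A. h x \<partial>lebesgue) + (\<integral>x\<in>UNIV - A. h x \<partial>lebesgue)"
        by (intro set_integral_Un si) (use A in auto)
      then show ?case using compl univ by (simp add: set_lebesgue_integral_def)
    next
      case (union A)
      then have A: "A n \<in> sets lebesgue" for n
        using borel_eq_box by (metis G_def sets_measure_of subset_UNIV Pow_UNIV sets_completionI_sets sets_lborel range_subsetD)
      have "(\<integral>x\<in>(\<Union>i. A i). h x \<partial>lebesgue) = (\<Sum>i. \<integral>x\<in>A i. h x \<partial>lebesgue)"
        by (intro lebesgue_integral_countable_add si)
          (use A union in \<open>auto simp: disjoint_family_on_def\<close>)
      then show ?case using union by simp
    qed
  qed
  have leb: "(\<integral>x\<in>A. h x \<partial>lebesgue) = 0" if "A \<in> sets lebesgue" for A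
  proof -
    obtain S N N' where S: "A = S \<union> N" "N \<subseteq> N'" "N' \<in> null_sets lborel" "S \<in> sets lborel"
      using \<open>A \<in> sets lebesgue\<close> by (rule sets_completionE)
    then have N: "N \<in> null_sets lebesgue"
      by (meson completion.complete2 null_sets_completionI)
    have "AE x in lebesgue. x \<notin> N" using N by (rule AE_not_in)
    then have "(\<integral>x\<in>A. h x \<partial>lebesgue) = (\<integral>x\<in>S. h x \<partial>lebesgue)"
      unfolding set_lebesgue_integral_def
    proof (intro integral_cong_AE)
      show "(\<lambda>x. indicator A x *\<^sub>R h x) \<in> borel_measurable lebesgue"
        using si[OF that] by (auto simp: set_integrable_def)
      show "(\<lambda>x. indicator S x *\<^sub>R h x) \<in> borel_measurable lebesgue"
        using si[of S] S(4) by (auto simp: set_integrable_def)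
    qed (auto simp: S(1) indicator_def elim!: eventually_mono)
    then show ?thesis using borel S(4) by simp
  qed
  have hm[measurable]: "h \<in> borel_measurable lebesgue" using h by simp
  have "{x. h x > 0} \<in> sets lebesgue" "{x. h x < 0} \<in> sets lebesgue"
    using measurable_sets[OF hm, of "{0<..}"] measurable_sets[OF hm, of "{..<0}"]
    by (simp_all add: vimage_def)
  moreover have "A \<in> null_sets lebesgue" if "A \<in> sets lebesgue" "\<And>x. x \<in> A \<Longrightarrow> c * h x > 0" for A and c :: real
    by (rule null_if_pos_func_has_zero_int[of lebesgue "\<lambda>x. c * h x"]) (use h leb that in auto)
  from this[of "{x. h x > 0}" 1] this[of "{x. h x < 0}" "-1"]
  have "{x. h x > 0} \<in> null_sets lebesgue" "{x. h x < 0} \<in> null_sets lebesgue"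
    using calculation by auto
  then have "AE x in lebesgue. x \<notin> {x. h x > 0}" "AE x in lebesgue. x \<notin> {x. h x < 0}"
    by (intro AE_not_in; simp)+
  then show ?thesis by eventually_elim auto
qed

lemma integral_lebesgue_on_eq:
  fixes f :: "'a::euclidean_space \<Rightarrow> real"
  assumes "S \<in> sets lebesgue" "\<And>x. x \<notin> S \<Longrightarrow> f x = 0"
  shows "(\<integral>x. f x \<partial>(lebesgue_on S)) = (\<integral>x. f x \<partial>lebesgue)"
proof -
  have "(\<integral>x. f x \<partial>(lebesgue_on S)) = (\<integral>x. indicator S x *\<^sub>R f x \<partial>lebesgue)"
    using assms(1) by (intro integral_restrict_space) auto
  also have "\<dots> = (\<integral>x. f x \<partial>lebesgue)"
    using assms(2) by (intro Bochner_Integration.integral_cong) (auto simp: indicator_def)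
  finally show ?thesis .
qed

text \<open>As g is integrable on compact subsets only, the claim is first proved on closed boxes
  inside \<Omega>; countably many of them cover it.\<close>

lemma fundamental_lemma:
  fixes \<Omega> :: "(real^'n::finite) set"
  assumes \<Omega>: "open \<Omega>" and g: "g \<in> L1_loc_on \<Omega>"
    and zero: "\<And>\<phi>. \<phi> \<in> test_functions \<Omega> \<Longrightarrow> (\<integral>x. g x * \<phi> x \<partial>(lebesgue_on \<Omega>)) = 0"
  shows "AE x in lebesgue_on \<Omega>. g x = 0"
proof -
  have meas: "\<Omega> \<in> sets lebesgue" using \<Omega> by auto
  have cb: "AE x in lebesgue. x \<in> cbox a b \<longrightarrow> g x = 0" if ab: "cbox a b \<subseteq> \<Omega>" for a b
  proof -
    define h where "h x = indicator (cbox a b) x * g x" for x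
    have "integrable (lebesgue_on (cbox a b)) g" using g ab by (auto simp: L1_loc_on_def)
    then have h: "integrable lebesgue h"
      using integrable_restrict_space[of "cbox a b" lebesgue g] by (simp add: h_def[abs_def])
    have bz: "(\<integral>x\<in>box c d. h x \<partial>lebesgue) = 0" if cd: "box c d = {} \<or> cbox c d \<subseteq> cbox a b" for c d
    proof (cases "box c d = {}")
      case True then show ?thesis by (simp add: set_lebesgue_integral_def)
    next
      case False
      with cd have cd: "cbox c d \<subseteq> cbox a b" by blast
      have "(\<integral>x. h x * bump c d n x \<partial>lebesgue) = 0" for n
      proof -
        have eq: "(\<lambda>x. h x * bump c d n x) = (\<lambda>x. g x * bump c d n x)"
          using bump_outside[of _ c d n] box_subset_cbox[of c d] cd
          by (auto simp: h_def indicator_def fun_eq_iff subset_iff)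
        have "(\<integral>x. g x * bump c d n x \<partial>(lebesgue_on \<Omega>)) = (\<integral>x. g x * bump c d n x \<partial>lebesgue)"
          by (rule integral_lebesgue_on_eq[OF meas])
            (use bump_outside[of _ c d n] box_subset_cbox[of c d] cd ab in \<open>auto simp: subset_iff\<close>)
        then show ?thesis using zero[OF bump_test_function[of c d \<Omega> n]] cd ab
          unfolding eq by simp
      qed
      moreover have "(\<lambda>n. \<integral>x. h x * bump c d n x \<partial>lebesgue) \<longlonglongrightarrow> (\<integral>x. h x * indicator (box c d) x \<partial>lebesgue)"
      proof (rule integral_dominated_convergence[where w = "\<lambda>x. \<bar>h x\<bar>"])
        have "continuous_on UNIV (bump c d n)" for n
          using C_k_bump[of 0 c d n] by simp
        then have "bump c d n \<in> borel_measurable lebesgue" for n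
          by (intro measurable_completion) (simp add: borel_measurable_continuous_onI)
        then show "(\<lambda>x. h x * bump c d n x) \<in> borel_measurable lebesgue" for n
          using h by (intro borel_measurable_times) auto
        show "(\<lambda>x. h x * indicator (box c d) x) \<in> borel_measurable lebesgue"
          using h by (intro borel_measurable_times borel_measurable_indicator) auto
        show "AE x in lebesgue. (\<lambda>n. h x * bump c d n x) \<longlonglongrightarrow> h x * indicator (box c d) x"
          by (intro AE_I2 tendsto_intros bump_limit)
        show "AE x in lebesgue. norm (h x * bump c d n x) \<le> \<bar>h x\<bar>" for n
          using bump_bounds[of c d n] by (intro AE_I2) (auto simp: abs_mult intro!: mult_left_le)
      qed (use h in auto)
      ultimately have "(\<integral>x. h x * indicator (box c d) x \<partial>lebesgue) = 0"
        by (simp add: LIMSEQ_const_iff)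
      then show ?thesis by (simp add: set_lebesgue_integral_def mult.commute)
    qed
    have frontier: "AE x in lebesgue. x \<notin> cbox a b - box a b"
      by (intro AE_not_in) (metis frontier_cbox negligible_frontier_interval negligible_iff_null_sets)
    have hbox: "AE x in lebesgue. h x = indicator (box a b) x * h x"
      using frontier by eventually_elim (auto simp: h_def indicator_def)
    have "AE x in lebesgue. h x = 0"
    proof (rule AE_zero_if_box_integrals_zero[OF h])
      fix c d :: "real^'n"
      \<comment> \<open>An arbitrary box may leave \<open>cbox a b\<close>. Up to a null set h lives
        on \<open>box a b\<close>, and the intersection is an open box whose closure, unless it is
        empty, stays in \<open>cbox a b\<close>.\<close>
      obtain c' d' :: "real^'n" where cd': "box c d \<inter> box a b = box c' d'"
        by (simp add: box_Int_box)
      have "(\<integral>x\<in>box c d. h x \<partial>lebesgue) = (\<integral>x\<in>box c' d'. h x \<partial>lebesgue)"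
        unfolding set_lebesgue_integral_def
      proof (intro integral_cong_AE)
        show "AE x in lebesgue. indicator (box c d) x *\<^sub>R h x = indicator (box c' d') x *\<^sub>R h x"
          unfolding cd'[symmetric] using hbox by eventually_elim (auto simp: indicator_def)
      qed (use h in \<open>auto intro!: borel_measurable_times borel_measurable_indicator\<close>)
      also have "\<dots> = 0"
      proof (rule bz)
        have "box c' d' \<subseteq> cbox a b" using cd' box_subset_cbox by blast
        then have "box c' d' = {} \<or> cbox c' d' \<subseteq> cbox a b"
          using closure_box[of c' d'] closure_minimal[of "box c' d'" "cbox a b"] closed_cbox by metis
        then show "box c' d' = {} \<or> cbox c' d' \<subseteq> cbox a b" .
      qed
      finally show "(\<integral>x\<in>box c d. h x \<partial>lebesgue) = 0" .
    next
      have "(\<integral>x. h x \<partial>lebesgue) = (\<integral>x\<in>box a b. h x \<partial>lebesgue)"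
        unfolding set_lebesgue_integral_def
        by (intro integral_cong_AE) (use h hbox in \<open>auto intro!: borel_measurable_times borel_measurable_indicator\<close>)
      also have "\<dots> = 0" by (rule bz) auto
      finally show "(\<integral>x. h x \<partial>lebesgue) = 0" .
    qed
    then show ?thesis by eventually_elim (auto simp: h_def)
  qed
  obtain \<D> where D: "countable \<D>" "\<And>X. X \<in> \<D> \<Longrightarrow> \<exists>a b. X = cbox a b" "\<Union>\<D> = \<Omega>" "\<D> \<subseteq> Pow \<Omega>"
    using open_countable_Union_open_cbox[OF \<Omega>] by metis
  have "AE x in lebesgue. \<forall>X\<in>\<D>. x \<in> X \<longrightarrow> g x = 0"
    unfolding AE_ball_countable[OF D(1)] using D(2,4) cb by blast
  then have "AE x in lebesgue. x \<in> \<Omega> \<longrightarrow> g x = 0"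
    by eventually_elim (use D(3) in blast)
  then show ?thesis using meas by (subst AE_restrict_space_iff) auto
qed

section \<open>Square-integrable functions and weak derivatives\<close>

lemma plus_fun_eq: "f + g = (\<lambda>x. f x + g x)" and minus_fun_eq: "f - g = (\<lambda>x. f x - g x)"
  by (auto simp: fun_eq_iff)

lemma integrable_lebesgue_on_subset:
  assumes "integrable (lebesgue_on S) f" "T \<subseteq> S" "S \<in> sets lebesgue" "T \<in> sets lebesgue"
  shows "integrable (lebesgue_on T) (f :: 'a::euclidean_space \<Rightarrow> real)"
  using assms set_integrable_subset[of lebesgue S f T]
  by (simp add: set_integrable_def integrable_restrict_space)

section \<open>The space L2 over a bounded open set\<close>

locale open_bounded =
  fixes \<Omega> :: "(real^'n::finite) set"
  assumes open_\<Omega>: "open \<Omega>" and bounded_\<Omega>: "bounded \<Omega>"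
begin

abbreviation M where "M \<equiv> lebesgue_on \<Omega>"
abbreviation L2sp where "L2sp \<equiv> L2_on \<Omega>"
abbreviation ipL2 where "ipL2 \<equiv> L2_inner \<Omega>"
abbreviation tests where "tests \<equiv> test_functions \<Omega>"

lemma sets_\<Omega> [simp, measurable]: "\<Omega> \<in> sets lebesgue" using open_\<Omega> by auto

lemma space_M [simp]: "space M = \<Omega>" by (simp add: space_restrict_space)

lemma finite_M: "finite_measure M"
proof (rule finite_measureI)
  have "emeasure lebesgue \<Omega> < \<infinity>"
    using bounded_set_imp_lmeasurable[OF bounded_\<Omega>] by (simp add: fmeasurable_def)
  then show "emeasure M (space M) \<noteq> \<infinity>" by (simp add: emeasure_restrict_space)
qed

lemma integrable_const_M [simp]: "integrable M (\<lambda>x. c :: real)"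
  using finite_measure.integrable_const[OF finite_M] .

lemma L2_measurable: "u \<in> L2sp \<Longrightarrow> u \<in> borel_measurable M"
  and L2_sq: "u \<in> L2sp \<Longrightarrow> integrable M (\<lambda>x. (u x)\<^sup>2)"
  by (auto simp: L2_on_def)

lemma L2_mult_integrable:
  assumes "u \<in> L2sp" "v \<in> L2sp" shows "integrable M (\<lambda>x. u x * v x)"
proof (rule Bochner_Integration.integrable_bound)
  show "integrable M (\<lambda>x. (u x)\<^sup>2 + (v x)\<^sup>2)" using assms by (intro Bochner_Integration.integrable_add L2_sq)
  show "AE x in M. norm (u x * v x) \<le> norm ((u x)\<^sup>2 + (v x)\<^sup>2)"
  proof (rule AE_I2)
    fix x
    have "2 * \<bar>u x\<bar> * \<bar>v x\<bar> \<le> \<bar>u x\<bar>\<^sup>2 + \<bar>v x\<bar>\<^sup>2" by (rule sum_squares_bound)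
    moreover have "0 \<le> \<bar>u x\<bar> * \<bar>v x\<bar>" by simp
    ultimately have "\<bar>u x\<bar> * \<bar>v x\<bar> \<le> (u x)\<^sup>2 + (v x)\<^sup>2" unfolding power2_abs by linarith
    then show "norm (u x * v x) \<le> norm ((u x)\<^sup>2 + (v x)\<^sup>2)" by (simp add: abs_mult)
  qed
qed (intro borel_measurable_times L2_measurable assms)

lemma L2_integrable: "u \<in> L2sp \<Longrightarrow> integrable M u"
  using L2_mult_integrable[of u "\<lambda>x. 1"] by (auto simp: L2_on_def)

lemma L2_bounded_mult:
  assumes u: "u \<in> L2sp" and c: "c \<in> borel_measurable M" "AE x in M. \<bar>c x\<bar> \<le> B"
  shows "(\<lambda>x. c x * u x) \<in> L2sp"
proof -
  have "integrable M (\<lambda>x. (c x * u x)\<^sup>2)"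
  proof (rule Bochner_Integration.integrable_bound)
    show "integrable M (\<lambda>x. B\<^sup>2 * (u x)\<^sup>2)" using L2_sq[OF u] by simp
    show "AE x in M. norm ((c x * u x)\<^sup>2) \<le> norm (B\<^sup>2 * (u x)\<^sup>2)"
      using c(2)
    proof eventually_elim
      case (elim x)
      then have "(c x)\<^sup>2 \<le> B\<^sup>2" by (metis abs_ge_zero power2_abs power_mono)
      then show ?case by (simp add: power_mult_distrib mult_right_mono)
    qed
  qed (use c(1) L2_measurable[OF u] in measurable)
  then show ?thesis using c(1) L2_measurable[OF u] by (simp add: L2_on_def borel_measurable_times)
qed

lemma L2_add: "u \<in> L2sp \<Longrightarrow> v \<in> L2sp \<Longrightarrow> (\<lambda>x. u x + v x) \<in> L2sp"
proof -
  assume uv: "u \<in> L2sp" "v \<in> L2sp"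
  have "integrable M (\<lambda>x. (u x)\<^sup>2 + (v x)\<^sup>2 + 2 * (u x * v x))"
    using uv by (intro Bochner_Integration.integrable_add L2_sq integrable_mult_right L2_mult_integrable)
  then have "integrable M (\<lambda>x. (u x + v x)\<^sup>2)" by (simp add: power2_sum algebra_simps)
  then show ?thesis using uv by (auto simp: L2_on_def)
qed

lemma L2_cmult: "u \<in> L2sp \<Longrightarrow> (\<lambda>x. c * u x) \<in> L2sp"
  by (rule L2_bounded_mult[where B = "\<bar>c\<bar>"]) auto

sublocale L2: semi_inner "L2sp" "ipL2"
proof
  show "subspace (L2sp)"
    unfolding subspace_def plus_fun_eq scaleR_fun_def real_scaleR_def
    by (auto intro: L2_add L2_cmult) (simp add: L2_on_def zero_fun_def)
  fix x y z :: "real^'n \<Rightarrow> real" and c :: real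
  show "ipL2 x y = ipL2 y x" by (simp add: L2_inner_def mult.commute)
  show "ipL2 (x + y) z = ipL2 x z + ipL2 y z"
    if "x \<in> L2sp" "y \<in> L2sp" "z \<in> L2sp"
    using that by (simp add: L2_inner_def distrib_right L2_mult_integrable)
  show "ipL2 (c *\<^sub>R x) z = c * ipL2 x z"
    by (simp add: L2_inner_def scaleR_fun_def mult.assoc)
  show "0 \<le> ipL2 x x" by (simp add: L2_inner_def)
qed

lemma L2_inner_cong_AE:
  assumes "u \<in> L2sp" "u' \<in> L2sp" "v \<in> L2sp" "v' \<in> L2sp"
    and "AE x in M. u x = u' x" "AE x in M. v x = v' x"
  shows "ipL2 u v = ipL2 u' v'"
  unfolding L2_inner_def
proof (rule integral_cong_AE)
  show "AE x in M. u x * v x = u' x * v' x" using assms(5,6) by eventually_elim simp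
qed (intro borel_measurable_times L2_measurable assms)+

lemma L2_null_iff: "u \<in> L2sp \<Longrightarrow> ipL2 u u = 0 \<longleftrightarrow> (AE x in M. u x = 0)"
  unfolding L2_inner_def
  by (subst integral_nonneg_eq_0_iff_AE) (auto simp: L2_mult_integrable)

lemma AE_cong_L2: "u \<in> L2sp \<Longrightarrow> v \<in> borel_measurable M \<Longrightarrow> AE x in M. u x = v x \<Longrightarrow> v \<in> L2sp"
proof -
  assume u: "u \<in> L2sp" and v: "v \<in> borel_measurable M" "AE x in M. u x = v x"
  have "integrable M (\<lambda>x. (v x)\<^sup>2)"
    by (rule integrable_cong_AE_imp[OF L2_sq[OF u]])
      (use v in \<open>auto elim!: eventually_mono\<close>)
  then show ?thesis using v by (simp add: L2_on_def)
qed

text \<open>The measure is finite, so a Cauchy sequence in L2 is Cauchy in L1 and has a subsequence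
  converging almost everywhere. Fatou's lemma bounds the L2 distance from each late f n to the
  pointwise limit.\<close>

theorem L2_complete: "seminorm_complete (L2sp) L2.nrm"
  unfolding seminorm_complete_def
proof (intro allI impI, elim conjE)
  fix f :: "nat \<Rightarrow> real^'n \<Rightarrow> real"
  assume f: "\<forall>n. f n \<in> L2sp"
    and cau: "\<forall>e>0. \<exists>N. \<forall>m\<ge>N. \<forall>n\<ge>N. L2.nrm (f m - f n) < e"
  have one: "(\<lambda>x. 1) \<in> L2sp" by (simp add: L2_on_def)
  define c where "c = L2.nrm (\<lambda>x. 1) + 1"
  have c: "c > 0" using L2.p_nonneg[OF one] unfolding c_def by linarith
  have L1: "(\<integral>x. norm (f i x - f j x) \<partial>M) \<le> c * L2.nrm (f i - f j)" for i j
  proof -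
    have d: "f i - f j \<in> L2sp" using f L2.memX(3) by blast
    have ab: "(\<lambda>x. \<bar>(f i - f j) x\<bar>) \<in> L2sp"
      using d by (auto simp: L2_on_def minus_fun_eq)
    have "(\<integral>x. norm (f i x - f j x) \<partial>M) = ipL2 (\<lambda>x. \<bar>(f i - f j) x\<bar>) (\<lambda>x. 1)"
      by (simp add: L2_inner_def)
    also have "\<dots> \<le> L2.nrm (\<lambda>x. \<bar>(f i - f j) x\<bar>) * L2.nrm (\<lambda>x. 1)"
      using L2.Cauchy_Schwarz[OF ab one] by simp
    also have "L2.nrm (\<lambda>x. \<bar>(f i - f j) x\<bar>) = L2.nrm (f i - f j)"
      by (simp add: L2_inner_def)
    also have "\<dots> * L2.nrm (\<lambda>x. 1) \<le> c * L2.nrm (f i - f j)"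
      using L2.p_nonneg[OF d] by (simp add: c_def algebra_simps)
    finally show ?thesis .
  qed
  have "\<exists>N. \<forall>i\<ge>N. \<forall>j\<ge>N. (\<integral>x. norm (f i x - f j x) \<partial>M) < e" if e: "e > 0" for e
  proof -
    obtain N where N: "\<forall>m\<ge>N. \<forall>n\<ge>N. L2.nrm (f m - f n) < e / c" using cau e c by (meson divide_pos_pos)
    have "(\<integral>x. norm (f i x - f j x) \<partial>M) < e" if "i \<ge> N" "j \<ge> N" for i j
    proof -
      have "c * L2.nrm (f i - f j) < e" using N that c by (simp add: field_simps)
      then show ?thesis using L1[of i j] by linarith
    qed
    then show ?thesis by blast
  qed
  then obtain r where r: "strict_mono r" "AE x in M. Cauchy (\<lambda>i. f (r i) x)"
    using cauchy_L1_AE_cauchy_subseq[of M f] f L2_integrable by blast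
  define g where "g x = lim (\<lambda>i. f (r i) x)" for x
  have fm: "f n \<in> borel_measurable M" for n using f L2_measurable by blast
  have gm: "g \<in> borel_measurable M"
    unfolding g_def[abs_def] by (rule borel_measurable_lim_metric) (rule fm)
  have lim: "AE x in M. (\<lambda>i. f (r i) x) \<longlonglongrightarrow> g x"
    using r(2) by eventually_elim (simp add: g_def Cauchy_convergent_iff convergent_LIMSEQ_iff)
  \<comment> \<open>Integrability is part of the claim: it puts f n - g into L2 for late n, and
    hence g as well.\<close>
  have fatou: "integrable M (\<lambda>x. (f n x - g x)\<^sup>2) \<and> (\<integral>x. (f n x - g x)\<^sup>2 \<partial>M) \<le> e\<^sup>2"
    if e: "e > 0" and N: "\<forall>m\<ge>N. \<forall>n\<ge>N. L2.nrm (f m - f n) < e" and n: "n \<ge> N" for e N n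
  proof -
    have "(\<integral>\<^sup>+x. ennreal ((f n x - g x)\<^sup>2) \<partial>M) = (\<integral>\<^sup>+x. liminf (\<lambda>i. ennreal ((f n x - f (r i) x)\<^sup>2)) \<partial>M)"
    proof (rule nn_integral_cong_AE)
      show "AE x in M. ennreal ((f n x - g x)\<^sup>2) = liminf (\<lambda>i. ennreal ((f n x - f (r i) x)\<^sup>2))"
        using lim
      proof eventually_elim
        case (elim x)
        have "(\<lambda>i. ennreal ((f n x - f (r i) x)\<^sup>2)) \<longlonglongrightarrow> ennreal ((f n x - g x)\<^sup>2)"
          by (intro tendsto_intros elim)
        then show ?case using lim_imp_Liminf[OF sequentially_bot] by metis
      qed
    qed
    also have "\<dots> \<le> liminf (\<lambda>i. \<integral>\<^sup>+x. ennreal ((f n x - f (r i) x)\<^sup>2) \<partial>M)"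
      by (rule nn_integral_liminf) (use fm in measurable)
    also have "\<dots> \<le> ennreal (e\<^sup>2)"
    proof (rule Liminf_le)
      show "\<forall>\<^sub>F i in sequentially. (\<integral>\<^sup>+x. ennreal ((f n x - f (r i) x)\<^sup>2) \<partial>M) \<le> ennreal (e\<^sup>2)"
        unfolding eventually_sequentially
      proof (intro exI allI impI)
        fix i assume "i \<ge> N"
        then have ri: "r i \<ge> N" using seq_suble[OF r(1), of i] by linarith
        have d: "f n - f (r i) \<in> L2sp" using f L2.memX(3) by blast
        have "ipL2 (f n - f (r i)) (f n - f (r i)) = (L2.nrm (f n - f (r i)))\<^sup>2"
          using L2.nrm_sq[OF d] by simp
        also have "\<dots> \<le> e\<^sup>2" using N ri n L2.p_nonneg[OF d] by (intro power_mono) (auto simp: less_imp_le)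
        finally have "(\<integral>x. (f n x - f (r i) x)\<^sup>2 \<partial>M) \<le> e\<^sup>2"
          by (simp add: L2_inner_def power2_eq_square)
        then show "(\<integral>\<^sup>+x. ennreal ((f n x - f (r i) x)\<^sup>2) \<partial>M) \<le> ennreal (e\<^sup>2)"
          using L2_sq[OF d] by (subst nn_integral_eq_integral) (auto simp: ennreal_leI)
      qed
    qed simp
    finally have le: "(\<integral>\<^sup>+x. ennreal ((f n x - g x)\<^sup>2) \<partial>M) \<le> ennreal (e\<^sup>2)" .
    have int: "integrable M (\<lambda>x. (f n x - g x)\<^sup>2)"
      by (rule integrableI_bounded) (use fm gm le in \<open>auto intro: le_less_trans\<close>)
    then show ?thesis using le by (simp add: nn_integral_eq_integral)
  qed
  have fgL2: "f n - g \<in> L2sp" if "\<exists>N\<le>n. \<forall>m\<ge>N. \<forall>n\<ge>N. L2.nrm (f m - f n) < 1" for n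
    using that fatou[of 1] fm gm by (auto simp: L2_on_def minus_fun_eq)
  obtain N1 where N1: "\<forall>m\<ge>N1. \<forall>n\<ge>N1. L2.nrm (f m - f n) < 1" using cau by (meson zero_less_one)
  have gL2: "g \<in> L2sp"
    using L2.memX(3)[of "f N1" "f N1 - g"] f fgL2[of N1] N1 by force
  moreover have "(\<lambda>n. L2.nrm (f n - g)) \<longlonglongrightarrow> 0"
  proof (rule LIMSEQ_I)
    fix e :: real assume e: "e > 0"
    then obtain N where N: "\<forall>m\<ge>N. \<forall>n\<ge>N. L2.nrm (f m - f n) < e / 2" using cau by (meson half_gt_zero)
    have "norm (L2.nrm (f n - g) - 0) < e" if "n \<ge> N" for n
    proof -
      have "ipL2 (f n - g) (f n - g) \<le> (e / 2)\<^sup>2"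
        using fatou[OF half_gt_zero[OF e] N that] by (simp add: L2_inner_def power2_eq_square)
      then have "L2.nrm (f n - g) \<le> e / 2" using e by (intro real_le_lsqrt) auto
      then show ?thesis using e L2.p_nonneg[of "f n - g"] f gL2 by auto
    qed
    then show "\<exists>N. \<forall>n\<ge>N. norm (L2.nrm (f n - g) - 0) < e" by blast
  qed
  ultimately show "\<exists>x\<in>L2sp. (\<lambda>n. L2.nrm (f n - x)) \<longlonglongrightarrow> 0" by blast
qed

section \<open>Locally integrable functions and test functions\<close>

lemma integrable_imp_L1_loc: "integrable M u \<Longrightarrow> u \<in> L1_loc_on \<Omega>"
  unfolding L1_loc_on_def
  by (simp add: integrable_lebesgue_on_subset[OF _ _ sets_\<Omega>] lmeasurable_compact fmeasurableD)

lemma L2_imp_L1_loc: "u \<in> L2sp \<Longrightarrow> u \<in> L1_loc_on \<Omega>"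
  by (intro integrable_imp_L1_loc L2_integrable)

lemma L1_loc_add: "u \<in> L1_loc_on \<Omega> \<Longrightarrow> v \<in> L1_loc_on \<Omega> \<Longrightarrow> (\<lambda>x. u x + v x) \<in> L1_loc_on \<Omega>"
  and L1_loc_cmult: "u \<in> L1_loc_on \<Omega> \<Longrightarrow> (\<lambda>x. c * u x) \<in> L1_loc_on \<Omega>"
  by (auto simp: L1_loc_on_def)

text \<open>Measurability is available on each compact subset separately and is glued along a
  countable cover by closed boxes.\<close>

lemma L1_loc_measurable:
  assumes "u \<in> L1_loc_on \<Omega>" shows "u \<in> borel_measurable M"
proof (rule borel_measurableI)
  fix B :: "real set" assume B: "open B"
  obtain \<D> where D: "countable \<D>" "\<And>X. X \<in> \<D> \<Longrightarrow> \<exists>a b. X = cbox a b" "\<Union>\<D> = \<Omega>" "\<D> \<subseteq> Pow \<Omega>"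
    using open_countable_Union_open_cbox[OF open_\<Omega>] by metis
  have "u -` B \<inter> X \<in> sets lebesgue" if X: "X \<in> \<D>" for X
  proof -
    obtain a b where ab: "X = cbox a b" using D(2) X by blast
    then have "integrable (lebesgue_on X) u" using assms D(4) X by (auto simp: L1_loc_on_def)
    then have "u \<in> borel_measurable (lebesgue_on X)" by simp
    then have "u -` B \<inter> space (lebesgue_on X) \<in> sets (lebesgue_on X)"
      using B by (intro measurable_sets) auto
    then show ?thesis using ab by (auto simp: sets_restrict_space_iff space_restrict_space)
  qed
  then have "(\<Union>X\<in>\<D>. u -` B \<inter> X) \<in> sets lebesgue"
    using D(1) by (intro sets.countable_UN') auto
  also have "(\<Union>X\<in>\<D>. u -` B \<inter> X) = u -` B \<inter> \<Omega>" using D(3) by blast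
  finally show "u -` B \<inter> space M \<in> sets M" by (auto simp: sets_restrict_space)
qed

text \<open>The factor may blow up at the boundary, as the reciprocal of the weight does where x_l
  tends to 0; on compact subsets it is bounded.\<close>

lemma L1_loc_continuous_mult:
  assumes u: "u \<in> L1_loc_on \<Omega>" and c: "continuous_on \<Omega> c"
  shows "(\<lambda>x. c x * u x) \<in> L1_loc_on \<Omega>"
  unfolding L1_loc_on_def
proof (clarify)
  fix K assume K: "compact K" "K \<subseteq> \<Omega>"
  have Ks: "K \<in> sets lebesgue" using K(1) by (simp add: lmeasurable_compact fmeasurableD)
  have cK: "continuous_on K c" using c K(2) by (rule continuous_on_subset)
  then obtain B where B: "\<And>x. x \<in> K \<Longrightarrow> \<bar>c x\<bar> \<le> B"
    using compact_imp_bounded[OF compact_continuous_image[OF cK K(1)]] by (auto simp: bounded_iff)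
  have uK: "integrable (lebesgue_on K) u" using u K by (auto simp: L1_loc_on_def)
  show "integrable (lebesgue_on K) (\<lambda>x. c x * u x)"
  proof (rule Bochner_Integration.integrable_bound)
    show "integrable (lebesgue_on K) (\<lambda>x. B * u x)" using uK by simp
    show "(\<lambda>x. c x * u x) \<in> borel_measurable (lebesgue_on K)"
      using continuous_imp_measurable_on_sets_lebesgue[OF cK Ks] uK by (intro borel_measurable_times) auto
    show "AE x in lebesgue_on K. norm (c x * u x) \<le> norm (B * u x)"
      using B by (intro AE_I2) (force simp: space_restrict_space abs_mult intro!: mult_right_mono)
  qed
qed

lemma L1_loc_compact_support:
  assumes u: "u \<in> L1_loc_on \<Omega>" and K: "compact K" "K \<subseteq> \<Omega>" "\<And>x. x \<notin> K \<Longrightarrow> u x = 0"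
  shows "integrable M u"
proof -
  have Ks: "K \<in> sets lebesgue" using K(1) by (simp add: lmeasurable_compact fmeasurableD)
  have "integrable (lebesgue_on K) u" using u K by (auto simp: L1_loc_on_def)
  then have "integrable lebesgue (\<lambda>x. indicator K x *\<^sub>R u x)"
    using Ks by (simp add: integrable_restrict_space)
  also have "(\<lambda>x. indicator K x *\<^sub>R u x) = (\<lambda>x. indicator \<Omega> x *\<^sub>R u x)"
    using K(2,3) by (fastforce simp: indicator_def fun_eq_iff)
  finally show ?thesis by (simp add: integrable_restrict_space)
qed

lemma test_C_k: "\<phi> \<in> tests \<Longrightarrow> C_k k \<phi>"
  by (simp add: test_functions_def)

lemma test_support:
  assumes "\<phi> \<in> tests"
  shows "\<exists>K. compact K \<and> K \<subseteq> \<Omega> \<and> (\<forall>x. x \<notin> K \<longrightarrow> \<phi> x = 0)"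
proof (intro exI conjI allI impI)
  show "\<phi> x = 0" if "x \<notin> closure {x. \<phi> x \<noteq> 0}" for x
    using that closure_subset[of "{x. \<phi> x \<noteq> 0}"] by blast
qed (use assms in \<open>auto simp: test_functions_def\<close>)

lemma test_partial_continuous: "\<phi> \<in> tests \<Longrightarrow> continuous_on UNIV (partial_deriv i \<phi>)"
  and test_continuous: "\<phi> \<in> tests \<Longrightarrow> continuous_on UNIV \<phi>"
  and test_differentiable: "\<phi> \<in> tests \<Longrightarrow> \<phi> differentiable (at x)"
  unfolding test_functions_def by (auto intro: C_k_1 simp del: One_nat_def)

lemma test_mult_integrable:
  assumes u: "u \<in> L1_loc_on \<Omega>" and \<phi>: "\<phi> \<in> tests"
  shows "integrable M (\<lambda>x. u x * \<phi> x)" "integrable M (\<lambda>x. u x * partial_deriv i \<phi> x)"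
proof -
  obtain K where K: "compact K" "K \<subseteq> \<Omega>" "\<And>x. x \<notin> K \<Longrightarrow> \<phi> x = 0"
    using test_support[OF \<phi>] by blast
  have "(\<lambda>x. \<phi> x * u x) \<in> L1_loc_on \<Omega>" "(\<lambda>x. partial_deriv i \<phi> x * u x) \<in> L1_loc_on \<Omega>"
    using test_continuous[OF \<phi>] test_partial_continuous[OF \<phi>]
    by (intro L1_loc_continuous_mult[OF u]; blast intro: continuous_on_subset)+
  then have "integrable M (\<lambda>x. \<phi> x * u x)" "integrable M (\<lambda>x. partial_deriv i \<phi> x * u x)"
    using K partial_deriv_outside[OF compact_imp_closed[OF K(1)] K(3)]
    by (auto intro: L1_loc_compact_support)
  then show "integrable M (\<lambda>x. u x * \<phi> x)" "integrable M (\<lambda>x. u x * partial_deriv i \<phi> x)"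
    by (simp_all add: mult.commute)
qed

text \<open>Continuity is asked on \<Omega> only, which admits test functions divided by the
  weight.\<close>

lemma continuous_compact_support_L2:
  assumes c: "continuous_on \<Omega> c" and K: "compact K" "K \<subseteq> \<Omega>" "\<And>x. x \<notin> K \<Longrightarrow> c x = 0"
  shows "c \<in> L2sp"
proof -
  have "(\<lambda>x. 1) \<in> L1_loc_on \<Omega>" by (intro integrable_imp_L1_loc) simp
  then have "(\<lambda>x. (c x)\<^sup>2 * 1) \<in> L1_loc_on \<Omega>"
    by (rule L1_loc_continuous_mult) (intro continuous_intros c)
  then have "integrable M (\<lambda>x. (c x)\<^sup>2)"
    using L1_loc_compact_support[of "\<lambda>x. (c x)\<^sup>2" K] K by simp
  moreover have "c \<in> borel_measurable M"
    by (rule continuous_imp_measurable_on_sets_lebesgue[OF c]) simp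
  ultimately show ?thesis by (simp add: L2_on_def)
qed

lemma test_in_L2: "\<phi> \<in> tests \<Longrightarrow> \<phi> \<in> L2sp"
proof -
  assume \<phi>: "\<phi> \<in> tests"
  obtain K where "compact K" "K \<subseteq> \<Omega>" "\<And>x. x \<notin> K \<Longrightarrow> \<phi> x = 0"
    using test_support[OF \<phi>] by blast
  then show ?thesis
    by (rule continuous_compact_support_L2[OF continuous_on_subset[OF test_continuous[OF \<phi>] subset_UNIV]])
qed

lemma test_subspace: "subspace (tests)"
proof -
  have "(\<lambda>x. f x + g x) \<in> tests" if f: "f \<in> tests" and g: "g \<in> tests" for f g
  proof -
    have sub: "{x. f x + g x \<noteq> 0} \<subseteq> closure {x. f x \<noteq> 0} \<union> closure {x. g x \<noteq> 0}"
      using closure_subset[of "{x. f x \<noteq> 0}"] closure_subset[of "{x. g x \<noteq> 0}"]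
      by force
    have *: "closure {x. f x + g x \<noteq> 0} \<subseteq> closure {x. f x \<noteq> 0} \<union> closure {x. g x \<noteq> 0}"
      using sub by (intro closure_minimal) auto
    have "compact (closure {x. f x \<noteq> 0} \<union> closure {x. g x \<noteq> 0})"
      using f g by (intro compact_Un) (auto simp: test_functions_def)
    then have "compact (closure {x. f x + g x \<noteq> 0})"
      using bounded_subset[OF compact_imp_bounded sub] by (simp add: compact_closure)
    then show ?thesis using f g * C_k_add by (simp add: test_functions_def) blast
  qed
  moreover have "(\<lambda>x. c * f x) \<in> tests" if f: "f \<in> tests" for f c
  proof -
    have *: "closure {x. c * f x \<noteq> 0} \<subseteq> closure {x. f x \<noteq> 0}" by (intro closure_mono) auto
    then have "compact (closure {x. c * f x \<noteq> 0})"
      using f bounded_subset[of "{x. f x \<noteq> 0}" "{x. c * f x \<noteq> 0}"]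
      by (auto simp: test_functions_def)
    then show ?thesis using f order_trans[OF *] by (simp add: test_functions_def C_k_cmult)
  qed
  moreover have "(\<lambda>x. 0) \<in> tests" by (simp add: test_functions_def C_k_const)
  ultimately show ?thesis
    unfolding subspace_def plus_fun_eq scaleR_fun_def real_scaleR_def zero_fun_def by blast
qed

section \<open>Uniqueness and linearity of weak derivatives\<close>

lemma test_zero_imp_AE_zero:
  assumes "g \<in> L1_loc_on \<Omega>" "\<And>\<phi>. \<phi> \<in> tests \<Longrightarrow> (\<integral>x. g x * \<phi> x \<partial>M) = 0"
  shows "AE x in M. g x = 0"
  using fundamental_lemma[OF open_\<Omega>] assms by blast

text \<open>\<open>weak_gradient\<close> picks representatives by choice; this makes what is proved
  about it independent of the pick, up to null sets.\<close>

lemma weak_partial_unique: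
  assumes "has_weak_partial \<Omega> i u g" "has_weak_partial \<Omega> i u g'"
  shows "AE x in M. g x = g' x"
proof -
  have g: "g \<in> L1_loc_on \<Omega>" "g' \<in> L1_loc_on \<Omega>" using assms by (auto simp: has_weak_partial_def)
  have "AE x in M. g x + (-1) * g' x = 0"
  proof (rule test_zero_imp_AE_zero)
    show "(\<lambda>x. g x + (-1) * g' x) \<in> L1_loc_on \<Omega>" using g by (intro L1_loc_add L1_loc_cmult)
    fix \<phi> assume \<phi>: "\<phi> \<in> tests"
    then have "(\<integral>x. g x * \<phi> x \<partial>M) = (\<integral>x. g' x * \<phi> x \<partial>M)"
      using assms by (simp add: has_weak_partial_def)
    moreover have "(\<integral>x. (g x + (-1) * g' x) * \<phi> x \<partial>M) = (\<integral>x. g x * \<phi> x \<partial>M) - (\<integral>x. g' x * \<phi> x \<partial>M)"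
      using test_mult_integrable(1)[OF g(1) \<phi>] test_mult_integrable(1)[OF g(2) \<phi>]
      by (simp add: algebra_simps)
    ultimately show "(\<integral>x. (g x + (-1) * g' x) * \<phi> x \<partial>M) = 0" by simp
  qed
  then show ?thesis by eventually_elim simp
qed

lemma weak_partial_add:
  assumes "has_weak_partial \<Omega> i u g" "has_weak_partial \<Omega> i v h"
  shows "has_weak_partial \<Omega> i (u + v) (\<lambda>x. g x + h x)"
  unfolding has_weak_partial_def
proof (intro conjI ballI)
  note * = assms[unfolded has_weak_partial_def]
  show "u + v \<in> L1_loc_on \<Omega>" unfolding plus_fun_eq using * by (intro L1_loc_add) auto
  show "(\<lambda>x. g x + h x) \<in> L1_loc_on \<Omega>" using * by (intro L1_loc_add) auto
  fix \<phi> assume \<phi>: "\<phi> \<in> tests"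
  show "(\<integral>x. (u + v) x * partial_deriv i \<phi> x \<partial>M) = - (\<integral>x. (g x + h x) * \<phi> x \<partial>M)"
    using * \<phi> by (simp add: distrib_right test_mult_integrable)
qed

lemma weak_partial_cmult:
  assumes "has_weak_partial \<Omega> i u g"
  shows "has_weak_partial \<Omega> i (c *\<^sub>R u) (\<lambda>x. c * g x)"
  unfolding has_weak_partial_def scaleR_fun_def real_scaleR_def
proof (intro conjI ballI)
  note * = assms[unfolded has_weak_partial_def]
  show "(\<lambda>x. c * u x) \<in> L1_loc_on \<Omega>" "(\<lambda>x. c * g x) \<in> L1_loc_on \<Omega>"
    using * by (auto intro: L1_loc_cmult)
  fix \<phi> assume \<phi>: "\<phi> \<in> tests"
  show "(\<integral>x. c * u x * partial_deriv i \<phi> x \<partial>M) = - (\<integral>x. c * g x * \<phi> x \<partial>M)"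
    using * \<phi> by (simp add: mult.assoc)
qed

text \<open>The products involved vanish outside a compact subset of \<Omega>, so the integrals may
  be taken over the whole space and no boundary term arises.\<close>

lemma weak_partial_test:
  assumes \<phi>: "\<phi> \<in> tests"
  shows "has_weak_partial \<Omega> i \<phi> (partial_deriv i \<phi>)"
  unfolding has_weak_partial_def
proof (intro conjI ballI)
  obtain K where K: "compact K" "K \<subseteq> \<Omega>" "\<And>x. x \<notin> K \<Longrightarrow> \<phi> x = 0"
    using test_support[OF \<phi>] by blast
  have out: "partial_deriv i \<phi> x = 0" if "x \<notin> K" for x
    by (rule partial_deriv_outside[OF compact_imp_closed[OF K(1)] K(3) that])
  show "\<phi> \<in> L1_loc_on \<Omega>" using \<phi> test_in_L2 L2_imp_L1_loc by blast
  show "partial_deriv i \<phi> \<in> L1_loc_on \<Omega>"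
    by (intro L2_imp_L1_loc continuous_compact_support_L2[OF _ K(1,2)] out
        continuous_on_subset[OF test_partial_continuous[OF \<phi>]]) auto
  fix \<psi> assume \<psi>: "\<psi> \<in> tests"
  then have \<psi>1: "C_k 1 \<psi>" by (auto simp: test_functions_def simp del: One_nat_def)
  have cont: "continuous_on UNIV (\<lambda>x. \<phi> x * partial_deriv i \<psi> x)" "continuous_on UNIV (\<lambda>x. partial_deriv i \<phi> x * \<psi> x)"
    by (rule continuous_on_mult[OF test_continuous[OF \<phi>] test_partial_continuous[OF \<psi>]]
        continuous_on_mult[OF test_partial_continuous[OF \<phi>] test_continuous[OF \<psi>]])+
  have "(\<integral>x. \<phi> x * partial_deriv i \<psi> x \<partial>M) = (\<integral>x. \<phi> x * partial_deriv i \<psi> x \<partial>lebesgue)"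
    using K(2,3) by (intro integral_lebesgue_on_eq) auto
  also have "\<dots> = (\<integral>x. \<phi> x * partial_deriv i \<psi> x \<partial>lborel)"
    using cont by (intro integral_completion) (simp add: borel_measurable_continuous_onI)
  also have "\<dots> = - (\<integral>x. partial_deriv i \<phi> x * \<psi> x \<partial>lborel)"
    by (rule integration_by_parts[OF test_C_k[OF \<phi>] \<psi>1 K(1,3)])
  also have "(\<integral>x. partial_deriv i \<phi> x * \<psi> x \<partial>lborel) = (\<integral>x. partial_deriv i \<phi> x * \<psi> x \<partial>lebesgue)"
    using cont by (intro integral_completion[symmetric]) (simp add: borel_measurable_continuous_onI)
  also have "\<dots> = (\<integral>x. partial_deriv i \<phi> x * \<psi> x \<partial>M)"
    using out K(2) by (intro integral_lebesgue_on_eq[symmetric]) auto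
  finally show "(\<integral>x. \<phi> x * partial_deriv i \<psi> x \<partial>M) = - (\<integral>x. partial_deriv i \<phi> x * \<psi> x \<partial>M)" .
qed

lemma weak_gradient_partial:
  "\<exists>g. has_weak_partial \<Omega> i u g \<Longrightarrow> has_weak_partial \<Omega> i u (\<lambda>x. weak_gradient \<Omega> u x $ i)"
  unfolding weak_gradient_def by (simp add: someI_ex)

lemma weak_gradient_AE:
  "has_weak_partial \<Omega> i u g \<Longrightarrow> AE x in M. weak_gradient \<Omega> u x $ i = g x"
  using weak_partial_unique weak_gradient_partial by blast

end

section \<open>The weighted Sobolev space\<close>

locale weighted_domain = open_bounded \<Omega> for \<Omega> :: "(real^'n::finite) set" +
  fixes l :: 'n and \<alpha> :: real
  assumes half_space: "x \<in> \<Omega> \<Longrightarrow> 0 < x $ l" and \<alpha>_pos: "0 < \<alpha>" and \<alpha>_lt_1: "\<alpha> < 1"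
begin

abbreviation H1sp where "H1sp \<equiv> H1w l \<alpha> \<Omega>"
abbreviation H10sp where "H10sp \<equiv> H10w l \<alpha> \<Omega>"
abbreviation form where "form \<equiv> form_a l \<alpha> \<Omega>"
abbreviation energy where "energy \<equiv> energy_space l \<alpha> \<Omega>"
abbreviation ipE where "ipE \<equiv> energy_inner l \<alpha> \<Omega>"
abbreviation domA where "domA \<equiv> dom_A l \<alpha> \<Omega>"

text \<open>The square roots of the diagonal entries of A. They turn the form into a sum of L2 inner
  products of the components \<open>wgrad i u\<close> of A^(1/2) \<nabla>u, so that facts on L2
  apply componentwise.\<close>

definition wt :: "'n \<Rightarrow> real^'n \<Rightarrow> real" where
  "wt i x = (if i = l then (x $ l) powr (\<alpha> / 2) else 1)"

definition wgrad :: "'n \<Rightarrow> (real^'n \<Rightarrow> real) \<Rightarrow> real^'n \<Rightarrow> real" where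
  "wgrad i u x = wt i x * weak_gradient \<Omega> u x $ i"

lemma wt_pos: "x \<in> \<Omega> \<Longrightarrow> 0 < wt i x"
  using half_space[of x] by (simp add: wt_def)

lemma wt_continuous: "continuous_on \<Omega> (wt i)"
proof (cases "i = l")
  case True
  have "continuous_on \<Omega> (\<lambda>x. (x $ l) powr (\<alpha> / 2))"
    using half_space by (intro continuous_intros) force
  then show ?thesis using True by (simp add: wt_def[abs_def])
next
  case False then show ?thesis by (simp add: wt_def[abs_def])
qed

lemma wt_measurable: "wt i \<in> borel_measurable M"
  using wt_continuous by (rule continuous_imp_measurable_on_sets_lebesgue) simp

definition R :: real where "R = (SOME r. \<forall>x\<in>\<Omega>. norm x \<le> r)"

lemma R: "x \<in> \<Omega> \<Longrightarrow> x $ l \<le> R"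
proof -
  assume x: "x \<in> \<Omega>"
  have "\<exists>r. \<forall>x\<in>\<Omega>. norm x \<le> r" using bounded_\<Omega> by (simp add: bounded_iff)
  then have "\<forall>x\<in>\<Omega>. norm x \<le> R" unfolding R_def by (rule someI_ex)
  then show ?thesis using x component_le_norm_cart[of x l] by fastforce
qed

lemma wt_bounded: "x \<in> \<Omega> \<Longrightarrow> \<bar>wt i x\<bar> \<le> 1 + \<bar>R\<bar> powr (\<alpha> / 2)"
proof -
  assume x: "x \<in> \<Omega>"
  then have "(x $ l) powr (\<alpha> / 2) \<le> \<bar>R\<bar> powr (\<alpha> / 2)"
    using half_space[OF x] R[OF x] \<alpha>_pos by (intro powr_mono2) auto
  then show ?thesis by (auto simp: wt_def)
qed

lemma wt_mult_L2: "u \<in> L2sp \<Longrightarrow> (\<lambda>x. wt i x * u x) \<in> L2sp"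
  using wt_bounded by (intro L2_bounded_mult[OF _ wt_measurable]) (auto intro!: AE_I2)

lemma coeffA_inner:
  "a \<bullet> (coeffA l \<alpha> x *v b) = (\<Sum>i\<in>UNIV. (wt i x * a $ i) * (wt i x * b $ i))"
proof -
  have "(coeffA l \<alpha> x *v b) $ i = wt i x * wt i x * b $ i" for i
  proof -
    have "(coeffA l \<alpha> x *v b) $ i = (\<Sum>j\<in>UNIV. if i = j then (if i = l then (x $ l) powr \<alpha> else 1) * b $ j else 0)"
      unfolding matrix_vector_mult_def coeffA_def vec_lambda_beta by (rule sum.cong) auto
    also have "\<dots> = (if i = l then (x $ l) powr \<alpha> else 1) * b $ i" by simp
    also have "(if i = l then (x $ l) powr \<alpha> else 1) = wt i x * wt i x"
      by (simp add: wt_def flip: powr_add)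
    finally show ?thesis .
  qed
  then show ?thesis by (simp add: inner_vec_def algebra_simps)
qed

definition has_gradient where "has_gradient u \<longleftrightarrow> (\<forall>i. \<exists>g. has_weak_partial \<Omega> i u g)"

lemma has_gradientD: "has_gradient u \<Longrightarrow> has_weak_partial \<Omega> i u (\<lambda>x. weak_gradient \<Omega> u x $ i)"
  using weak_gradient_partial by (simp add: has_gradient_def)

lemma wgrad_measurable: "has_gradient u \<Longrightarrow> wgrad i u \<in> borel_measurable M"
  using L1_loc_measurable has_gradientD[of u i] wt_measurable
  unfolding wgrad_def[abs_def] has_weak_partial_def by (intro borel_measurable_times) auto

text \<open>A sum of squares dominates each summand, so its integrability passes to every component;
  measurability of the components comes from local integrability of the weak derivatives.\<close>

lemma H1w_iff: "u \<in> H1sp \<longleftrightarrow> u \<in> L2sp \<and> has_gradient u \<and> (\<forall>i. wgrad i u \<in> L2sp)"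
proof -
  have eq: "weak_gradient \<Omega> u x \<bullet> (coeffA l \<alpha> x *v weak_gradient \<Omega> u x) = (\<Sum>i\<in>UNIV. (wgrad i u x)\<^sup>2)" for x
    by (simp add: coeffA_inner wgrad_def power2_eq_square)
  have "integrable M (\<lambda>x. \<Sum>i\<in>UNIV. (wgrad i u x)\<^sup>2) \<longleftrightarrow> (\<forall>i. wgrad i u \<in> L2sp)" if u: "has_gradient u"
  proof
    assume int: "integrable M (\<lambda>x. \<Sum>i\<in>UNIV. (wgrad i u x)\<^sup>2)"
    show "\<forall>i. wgrad i u \<in> L2sp"
    proof
      fix i
      have m: "wgrad i u \<in> borel_measurable M" using wgrad_measurable u .
      have "integrable M (\<lambda>x. (wgrad i u x)\<^sup>2)"
      proof (rule Bochner_Integration.integrable_bound[OF int])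
        show "AE x in M. norm ((wgrad i u x)\<^sup>2) \<le> norm (\<Sum>i\<in>UNIV. (wgrad i u x)\<^sup>2)"
        proof (rule AE_I2)
          fix x
          have "(wgrad i u x)\<^sup>2 \<le> (\<Sum>i\<in>UNIV. (wgrad i u x)\<^sup>2)"
            by (rule member_le_sum) auto
          then show "norm ((wgrad i u x)\<^sup>2) \<le> norm (\<Sum>i\<in>UNIV. (wgrad i u x)\<^sup>2)" by simp
        qed
      qed (use m in measurable)
      then show "wgrad i u \<in> L2sp" using m by (simp add: L2_on_def)
    qed
  next
    assume "\<forall>i. wgrad i u \<in> L2sp"
    then show "integrable M (\<lambda>x. \<Sum>i\<in>UNIV. (wgrad i u x)\<^sup>2)"
      by (intro Bochner_Integration.integrable_sum L2_sq) auto
  qed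
  moreover have "u \<in> H1sp \<longleftrightarrow> u \<in> L2sp \<and> has_gradient u \<and> integrable M (\<lambda>x. \<Sum>i\<in>UNIV. (wgrad i u x)\<^sup>2)"
    by (simp add: H1w_def has_gradient_def eq)
  ultimately show ?thesis by blast
qed

lemma H1w_D:
  assumes "u \<in> H1sp"
  shows "u \<in> L2sp" "has_gradient u" "wgrad i u \<in> L2sp"
  using assms by (simp_all add: H1w_iff)

lemma form_a_eq:
  assumes "u \<in> H1sp" "v \<in> H1sp"
  shows "form u v = (\<Sum>i\<in>UNIV. ipL2 (wgrad i u) (wgrad i v))"
proof -
  have "form u v = (\<integral>x. (\<Sum>i\<in>UNIV. wgrad i u x * wgrad i v x) \<partial>M)"
    by (simp add: form_a_def coeffA_inner wgrad_def)
  also have "\<dots> = (\<Sum>i\<in>UNIV. ipL2 (wgrad i u) (wgrad i v))"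
    unfolding L2_inner_def using assms
    by (intro Bochner_Integration.integral_sum L2_mult_integrable H1w_D)
  finally show ?thesis .
qed

lemma wgrad_AE: "has_weak_partial \<Omega> i u g \<Longrightarrow> AE x in M. wgrad i u x = wt i x * g x"
  using weak_gradient_AE[of i u g] by (auto simp: wgrad_def elim!: eventually_mono)

text \<open>Equality holds almost everywhere only, because the gradient of a sum is a choice made
  separately from those of the summands.\<close>

lemma wgrad_add:
  assumes "has_gradient u" "has_gradient v"
  shows "has_gradient (u + v)" "AE x in M. wgrad i (u + v) x = (wgrad i u + wgrad i v) x"
proof -
  have *: "has_weak_partial \<Omega> i (u + v) (\<lambda>x. weak_gradient \<Omega> u x $ i + weak_gradient \<Omega> v x $ i)" for i
    using assms by (intro weak_partial_add has_gradientD)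
  show "has_gradient (u + v)" using * unfolding has_gradient_def by blast
  show "AE x in M. wgrad i (u + v) x = (wgrad i u + wgrad i v) x"
    using wgrad_AE[OF *[of i]] by (simp add: wgrad_def distrib_left)
qed

lemma wgrad_scale:
  assumes "has_gradient u"
  shows "has_gradient (c *\<^sub>R u)" "AE x in M. wgrad i (c *\<^sub>R u) x = (c *\<^sub>R wgrad i u) x"
proof -
  have *: "has_weak_partial \<Omega> i (c *\<^sub>R u) (\<lambda>x. c * weak_gradient \<Omega> u x $ i)" for i
    using assms by (intro weak_partial_cmult has_gradientD)
  show "has_gradient (c *\<^sub>R u)" using * unfolding has_gradient_def by blast
  show "AE x in M. wgrad i (c *\<^sub>R u) x = (c *\<^sub>R wgrad i u) x"
    using wgrad_AE[OF *[of i]] by (simp add: wgrad_def scaleR_fun_def algebra_simps)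
qed

lemma H1w_add: assumes u: "u \<in> H1sp" and v: "v \<in> H1sp" shows "u + v \<in> H1sp"
  unfolding H1w_iff
proof (intro conjI allI)
  note g = wgrad_add[OF H1w_D(2)[OF u] H1w_D(2)[OF v]]
  show "u + v \<in> L2sp" using H1w_D[OF u] H1w_D[OF v] L2.memX(2) by blast
  show "has_gradient (u + v)" by (rule g(1))
  fix i
  have "wgrad i u + wgrad i v \<in> L2sp" using H1w_D[OF u] H1w_D[OF v] L2.memX(2) by blast
  then show "wgrad i (u + v) \<in> L2sp"
    by (rule AE_cong_L2[OF _ wgrad_measurable[OF g(1)]]) (use g(2)[of i] in \<open>auto elim!: eventually_mono\<close>)
qed

lemma H1w_scale: assumes u: "u \<in> H1sp" shows "c *\<^sub>R u \<in> H1sp"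
  unfolding H1w_iff
proof (intro conjI allI)
  note g = wgrad_scale[OF H1w_D(2)[OF u], where c = c]
  show "c *\<^sub>R u \<in> L2sp" using H1w_D[OF u] L2.memX(4) by blast
  show "has_gradient (c *\<^sub>R u)" by (rule g(1))
  fix i
  have "c *\<^sub>R wgrad i u \<in> L2sp" using H1w_D[OF u] L2.memX(4) by blast
  then show "wgrad i (c *\<^sub>R u) \<in> L2sp"
    by (rule AE_cong_L2[OF _ wgrad_measurable[OF g(1)]]) (use g(2)[of i] in \<open>auto elim!: eventually_mono\<close>)
qed

lemma test_wgrad:
  assumes \<phi>: "\<phi> \<in> tests"
  shows "(\<lambda>x. wt i x * partial_deriv i \<phi> x) \<in> L2sp" "AE x in M. wgrad i \<phi> x = wt i x * partial_deriv i \<phi> x"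
proof -
  obtain K where K: "compact K" "K \<subseteq> \<Omega>" "\<And>x. x \<notin> K \<Longrightarrow> \<phi> x = 0"
    using test_support[OF \<phi>] by blast
  have out: "partial_deriv i \<phi> x = 0" if "x \<notin> K" for x
    by (rule partial_deriv_outside[OF compact_imp_closed[OF K(1)] K(3) that])
  have "partial_deriv i \<phi> \<in> L2sp"
    by (rule continuous_compact_support_L2[OF continuous_on_subset[OF test_partial_continuous[OF \<phi>] subset_UNIV] K(1,2) out])
  then show "(\<lambda>x. wt i x * partial_deriv i \<phi> x) \<in> L2sp" by (rule wt_mult_L2)
  show "AE x in M. wgrad i \<phi> x = wt i x * partial_deriv i \<phi> x"
    by (rule wgrad_AE[OF weak_partial_test[OF \<phi>]])
qed

lemma test_in_H1w: assumes \<phi>: "\<phi> \<in> tests" shows "\<phi> \<in> H1sp"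
  unfolding H1w_iff
proof (intro conjI allI)
  show g: "has_gradient \<phi>" using weak_partial_test[OF \<phi>] unfolding has_gradient_def by blast
  show "\<phi> \<in> L2sp" using \<phi> by (rule test_in_L2)
  fix i show "wgrad i \<phi> \<in> L2sp"
    by (rule AE_cong_L2[OF test_wgrad(1)[OF \<phi>] wgrad_measurable[OF g]])
      (use test_wgrad(2)[OF \<phi>, of i] in \<open>auto elim!: eventually_mono\<close>)
qed

lemma form_a_add:
  assumes H: "x \<in> H1sp" "y \<in> H1sp" "z \<in> H1sp"
  shows "form (x + y) z = form x z + form y z"
proof -
  have "ipL2 (wgrad i (x + y)) (wgrad i z) = ipL2 (wgrad i x + wgrad i y) (wgrad i z)" for i
    using wgrad_add(2)[OF H1w_D(2)[OF H(1)] H1w_D(2)[OF H(2)]] H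
    by (intro L2_inner_cong_AE H1w_D H1w_add L2.memX) auto
  then show ?thesis using H H1w_D(3)
    by (simp add: form_a_eq H1w_add L2.ip_add sum.distrib)
qed

lemma form_a_scale:
  assumes H: "x \<in> H1sp" "z \<in> H1sp"
  shows "form (c *\<^sub>R x) z = c * form x z"
proof -
  have "ipL2 (wgrad i (c *\<^sub>R x)) (wgrad i z) = ipL2 (c *\<^sub>R wgrad i x) (wgrad i z)" for i
    using wgrad_scale(2)[OF H1w_D(2)[OF H(1)]] H
    by (intro L2_inner_cong_AE H1w_D H1w_scale L2.memX) auto
  then show ?thesis using H H1w_D(3)
    by (simp add: form_a_eq H1w_scale L2.ip_scale sum_distrib_left)
qed

lemma form_a_sym:
  assumes H: "x \<in> H1sp" "z \<in> H1sp"
  shows "form x z = form z x"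
  using H by (simp add: form_a_eq L2.ip_sym H1w_D)

lemma form_a_nonneg: "x \<in> H1sp \<Longrightarrow> 0 \<le> form x x"
  by (simp add: form_a_eq sum_nonneg L2.ip_nonneg H1w_D)

lemma H1w_zero: "0 \<in> H1sp"
  using test_in_H1w subspace_0[OF test_subspace] by blast

lemma H1w_subspace: "subspace (H1sp)"
  unfolding subspace_def using H1w_zero H1w_add H1w_scale by blast

sublocale H1: semi_inner "H1sp" "\<lambda>u v. ipL2 u v + form u v"
proof
  fix x y z :: "real^'n \<Rightarrow> real" and c :: real
  assume x: "x \<in> H1sp"
  show "0 \<le> ipL2 x x + form x x"
    using x form_a_nonneg L2.ip_nonneg H1w_D(1) by (simp add: add_nonneg_nonneg)
  assume z: "z \<in> H1sp"
  show "ipL2 (c *\<^sub>R x) z + form (c *\<^sub>R x) z = c * (ipL2 x z + form x z)"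
    using x z by (simp add: form_a_scale L2.ip_scale H1w_D(1) distrib_left)
  show "ipL2 x z + form x z = ipL2 z x + form z x"
    using x z by (simp add: form_a_sym[of x z] L2.ip_sym[of x z] H1w_D(1))
  assume y: "y \<in> H1sp"
  show "ipL2 (x + y) z + form (x + y) z
      = ipL2 x z + form x z + (ipL2 y z + form y z)"
    using x y z by (simp add: form_a_add L2.ip_add H1w_D(1))
qed (rule H1w_subspace)

lemma H10w_iff: "u \<in> H10sp \<longleftrightarrow>
    u \<in> H1sp \<and> (\<forall>e>0. \<exists>\<phi>\<in>tests. H1.nrm (u - \<phi>) < e)"
  by (simp add: H10w_def H1w_norm_def)

lemma H10w_in_H1w: "u \<in> H10sp \<Longrightarrow> u \<in> H1sp"
  and H10w_in_L2: "u \<in> H10sp \<Longrightarrow> u \<in> L2sp"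
  using H1w_D(1) by (auto simp: H10w_def)

lemma test_in_H10w: "\<phi> \<in> tests \<Longrightarrow> \<phi> \<in> H10sp"
  unfolding H10w_iff using test_in_H1w H1.p_zero by force

lemma H10w_subspace: "subspace (H10sp)"
proof -
  have "u + v \<in> H10sp" if u: "u \<in> H10sp" and v: "v \<in> H10sp" for u v
    unfolding H10w_iff
  proof (intro conjI allI impI)
    show "u + v \<in> H1sp" using u v H1w_add by (simp add: H10w_iff)
    fix e :: real assume e: "e > 0"
    obtain \<phi> where p: "\<phi> \<in> tests" "H1.nrm (u - \<phi>) < e / 2"
      using u half_gt_zero[OF e] unfolding H10w_iff by blast
    obtain \<psi> where q: "\<psi> \<in> tests" "H1.nrm (v - \<psi>) < e / 2"
      using v half_gt_zero[OF e] unfolding H10w_iff by blast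
    have H: "u - \<phi> \<in> H1sp" "v - \<psi> \<in> H1sp"
      using H10w_in_H1w[OF u] H10w_in_H1w[OF v] test_in_H1w[OF p(1)] test_in_H1w[OF q(1)] H1.memX(3) by blast+
    have "H1.nrm (u + v - (\<phi> + \<psi>)) = H1.nrm ((u - \<phi>) + (v - \<psi>))"
      by (simp add: algebra_simps)
    also have "\<dots> < e" using H1.p_triangle[OF H] p q by linarith
    finally show "\<exists>\<phi>\<in>tests. H1.nrm (u + v - \<phi>) < e"
      using subspace_add[OF test_subspace p(1) q(1)] by blast
  qed
  moreover have "c *\<^sub>R u \<in> H10sp" if u: "u \<in> H10sp" for u c
    unfolding H10w_iff
  proof (intro conjI allI impI)
    show "c *\<^sub>R u \<in> H1sp" using u H1w_scale by (simp add: H10w_iff)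
    fix e :: real assume e: "e > 0"
    have "e / (\<bar>c\<bar> + 1) > 0" using e by (simp add: add_nonneg_pos)
    then obtain \<phi> where p: "\<phi> \<in> tests" "H1.nrm (u - \<phi>) < e / (\<bar>c\<bar> + 1)"
      using u unfolding H10w_iff by blast
    have H: "u - \<phi> \<in> H1sp"
      using H10w_in_H1w[OF u] test_in_H1w[OF p(1)] H1.memX(3) by blast
    have "H1.nrm (c *\<^sub>R u - c *\<^sub>R \<phi>) = \<bar>c\<bar> * H1.nrm (u - \<phi>)"
      using H1.p_scale[OF H, of c] by (simp add: scaleR_diff_right)
    also have "\<dots> \<le> (\<bar>c\<bar> + 1) * H1.nrm (u - \<phi>)"
      using H1.p_nonneg[OF H] by (intro mult_right_mono) auto
    also have "\<dots> < e" using p(2) by (simp add: pos_less_divide_eq add_nonneg_pos mult.commute)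
    finally show "\<exists>\<phi>\<in>tests. H1.nrm (c *\<^sub>R u - \<phi>) < e"
      using subspace_scale[OF test_subspace p(1)] by blast
  qed
  ultimately show ?thesis
    unfolding subspace_def using test_in_H10w subspace_0[OF test_subspace] by blast
qed

sublocale E: semi_inner "H10sp" "form"
proof
qed (blast intro: H10w_subspace form_a_sym form_a_add form_a_scale form_a_nonneg H10w_in_H1w)+

text \<open>\<open>sqrt P\<close> is 2 * sqrt (R^2 + 1) and bounds 2 x_l^(1 - \<alpha>/2) on
  \<Omega>: the power is at most 1 where x_l \<le> 1 and at most R elsewhere.\<close>

definition P :: real where "P = 4 * (R\<^sup>2 + 1)"

lemma P_pos: "P > 0" by (simp add: P_def add_nonneg_pos)

text \<open>Integrate \<open>\<phi>\<^sup>2 = \<phi>\<^sup>2 * \<partial>\<^sub>N x\<^sub>N\<close> by parts; the factor \<open>x\<^sub>N\<close> gained absorbs the degenerate weight.\<close>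

lemma Poincare_test:
  assumes \<phi>: "\<phi> \<in> tests"
  shows "ipL2 \<phi> \<phi> \<le> P * form \<phi> \<phi>"
proof -
  obtain K where K: "compact K" "K \<subseteq> \<Omega>" "\<And>x. x \<notin> K \<Longrightarrow> \<phi> x = 0"
    using test_support[OF \<phi>] by blast
  define d where "d = partial_deriv l \<phi>"
  have \<phi>1: "C_k 1 \<phi>" using test_C_k[OF \<phi>] .
  have x1: "C_k 1 (\<lambda>x::real^'n. x $ l)"
    using C_k_coord[of "\<lambda>j t. if j = 0 then t else if j = 1 then 1 else 0" 1 0 1 l 0]
    by (auto intro!: derivative_eq_intros simp del: One_nat_def)
  have px: "partial_deriv l (\<lambda>x::real^'n. x $ l) x = 1" for x
    using partial_deriv_coord(2)[of "\<lambda>t. t" "\<lambda>_. 1" l 1 l 0 x] by simp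
  have sq: "partial_deriv l (\<lambda>x. \<phi> x * \<phi> x) x = 2 * (\<phi> x * d x)" for x
    using partial_deriv_mult[OF test_differentiable[OF \<phi>] test_differentiable[OF \<phi>], of l x] by (simp add: d_def)
  have cont: "continuous_on UNIV \<phi>" "continuous_on UNIV d"
    using test_continuous[OF \<phi>] test_partial_continuous[OF \<phi>] by (auto simp: d_def)
  have bm: "(\<lambda>x. \<phi> x * \<phi> x) \<in> borel_measurable lborel" "(\<lambda>x. 2 * (\<phi> x * d x) * x $ l) \<in> borel_measurable lborel"
    using cont by (auto intro!: borel_measurable_continuous_onI continuous_intros)
  have "ipL2 \<phi> \<phi> = (\<integral>x. \<phi> x * \<phi> x \<partial>lebesgue)"
    unfolding L2_inner_def using K by (intro integral_lebesgue_on_eq) auto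
  also have "\<dots> = (\<integral>x. \<phi> x * \<phi> x * partial_deriv l (\<lambda>x. x $ l) x \<partial>lborel)"
    using bm by (simp add: px integral_completion)
  also have "\<dots> = - (\<integral>x. 2 * (\<phi> x * d x) * x $ l \<partial>lborel)"
    using integration_by_parts[OF C_k_mult[OF \<phi>1 \<phi>1] x1 K(1), of l] K(3) by (simp add: sq)
  also have "(\<integral>x. 2 * (\<phi> x * d x) * x $ l \<partial>lborel) = (\<integral>x. 2 * (\<phi> x * d x) * x $ l \<partial>lebesgue)"
    using bm by (simp add: integral_completion)
  also have "\<dots> = (\<integral>x. 2 * (\<phi> x * d x) * x $ l \<partial>M)"
    using K by (intro integral_lebesgue_on_eq[symmetric]) auto
  finally have eq: "ipL2 \<phi> \<phi> = - (\<integral>x. 2 * (\<phi> x * d x) * x $ l \<partial>M)" .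
  \<comment> \<open>x_l is split into x_l^(1 - \<alpha>/2), which is bounded and goes with \<phi>,
    and x_l^(\<alpha>/2), the square root of the weight, which goes with the derivative and forms
    g.\<close>
  define c where "c x = - 2 * (x $ l) powr (1 - \<alpha> / 2)" for x :: "real^'n"
  define g where "g x = wt l x * d x" for x
  have cb: "\<bar>c x\<bar> \<le> sqrt P" if x: "x \<in> \<Omega>" for x
  proof -
    have xl: "0 < x $ l" "x $ l \<le> R" using half_space R x by auto
    have "(x $ l) powr (1 - \<alpha> / 2) \<le> sqrt (R\<^sup>2 + 1)"
    proof (cases "x $ l \<le> 1")
      case True
      then have "(x $ l) powr (1 - \<alpha> / 2) \<le> 1" using xl \<alpha>_lt_1 by (intro powr_le1) auto
      also have "\<dots> \<le> sqrt (R\<^sup>2 + 1)" by simp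
      finally show ?thesis .
    next
      case False
      then have "(x $ l) powr (1 - \<alpha> / 2) \<le> (x $ l) powr 1" using \<alpha>_pos by (intro powr_mono) auto
      also have "\<dots> \<le> R" using xl by simp
      also have "\<dots> \<le> sqrt (R\<^sup>2 + 1)" by (rule real_le_rsqrt) simp
      finally show ?thesis .
    qed
    moreover have "sqrt P = 2 * sqrt (R\<^sup>2 + 1)" unfolding P_def real_sqrt_mult by simp
    ultimately show ?thesis by (simp add: c_def abs_mult)
  qed
  have cc: "continuous_on \<Omega> c" unfolding c_def[abs_def]
    using half_space by (intro continuous_intros) force
  have cm: "c \<in> borel_measurable M" using cc by (rule continuous_imp_measurable_on_sets_lebesgue) simp
  have cphi: "(\<lambda>x. c x * \<phi> x) \<in> L2sp"
    using cb by (intro L2_bounded_mult[OF test_in_L2[OF \<phi>] cm, of "sqrt P"]) (auto intro!: AE_I2)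
  have gL2: "g \<in> L2sp" unfolding g_def[abs_def] d_def by (rule test_wgrad(1)[OF \<phi>])
  have "ipL2 \<phi> \<phi> = (\<integral>x. - (2 * (\<phi> x * d x) * x $ l) \<partial>M)" unfolding eq by simp
  also have "\<dots> = ipL2 (\<lambda>x. c x * \<phi> x) g"
    unfolding L2_inner_def
  proof (rule Bochner_Integration.integral_cong)
    fix x assume "x \<in> space M"
    then have xl: "0 < x $ l" using half_space by simp
    have "(x $ l) powr (1 - \<alpha> / 2) * (x $ l) powr (\<alpha> / 2) = x $ l"
      using xl by (simp flip: powr_add)
    then have "c x * wt l x = - 2 * x $ l" by (simp add: c_def wt_def)
    then show "- (2 * (\<phi> x * d x) * x $ l) = c x * \<phi> x * g x"
      unfolding g_def by (metis (no_types, opaque_lifting) mult.assoc mult.commute mult_minus_left)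
  qed simp
  also have "\<dots> \<le> L2.nrm (\<lambda>x. c x * \<phi> x) * L2.nrm g"
    using L2.Cauchy_Schwarz[OF cphi gL2] by simp
  also have "L2.nrm (\<lambda>x. c x * \<phi> x) \<le> sqrt P * L2.nrm \<phi>"
  proof -
    have "ipL2 (\<lambda>x. c x * \<phi> x) (\<lambda>x. c x * \<phi> x) \<le> (\<integral>x. P * (\<phi> x * \<phi> x) \<partial>M)"
      unfolding L2_inner_def
    proof (rule integral_mono)
      show "integrable M (\<lambda>x. c x * \<phi> x * (c x * \<phi> x))" using L2_mult_integrable[OF cphi cphi] .
      show "integrable M (\<lambda>x. P * (\<phi> x * \<phi> x))"
        using L2_mult_integrable[OF test_in_L2[OF \<phi>] test_in_L2[OF \<phi>]] by simp
      fix x assume "x \<in> space M"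
      then have "(c x)\<^sup>2 \<le> P" using cb[of x] P_pos
        by (metis abs_ge_zero less_imp_le power2_abs power_mono real_sqrt_pow2 space_M)
      then have "(c x)\<^sup>2 * (\<phi> x * \<phi> x) \<le> P * (\<phi> x * \<phi> x)" by (intro mult_right_mono) auto
      then show "c x * \<phi> x * (c x * \<phi> x) \<le> P * (\<phi> x * \<phi> x)" by (simp add: power2_eq_square algebra_simps)
    qed
    also have "\<dots> = P * ipL2 \<phi> \<phi>" by (simp add: L2_inner_def)
    finally show ?thesis by (metis real_sqrt_le_mono real_sqrt_mult)
  qed
  finally have main: "ipL2 \<phi> \<phi> \<le> sqrt P * L2.nrm \<phi> * L2.nrm g"
    using L2.p_nonneg[OF gL2] by (simp add: mult_right_mono)
  have g_le: "ipL2 g g \<le> form \<phi> \<phi>"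
  proof -
    have H: "\<phi> \<in> H1sp" using \<phi> by (rule test_in_H1w)
    have "ipL2 g g = ipL2 (wgrad l \<phi>) (wgrad l \<phi>)"
      using test_wgrad(2)[OF \<phi>, of l] gL2 H1w_D(3)[OF H]
      by (intro L2_inner_cong_AE) (auto simp: g_def d_def elim!: eventually_mono)
    also have "\<dots> \<le> (\<Sum>i\<in>UNIV. ipL2 (wgrad i \<phi>) (wgrad i \<phi>))"
      using H1w_D(3)[OF H] by (intro member_le_sum) (auto intro: L2.ip_nonneg)
    also have "\<dots> = form \<phi> \<phi>" using H by (simp add: form_a_eq)
    finally show ?thesis .
  qed
  define N where "N = L2.nrm \<phi>"
  have N: "N \<ge> 0" "N\<^sup>2 = ipL2 \<phi> \<phi>"
    using L2.p_nonneg[OF test_in_L2[OF \<phi>]] L2.nrm_sq[OF test_in_L2[OF \<phi>]] by (auto simp: N_def)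
  have "N * N \<le> N * (sqrt P * L2.nrm g)" using main N by (simp add: N_def[symmetric] power2_eq_square algebra_simps)
  \<comment> \<open>One factor N is cancelled; for N = 0 the bound is trivial.\<close>
  then have "N \<le> sqrt P * L2.nrm g"
    using N(1) L2.p_nonneg[OF gL2] P_pos by (cases "N = 0") auto
  then have "N\<^sup>2 \<le> (sqrt P * L2.nrm g)\<^sup>2" using N(1) by (rule power_mono)
  also have "\<dots> = P * ipL2 g g" using P_pos L2.nrm_sq[OF gL2] by (simp add: power_mult_distrib)
  also have "\<dots> \<le> P * form \<phi> \<phi>" using g_le P_pos by simp
  finally show ?thesis using N(2) by simp
qed

lemma nrm_le_H1:
  assumes "u \<in> H1sp"
  shows "L2.nrm u \<le> H1.nrm u" "E.nrm u \<le> H1.nrm u"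
  using form_a_nonneg[OF assms] L2.ip_nonneg[OF H1w_D(1)[OF assms]] by simp_all

lemma Poincare:
  assumes u: "u \<in> H10sp"
  shows "L2.nrm u \<le> sqrt P * E.nrm u"
proof (rule field_le_epsilon)
  fix e :: real assume e: "e > 0"
  \<comment> \<open>Replacing u by \<phi> costs the L2 norm of u - \<phi> once and its energy norm
    \<open>sqrt P\<close> times, and the full norm dominates both.\<close>
  define k where "k = 1 + sqrt P"
  have k: "k > 0" using P_pos by (simp add: k_def add_pos_nonneg)
  then have "e / k > 0" using e by simp
  then obtain \<phi> where \<phi>: "\<phi> \<in> tests" "H1.nrm (u - \<phi>) < e / k"
    using u unfolding H10w_iff by blast
  have H: "\<phi> \<in> H10sp" using \<phi>(1) by (rule test_in_H10w)
  have d: "u - \<phi> \<in> H1sp" using H10w_in_H1w u H H1.memX(3) by blast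
  have "L2.nrm \<phi> \<le> sqrt (P * form \<phi> \<phi>)"
    using Poincare_test[OF \<phi>(1)] by (rule real_sqrt_le_mono)
  then have t: "L2.nrm \<phi> \<le> sqrt P * E.nrm \<phi>" by (simp add: real_sqrt_mult)
  have "L2.nrm u \<le> L2.nrm (u - \<phi>) + L2.nrm \<phi>"
    using L2.p_triangle[of "u - \<phi>" \<phi>] H1w_D(1)[OF d] H10w_in_L2[OF H] by simp
  also have "L2.nrm \<phi> \<le> sqrt P * (E.nrm u + E.nrm (u - \<phi>))"
  proof -
    have "E.nrm \<phi> \<le> E.nrm u + E.nrm (u - \<phi>)" using E.p_diff_lower[OF u H] by linarith
    then have "sqrt P * E.nrm \<phi> \<le> sqrt P * (E.nrm u + E.nrm (u - \<phi>))" using P_pos by simp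
    then show ?thesis using t by linarith
  qed
  finally have "L2.nrm u \<le> sqrt P * E.nrm u + (L2.nrm (u - \<phi>) + sqrt P * E.nrm (u - \<phi>))"
    unfolding distrib_left by linarith
  also have "L2.nrm (u - \<phi>) + sqrt P * E.nrm (u - \<phi>) \<le> H1.nrm (u - \<phi>) + sqrt P * H1.nrm (u - \<phi>)"
    using nrm_le_H1[OF d] P_pos by (intro add_mono mult_left_mono) auto
  also have "\<dots> = k * H1.nrm (u - \<phi>)" by (simp add: k_def algebra_simps)
  also have "\<dots> \<le> e" using \<phi>(2) k by (simp add: pos_less_divide_eq mult.commute)
  finally show "L2.nrm u \<le> sqrt P * E.nrm u + e" by simp
qed

text \<open>A function that vanishes almost everywhere has weak gradient zero. In the density proof
  the orthogonality relations give nullity in L2 only, whereas the first component of a state is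
  measured by the form.\<close>

lemma H10w_null_if_L2_null:
  assumes u: "u \<in> H10sp" and 0: "ipL2 u u = 0"
  shows "form u u = 0"
proof -
  have H: "u \<in> H1sp" using u by (rule H10w_in_H1w)
  have ae: "AE x in M. u x = 0" using 0 L2_null_iff[OF H1w_D(1)[OF H]] by simp
  have "has_weak_partial \<Omega> i u (\<lambda>x. 0)" for i
    unfolding has_weak_partial_def
  proof (intro conjI ballI)
    show "u \<in> L1_loc_on \<Omega>" using H1w_D(1)[OF H] by (rule L2_imp_L1_loc)
    show "(\<lambda>x. 0) \<in> L1_loc_on \<Omega>" by (simp add: L1_loc_on_def)
    fix \<phi>
    have "(\<integral>x. u x * partial_deriv i \<phi> x \<partial>M) = 0"
      by (rule integral_eq_zero_AE) (use ae in \<open>auto elim!: eventually_mono\<close>)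
    then show "(\<integral>x. u x * partial_deriv i \<phi> x \<partial>M) = - (\<integral>x. 0 * \<phi> x \<partial>M)" by simp
  qed
  then have "AE x in M. wgrad i u x = 0" for i using wgrad_AE[of i u "\<lambda>x. 0"] by simp
  then have "ipL2 (wgrad i u) (wgrad i u) = 0" for i
    using L2_null_iff[OF H1w_D(3)[OF H]] by simp
  then show ?thesis by (simp add: form_a_eq[OF H H])
qed

end

section \<open>The energy space and the generator\<close>

context weighted_domain
begin

lemma wgrad_diff:
  assumes "has_gradient u" "has_gradient v"
  shows "AE x in M. wgrad i (u - v) x = (wgrad i u - wgrad i v) x"
proof -
  have "AE x in M. wgrad i (u + (-1) *\<^sub>R v) x = (wgrad i u + wgrad i ((-1) *\<^sub>R v)) x"
    using wgrad_add(2)[OF assms(1) wgrad_scale(1)[OF assms(2)]] .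
  moreover have "AE x in M. wgrad i ((-1) *\<^sub>R v) x = ((-1) *\<^sub>R wgrad i v) x"
    using wgrad_scale(2)[OF assms(2)] .
  ultimately have "AE x in M. wgrad i (u + (-1) *\<^sub>R v) x = (wgrad i u - wgrad i v) x"
    by eventually_elim (simp add: scaleR_fun_def)
  then show ?thesis by simp
qed

lemma L2_nrm_wgrad_le:
  assumes u: "u \<in> H1sp" shows "L2.nrm (wgrad i u) \<le> E.nrm u"
proof -
  have "ipL2 (wgrad i u) (wgrad i u) \<le> (\<Sum>i\<in>UNIV. ipL2 (wgrad i u) (wgrad i u))"
    using H1w_D(3)[OF u] by (intro member_le_sum) (auto intro: L2.ip_nonneg)
  then show ?thesis using u by (simp add: form_a_eq)
qed

text \<open>By the Poincare inequality a Cauchy sequence for the form is Cauchy in L2, and so is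
  each of its weighted derivatives. Passing to the limit in the defining identity shows that the
  limits g i are the weighted derivatives of the limit u.\<close>

theorem H10w_complete: "seminorm_complete (H10sp) E.nrm"
  unfolding seminorm_complete_def
proof (intro allI impI, elim conjE)
  fix f :: "nat \<Rightarrow> real^'n \<Rightarrow> real"
  assume f: "\<forall>n. f n \<in> H10sp"
    and cau: "\<forall>e>0. \<exists>N. \<forall>m\<ge>N. \<forall>n\<ge>N. E.nrm (f m - f n) < e"
  have fH: "f n \<in> H1sp" for n using f H10w_in_H1w by blast
  have fd: "f m - f n \<in> H10sp" for m n using f E.memX(3) by blast
  have "\<exists>u\<in>L2sp. (\<lambda>n. L2.nrm (f n - u)) \<longlonglongrightarrow> 0"
  proof (rule seminorm_completeD[OF L2_complete])
    show "f n \<in> L2sp" for n using f H10w_in_L2 by blast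
    fix e :: real assume e: "e > 0"
    then have "e / sqrt P > 0" using P_pos by simp
    then obtain N where N: "\<forall>m\<ge>N. \<forall>n\<ge>N. E.nrm (f m - f n) < e / sqrt P" using cau by blast
    have "L2.nrm (f m - f n) < e" if "m \<ge> N" "n \<ge> N" for m n
    proof -
      have "sqrt P * E.nrm (f m - f n) < e"
        using N that P_pos by (simp add: pos_less_divide_eq mult.commute)
      then show ?thesis using Poincare[OF fd, of m n] by linarith
    qed
    then show "\<exists>N. \<forall>m\<ge>N. \<forall>n\<ge>N. L2.nrm (f m - f n) < e" by blast
  qed
  then obtain u where u: "u \<in> L2sp" "(\<lambda>n. L2.nrm (f n - u)) \<longlonglongrightarrow> 0" by blast
  have "\<exists>g\<in>L2sp. (\<lambda>n. L2.nrm (wgrad i (f n) - g)) \<longlonglongrightarrow> 0" for i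
  proof (rule seminorm_completeD[OF L2_complete])
    show "wgrad i (f n) \<in> L2sp" for n using fH H1w_D(3) by blast
    fix e :: real assume "e > 0"
    then obtain N where N: "\<forall>m\<ge>N. \<forall>n\<ge>N. E.nrm (f m - f n) < e" using cau by blast
    have step: "L2.nrm (wgrad i (f m) - wgrad i (f n)) \<le> E.nrm (f m - f n)" for m n
    proof -
      have "ipL2 (wgrad i (f m) - wgrad i (f n)) (wgrad i (f m) - wgrad i (f n))
          = ipL2 (wgrad i (f m - f n)) (wgrad i (f m - f n))"
        using wgrad_diff[OF H1w_D(2)[OF fH] H1w_D(2)[OF fH], of i m n] H1w_D(3)[OF fH] H1w_D(3)[OF H10w_in_H1w[OF fd]]
        by (intro L2_inner_cong_AE L2.memX) (auto elim!: eventually_mono)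
      then show ?thesis using L2_nrm_wgrad_le[OF H10w_in_H1w[OF fd], of i m n] by simp
    qed
    have "L2.nrm (wgrad i (f m) - wgrad i (f n)) < e" if "m \<ge> N" "n \<ge> N" for m n
      by (rule le_less_trans[OF step]) (use N that in blast)
    then show "\<exists>N. \<forall>m\<ge>N. \<forall>n\<ge>N. L2.nrm (wgrad i (f m) - wgrad i (f n)) < e" by blast
  qed
  then have "\<forall>i. \<exists>g. g \<in> L2sp \<and> (\<lambda>n. L2.nrm (wgrad i (f n) - g)) \<longlonglongrightarrow> 0" by blast
  from choice[OF this]
  obtain g where g: "\<And>i. g i \<in> L2sp" "\<And>i. (\<lambda>n. L2.nrm (wgrad i (f n) - g i)) \<longlonglongrightarrow> 0"
    by blast
  have wc: "continuous_on \<Omega> (\<lambda>x. 1 / wt i x)" for i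
    using wt_pos[of _ i] by (intro continuous_intros wt_continuous) force
  have wp: "has_weak_partial \<Omega> i u (\<lambda>x. 1 / wt i x * g i x)" for i
    unfolding has_weak_partial_def
  proof (intro conjI ballI)
    show "u \<in> L1_loc_on \<Omega>" using u(1) by (rule L2_imp_L1_loc)
    show "(\<lambda>x. 1 / wt i x * g i x) \<in> L1_loc_on \<Omega>"
      by (rule L1_loc_continuous_mult[OF L2_imp_L1_loc[OF g(1)] wc])
    fix \<phi> assume \<phi>: "\<phi> \<in> tests"
    obtain K where K: "compact K" "K \<subseteq> \<Omega>" "\<And>x. x \<notin> K \<Longrightarrow> \<phi> x = 0"
      using test_support[OF \<phi>] by blast
    have out: "partial_deriv i \<phi> x = 0" if "x \<notin> K" for x
      by (rule partial_deriv_outside[OF compact_imp_closed[OF K(1)] K(3) that])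
    have d: "partial_deriv i \<phi> \<in> L2sp"
      by (rule continuous_compact_support_L2[OF continuous_on_subset[OF test_partial_continuous[OF \<phi>] subset_UNIV] K(1,2) out])
    \<comment> \<open>The weight is moved from the derivative to the test function. The quotient is
      continuous on \<Omega> and vanishes off a compact subset, so it is in L2 although the
      reciprocal weight may be unbounded.\<close>
    define \<psi> where "\<psi> x = 1 / wt i x * \<phi> x" for x
    have "continuous_on \<Omega> \<psi>" unfolding \<psi>_def[abs_def]
      by (intro continuous_on_mult wc continuous_on_subset[OF test_continuous[OF \<phi>] subset_UNIV])
    then have \<psi>: "\<psi> \<in> L2sp"
      by (rule continuous_compact_support_L2[OF _ K(1,2)]) (simp add: \<psi>_def K(3))
    have L: "(\<lambda>n. ipL2 (f n) (partial_deriv i \<phi>)) \<longlonglongrightarrow> ipL2 u (partial_deriv i \<phi>)"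
      using u d H1w_D(1)[OF fH] by (intro L2.tendsto_ip) auto
    have R: "(\<lambda>n. ipL2 (wgrad i (f n)) \<psi>) \<longlonglongrightarrow> ipL2 (g i) \<psi>"
      using g \<psi> H1w_D(3)[OF fH] by (intro L2.tendsto_ip) auto
    have "ipL2 (f n) (partial_deriv i \<phi>) = - ipL2 (wgrad i (f n)) \<psi>" for n
    proof -
      have "ipL2 (wgrad i (f n)) \<psi> = (\<integral>x. weak_gradient \<Omega> (f n) x $ i * \<phi> x \<partial>M)"
        unfolding L2_inner_def
      proof (rule Bochner_Integration.integral_cong)
        fix x assume "x \<in> space M"
        then show "wgrad i (f n) x * \<psi> x = weak_gradient \<Omega> (f n) x $ i * \<phi> x"
          using wt_pos[of x i] by (simp add: wgrad_def \<psi>_def)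
      qed simp
      then show ?thesis
        using has_gradientD[OF H1w_D(2)[OF fH], of i n] \<phi> by (simp add: has_weak_partial_def L2_inner_def)
    qed
    then have "ipL2 u (partial_deriv i \<phi>) = - ipL2 (g i) \<psi>"
      using LIMSEQ_unique[OF L] tendsto_minus[OF R] by simp
    then show "(\<integral>x. u x * partial_deriv i \<phi> x \<partial>M) = - (\<integral>x. 1 / wt i x * g i x * \<phi> x \<partial>M)"
      by (simp add: L2_inner_def \<psi>_def mult.commute mult.left_commute)
  qed
  have ug: "has_gradient u" using wp unfolding has_gradient_def by blast
  have wu: "AE x in M. wgrad i u x = g i x" for i
    using wgrad_AE[OF wp[of i]] AE_space[of M]
  proof eventually_elim
    case (elim x)
    then show ?case using wt_pos[of x i] by simp
  qed
  have wuL2: "wgrad i u \<in> L2sp" for i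
    by (rule AE_cong_L2[OF g(1) wgrad_measurable[OF ug]]) (use wu[of i] in \<open>auto elim!: eventually_mono\<close>)
  have uH: "u \<in> H1sp" using u(1) ug wuL2 by (simp add: H1w_iff)
  have fu: "f n - u \<in> H1sp" for n using fH uH H1.memX(3) by blast
  have nrm_wg: "ipL2 (wgrad i (f n - u)) (wgrad i (f n - u)) = (L2.nrm (wgrad i (f n) - g i))\<^sup>2" for i n
  proof -
    have "AE x in M. wgrad i (f n - u) x = (wgrad i (f n) - g i) x"
      using wgrad_diff[OF H1w_D(2)[OF fH] ug, of i n] wu[of i] by eventually_elim simp
    then have "ipL2 (wgrad i (f n - u)) (wgrad i (f n - u))
        = ipL2 (wgrad i (f n) - g i) (wgrad i (f n) - g i)"
      using H1w_D(3)[OF fu] H1w_D(3)[OF fH] g(1) by (intro L2_inner_cong_AE L2.memX)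
    also have "\<dots> = (L2.nrm (wgrad i (f n) - g i))\<^sup>2"
      using H1w_D(3)[OF fH] g(1) by (intro L2.nrm_sq[symmetric] L2.memX)
    finally show ?thesis .
  qed
  \<comment> \<open>Approximation by test functions is demanded in the full norm, so convergence is
    proved there first; then approximants of f n also approximate u.\<close>
  have "(\<lambda>n. (L2.nrm (f n - u))\<^sup>2 + (\<Sum>i\<in>UNIV. (L2.nrm (wgrad i (f n) - g i))\<^sup>2)) \<longlonglongrightarrow> 0\<^sup>2 + (\<Sum>i\<in>(UNIV::'n set). 0\<^sup>2)"
    by (intro tendsto_intros u g)
  then have "(\<lambda>n. sqrt ((L2.nrm (f n - u))\<^sup>2 + (\<Sum>i\<in>UNIV. (L2.nrm (wgrad i (f n) - g i))\<^sup>2))) \<longlonglongrightarrow> sqrt 0"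
    by (intro tendsto_real_sqrt) simp
  moreover have "H1.nrm (f n - u) = sqrt ((L2.nrm (f n - u))\<^sup>2 + (\<Sum>i\<in>UNIV. (L2.nrm (wgrad i (f n) - g i))\<^sup>2))" for n
    using form_a_eq[OF fu fu, of n] L2.nrm_sq[OF H1w_D(1)[OF fu], of n] by (simp add: nrm_wg)
  ultimately have lim: "(\<lambda>n. H1.nrm (f n - u)) \<longlonglongrightarrow> 0" by simp
  have uH0: "u \<in> H10sp"
    unfolding H10w_iff
  proof (intro conjI allI impI uH)
    fix e :: real assume e: "e > 0"
    obtain n where n: "H1.nrm (f n - u) < e / 2"
      using eventually_happens'[OF sequentially_bot order_tendstoD(2)[OF lim half_gt_zero[OF e]]] by blast
    obtain \<phi> where p: "\<phi> \<in> tests" "H1.nrm (f n - \<phi>) < e / 2"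
      using f half_gt_zero[OF e] unfolding H10w_iff by blast
    have "H1.nrm (u - \<phi>) \<le> H1.nrm (u - f n) + H1.nrm (f n - \<phi>)"
      using uH fH test_in_H1w[OF p(1)] by (intro H1.p_trans)
    also have "\<dots> < e" using n p(2) H1.p_commute[OF uH fH, of n] by linarith
    finally show "\<exists>\<phi>\<in>tests. H1.nrm (u - \<phi>) < e" using p(1) by blast
  qed
  moreover have "(\<lambda>n. E.nrm (f n - u)) \<longlonglongrightarrow> 0"
  proof (rule Lim_null_comparison[OF _ lim], rule always_eventually, rule allI)
    fix n show "norm (E.nrm (f n - u)) \<le> H1.nrm (f n - u)"
      using nrm_le_H1(2)[OF fu, of n] form_a_nonneg[OF fu, of n] by simp
  qed
  ultimately show "\<exists>x\<in>H10sp. (\<lambda>n. E.nrm (f n - x)) \<longlonglongrightarrow> 0" by blast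
qed

section \<open>The weak form of the operator and its domain\<close>

lemma neg_div_iff:
  assumes u: "u \<in> H10sp"
  shows "neg_div_A l \<alpha> \<Omega> u f \<longleftrightarrow> (\<forall>\<phi>\<in>tests. form u \<phi> = ipL2 f \<phi>)"
proof -
  have uH: "u \<in> H1sp" using u by (rule H10w_in_H1w)
  have "(\<integral>x. (coeffA l \<alpha> x *v weak_gradient \<Omega> u x) \<bullet> gradient \<phi> x \<partial>M) = form u \<phi>"
    if \<phi>: "\<phi> \<in> tests" for \<phi>
  proof -
    have pH: "\<phi> \<in> H1sp" using \<phi> by (rule test_in_H1w)
    have "(coeffA l \<alpha> x *v weak_gradient \<Omega> u x) \<bullet> gradient \<phi> x
        = (\<Sum>i\<in>UNIV. (wt i x * partial_deriv i \<phi> x) * wgrad i u x)" for x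
      using coeffA_inner[of "gradient \<phi> x" x "weak_gradient \<Omega> u x"]
      by (simp add: inner_commute gradient_def wgrad_def)
    then have "(\<integral>x. (coeffA l \<alpha> x *v weak_gradient \<Omega> u x) \<bullet> gradient \<phi> x \<partial>M)
        = (\<integral>x. (\<Sum>i\<in>UNIV. (wt i x * partial_deriv i \<phi> x) * wgrad i u x) \<partial>M)" by simp
    also have "\<dots> = (\<Sum>i\<in>UNIV. ipL2 (\<lambda>x. wt i x * partial_deriv i \<phi> x) (wgrad i u))"
      unfolding L2_inner_def
      by (intro Bochner_Integration.integral_sum L2_mult_integrable test_wgrad(1)[OF \<phi>] H1w_D(3)[OF uH])
    also have "\<dots> = (\<Sum>i\<in>UNIV. ipL2 (wgrad i \<phi>) (wgrad i u))"
    proof (rule sum.cong)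
      fix i
      have "AE x in M. wt i x * partial_deriv i \<phi> x = wgrad i \<phi> x"
        using test_wgrad(2)[OF \<phi>, of i] by eventually_elim simp
      then show "ipL2 (\<lambda>x. wt i x * partial_deriv i \<phi> x) (wgrad i u) = ipL2 (wgrad i \<phi>) (wgrad i u)"
        using test_wgrad(1)[OF \<phi>, of i] H1w_D(3)[OF uH] H1w_D(3)[OF pH] by (intro L2_inner_cong_AE) auto
    qed simp
    also have "\<dots> = form u \<phi>"
      by (simp only: form_a_eq[OF pH uH] form_a_sym[OF uH pH])
    finally show ?thesis .
  qed
  then show ?thesis by (simp add: neg_div_A_def L2_inner_def)
qed

text \<open>Both sides are continuous in z for the full norm, in which every z is a limit of test
  functions.\<close>

lemma neg_div_H10w:
  assumes u: "u \<in> H10sp" and f: "f \<in> L2sp" and nd: "neg_div_A l \<alpha> \<Omega> u f" and z: "z \<in> H10sp"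
  shows "form u z = ipL2 f z"
proof -
  have "\<bar>form u z - ipL2 f z\<bar> \<le> 0 + e" if e: "e > 0" for e
  proof -
    define k where "k = E.nrm u + L2.nrm f + 1"
    have k: "k > 0" using E.p_nonneg[OF u] L2.p_nonneg[OF f] unfolding k_def by linarith
    then have "e / k > 0" using e by simp
    then obtain \<phi> where p: "\<phi> \<in> tests" "H1.nrm (z - \<phi>) < e / k"
      using z unfolding H10w_iff by blast
    have p0: "\<phi> \<in> H10sp" using p(1) by (rule test_in_H10w)
    have d: "z - \<phi> \<in> H10sp" using z p0 by (rule E.memX(3))
    have dH: "z - \<phi> \<in> H1sp" using d by (rule H10w_in_H1w)
    have eq: "form u \<phi> = ipL2 f \<phi>" using nd p(1) neg_div_iff[OF u] by blast
    have "form u z - ipL2 f z = form u (z - \<phi>) - ipL2 f (z - \<phi>)"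
      using E.ip_diff_right[OF z p0 u] L2.ip_diff_right[OF H10w_in_L2[OF z] H10w_in_L2[OF p0] f] eq by simp
    also have "\<bar>\<dots>\<bar> \<le> \<bar>form u (z - \<phi>)\<bar> + \<bar>ipL2 f (z - \<phi>)\<bar>" by simp
    also have "\<dots> \<le> E.nrm u * E.nrm (z - \<phi>) + L2.nrm f * L2.nrm (z - \<phi>)"
      using E.Cauchy_Schwarz[OF u d] L2.Cauchy_Schwarz[OF f H10w_in_L2[OF d]] by (rule add_mono)
    also have "\<dots> \<le> E.nrm u * H1.nrm (z - \<phi>) + L2.nrm f * H1.nrm (z - \<phi>)"
      using nrm_le_H1[OF dH] E.p_nonneg[OF u] L2.p_nonneg[OF f] by (intro add_mono mult_left_mono)
    also have "\<dots> \<le> k * H1.nrm (z - \<phi>)"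
      using H1.p_nonneg[OF dH] unfolding k_def distrib_right by linarith
    also have "\<dots> \<le> e" using p(2) k by (simp add: pos_less_divide_eq mult.commute)
    finally show ?thesis by simp
  qed
  then have "\<bar>form u z - ipL2 f z\<bar> \<le> 0" by (rule field_le_epsilon)
  then show ?thesis by simp
qed

lemma dom_A_H10w: "u \<in> domA \<Longrightarrow> u \<in> H10sp"
  by (simp add: dom_A_def)

text \<open>Green's identity for the chosen value of the operator; it is the form in which the
  operator is used below.\<close>

lemma op_A:
  assumes "u \<in> domA"
  shows "op_A l \<alpha> \<Omega> u \<in> L2sp"
    and "z \<in> H10sp \<Longrightarrow> form u z = ipL2 (op_A l \<alpha> \<Omega> u) z"
proof -
  have "\<exists>f. f \<in> L2sp \<and> neg_div_A l \<alpha> \<Omega> u f" using assms by (auto simp: dom_A_def)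
  then have *: "op_A l \<alpha> \<Omega> u \<in> L2sp \<and> neg_div_A l \<alpha> \<Omega> u (op_A l \<alpha> \<Omega> u)"
    unfolding op_A_def by (rule someI_ex)
  then show "op_A l \<alpha> \<Omega> u \<in> L2sp" by blast
  show "form u z = ipL2 (op_A l \<alpha> \<Omega> u) z" if "z \<in> H10sp"
    using neg_div_H10w[OF dom_A_H10w[OF assms] _ _ that] * by blast
qed

lemma dom_A_I:
  assumes u: "u \<in> H10sp" and f: "f \<in> L2sp"
    and eq: "\<And>z. z \<in> H10sp \<Longrightarrow> form u z = ipL2 f z"
  shows "u \<in> domA"
  unfolding dom_A_def using u f neg_div_iff[OF u] eq test_in_H10w by blast

lemma dom_A_subspace: "subspace (domA)"
  unfolding subspace_def
proof (intro conjI ballI allI)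
  show "0 \<in> domA"
  proof (rule dom_A_I[where f = 0])
    fix z assume z: "z \<in> H10sp"
    show "form 0 z = ipL2 0 z"
      using E.ip_scale[OF z z, of 0] L2.ip_scale[OF H10w_in_L2[OF z] H10w_in_L2[OF z], of 0] by simp
  qed auto
next
  fix u v assume u: "u \<in> domA" and v: "v \<in> domA"
  show "u + v \<in> domA"
  proof (rule dom_A_I[where f = "op_A l \<alpha> \<Omega> u + op_A l \<alpha> \<Omega> v"])
    fix z assume z: "z \<in> H10sp"
    show "form (u + v) z = ipL2 (op_A l \<alpha> \<Omega> u + op_A l \<alpha> \<Omega> v) z"
      using u v z by (simp add: E.ip_add L2.ip_add op_A dom_A_H10w H10w_in_L2)
  qed (use u v op_A(1) dom_A_H10w in blast)+
next
  fix u and c :: real assume u: "u \<in> domA"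
  show "c *\<^sub>R u \<in> domA"
  proof (rule dom_A_I[where f = "c *\<^sub>R op_A l \<alpha> \<Omega> u"])
    fix z assume z: "z \<in> H10sp"
    show "form (c *\<^sub>R u) z = ipL2 (c *\<^sub>R op_A l \<alpha> \<Omega> u) z"
      using u z by (simp add: E.ip_scale L2.ip_scale op_A dom_A_H10w H10w_in_L2)
  qed (use u op_A(1) dom_A_H10w in blast)+
qed

section \<open>The energy space and density of the domain\<close>

lemma energy_space_iff: "x \<in> energy \<longleftrightarrow> fst x \<in> H10sp \<and> snd x \<in> L2sp"
  by (cases x) (simp add: energy_space_def)

sublocale X: semi_inner "energy" "ipE"
proof
  show "subspace (energy)"
    unfolding energy_space_def by (intro subspace_Times H10w_subspace L2.sub)
qed (auto simp: energy_space_iff energy_inner_def E.ip_add L2.ip_add E.ip_scale L2.ip_scale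
    E.ip_nonneg L2.ip_nonneg distrib_left intro: arg_cong2[where f = "(+)"] E.ip_sym L2.ip_sym)

lemma energy_norm_eq: "energy_norm l \<alpha> \<Omega> = X.nrm"
  by (simp add: energy_norm_def fun_eq_iff)

lemma energy_components:
  assumes "x \<in> energy"
  shows "E.nrm (fst x) \<le> X.nrm x" "L2.nrm (snd x) \<le> X.nrm x" "X.nrm x \<le> E.nrm (fst x) + L2.nrm (snd x)"
proof -
  have a: "0 \<le> form (fst x) (fst x)" "0 \<le> ipL2 (snd x) (snd x)"
    using assms by (auto simp: energy_space_iff E.ip_nonneg L2.ip_nonneg)
  then show "E.nrm (fst x) \<le> X.nrm x" "L2.nrm (snd x) \<le> X.nrm x" by (simp_all add: energy_inner_def)
  show "X.nrm x \<le> E.nrm (fst x) + L2.nrm (snd x)"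
    using a by (simp add: energy_inner_def sqrt_add_le_add_sqrt)
qed

lemma energy_complete: "seminorm_complete (energy) X.nrm"
  unfolding seminorm_complete_def
proof (intro allI impI, elim conjE)
  fix f :: "nat \<Rightarrow> 'n state"
  assume f: "\<forall>n. f n \<in> energy"
    and cau: "\<forall>e>0. \<exists>N. \<forall>m\<ge>N. \<forall>n\<ge>N. X.nrm (f m - f n) < e"
  have fd: "f m - f n \<in> energy" for m n using f X.memX(3) by blast
  have "\<exists>N. \<forall>m\<ge>N. \<forall>n\<ge>N. E.nrm (fst (f m) - fst (f n)) < e" if "e > 0" for e
  proof -
    obtain N where N: "\<forall>m\<ge>N. \<forall>n\<ge>N. X.nrm (f m - f n) < e" using cau \<open>e > 0\<close> by blast
    have "E.nrm (fst (f m) - fst (f n)) < e" if "m \<ge> N" "n \<ge> N" for m n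
      unfolding fst_diff[symmetric]
      by (rule le_less_trans[OF energy_components(1)[OF fd]]) (use N that in blast)
    then show ?thesis by blast
  qed
  then have "\<exists>u\<in>H10sp. (\<lambda>n. E.nrm (fst (f n) - u)) \<longlonglongrightarrow> 0"
    using f by (intro seminorm_completeD[OF H10w_complete]) (auto simp: energy_space_iff)
  then obtain u where u: "u \<in> H10sp" "(\<lambda>n. E.nrm (fst (f n) - u)) \<longlonglongrightarrow> 0" by blast
  have "\<exists>N. \<forall>m\<ge>N. \<forall>n\<ge>N. L2.nrm (snd (f m) - snd (f n)) < e" if "e > 0" for e
  proof -
    obtain N where N: "\<forall>m\<ge>N. \<forall>n\<ge>N. X.nrm (f m - f n) < e" using cau \<open>e > 0\<close> by blast
    have "L2.nrm (snd (f m) - snd (f n)) < e" if "m \<ge> N" "n \<ge> N" for m n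
      unfolding snd_diff[symmetric]
      by (rule le_less_trans[OF energy_components(2)[OF fd]]) (use N that in blast)
    then show ?thesis by blast
  qed
  then have "\<exists>v\<in>L2sp. (\<lambda>n. L2.nrm (snd (f n) - v)) \<longlonglongrightarrow> 0"
    using f by (intro seminorm_completeD[OF L2_complete]) (auto simp: energy_space_iff)
  then obtain v where v: "v \<in> L2sp" "(\<lambda>n. L2.nrm (snd (f n) - v)) \<longlonglongrightarrow> 0" by blast
  have uv: "(u, v) \<in> energy" using u v by (simp add: energy_space_iff)
  have "(\<lambda>n. X.nrm (f n - (u, v))) \<longlonglongrightarrow> 0"
  proof (rule Lim_null_comparison[OF always_eventually], rule allI)
    fix n
    have d: "f n - (u, v) \<in> energy" using f uv X.memX(3) by blast
    show "norm (X.nrm (f n - (u, v))) \<le> E.nrm (fst (f n) - u) + L2.nrm (snd (f n) - v)"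
      using energy_components(3)[OF d] X.p_nonneg[OF d] by simp
  next
    show "(\<lambda>n. E.nrm (fst (f n) - u) + L2.nrm (snd (f n) - v)) \<longlonglongrightarrow> 0"
      using tendsto_add[OF u(2) v(2)] by simp
  qed
  then show "\<exists>x\<in>energy. (\<lambda>n. X.nrm (f n - x)) \<longlonglongrightarrow> 0" using uv by blast
qed

lemma dom_wave_subspace: "subspace (dom_wave l \<alpha> \<Omega>)"
  unfolding dom_wave_def by (intro subspace_Times dom_A_subspace H10w_subspace)

lemma dom_wave_iff: "x \<in> dom_wave l \<alpha> \<Omega> \<longleftrightarrow> fst x \<in> domA \<and> snd x \<in> H10sp"
  by (cases x) (simp add: dom_wave_def)

lemma dom_wave_subset: "dom_wave l \<alpha> \<Omega> \<subseteq> energy"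
  using dom_A_H10w H10w_in_L2 by (auto simp: dom_wave_iff energy_space_iff)

lemma dom_wave_dense:
  assumes x: "x \<in> energy" and e: "e > 0"
  shows "\<exists>d\<in>dom_wave l \<alpha> \<Omega>. X.nrm (x - d) < e"
proof (rule X.dense_if_orthogonal_null[OF energy_complete dom_wave_subspace dom_wave_subset _ x e])
  fix z assume z: "z \<in> energy"
    and orth: "\<And>x. x \<in> dom_wave l \<alpha> \<Omega> \<Longrightarrow> ipE z x = 0"
  have z1: "fst z \<in> H10sp" and z2: "snd z \<in> L2sp" using z by (auto simp: energy_space_iff)
  have a0: "form (fst z) 0 = 0"
    using E.ip_scale_right[OF z1 z1, of 0] by simp
  have l0: "ipL2 (snd z) 0 = 0"
    using L2.ip_scale_right[OF z2 z2, of 0] by simp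
  \<comment> \<open>The states (0, \<phi>) with a test function \<phi> lie in the domain, so the
    second component of z is orthogonal to all test functions.\<close>
  have "AE x in M. snd z x = 0"
  proof (rule test_zero_imp_AE_zero[OF L2_imp_L1_loc[OF z2]])
    fix \<phi> assume "\<phi> \<in> tests"
    then have "(0, \<phi>) \<in> dom_wave l \<alpha> \<Omega>"
      using test_in_H10w subspace_0[OF dom_A_subspace] by (simp add: dom_wave_iff)
    then have "ipL2 (snd z) \<phi> = 0" using orth[of "(0, \<phi>)"] a0 by (simp add: energy_inner_def)
    then show "(\<integral>x. snd z x * \<phi> x \<partial>M) = 0" by (simp add: L2_inner_def)
  qed
  then have 2: "ipL2 (snd z) (snd z) = 0" using L2_null_iff[OF z2] by simp
  \<comment> \<open>u is the weak solution of the equation with right-hand side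
    \<open>fst z\<close>. Then (u, 0) lies in the domain, and orthogonality to it says that the
    squared L2 norm of \<open>fst z\<close>, which equals a(u, \<open>fst z\<close>), is 0.\<close>
  obtain u where u: "u \<in> H10sp" "\<And>w. w \<in> H10sp \<Longrightarrow> form u w = ipL2 (fst z) w"
  proof -
    have "\<exists>u\<in>H10sp. \<forall>w\<in>H10sp. form u w = ipL2 (fst z) w"
    proof (rule E.Riesz[OF H10w_complete, where B = "L2.nrm (fst z) * sqrt P"])
      fix w assume w: "w \<in> H10sp"
      have "\<bar>ipL2 (fst z) w\<bar> \<le> L2.nrm (fst z) * L2.nrm w"
        by (rule L2.Cauchy_Schwarz[OF H10w_in_L2[OF z1] H10w_in_L2[OF w]])
      also have "\<dots> \<le> L2.nrm (fst z) * (sqrt P * E.nrm w)"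
        by (rule mult_left_mono[OF Poincare[OF w] L2.p_nonneg[OF H10w_in_L2[OF z1]]])
      finally show "\<bar>ipL2 (fst z) w\<bar> \<le> L2.nrm (fst z) * sqrt P * E.nrm w" by (simp only: mult.assoc)
    next
      show "ipL2 (fst z) (v + w) = ipL2 (fst z) v + ipL2 (fst z) w"
        if "v \<in> H10sp" "w \<in> H10sp" for v w
        using that z1 by (simp add: L2.ip_add_right H10w_in_L2)
      show "ipL2 (fst z) (c *\<^sub>R w) = c * ipL2 (fst z) w" if "w \<in> H10sp" for c w
        using that z1 by (simp add: L2.ip_scale_right H10w_in_L2)
    qed
    then show thesis using that by blast
  qed
  have ud: "u \<in> domA" by (rule dom_A_I[OF u(1) H10w_in_L2[OF z1] u(2)])
  then have "(u, 0) \<in> dom_wave l \<alpha> \<Omega>" by (simp add: dom_wave_iff)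
  then have "form (fst z) u = 0" using orth[of "(u, 0)"] l0 by (simp add: energy_inner_def)
  then have "ipL2 (fst z) (fst z) = 0" using u(2)[OF z1] E.ip_sym[OF z1 u(1)] by simp
  then have "form (fst z) (fst z) = 0" by (rule H10w_null_if_L2_null[OF z1])
  then show "ipE z z = 0" using 2 by (simp add: energy_inner_def)
qed

end

section \<open>The Lyapunov functional\<close>

locale damped_wave = weighted_domain \<Omega> l \<alpha> for \<Omega> :: "(real^'n::finite) set" and l \<alpha> +
  fixes V :: "real^'n \<Rightarrow> real" and H B :: real
  assumes V_measurable: "V \<in> borel_measurable M" and V_bounded: "AE x in M. \<bar>V x\<bar> \<le> B"
    and H_pos: "H > 0" and V_ge: "AE x in M. V x \<ge> H"
begin

abbreviation mV where "mV u \<equiv> (\<lambda>x. V x * u x)"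

lemma mV_L2: "u \<in> L2sp \<Longrightarrow> mV u \<in> L2sp"
  by (rule L2_bounded_mult[OF _ V_measurable V_bounded])

lemma mV_add: "mV (u + v) = mV u + mV v" and mV_scale: "mV (c *\<^sub>R u) = c *\<^sub>R mV u"
  by (auto simp: fun_eq_iff scaleR_fun_def distrib_left)

lemma mV_sym: "ipL2 (mV u) v = ipL2 (mV v) u"
  by (simp add: L2_inner_def mult.commute mult.left_commute)

lemma mV_lower:
  assumes u: "u \<in> L2sp" shows "H * ipL2 u u \<le> ipL2 (mV u) u"
proof -
  have "(\<integral>x. H * (u x * u x) \<partial>M) \<le> (\<integral>x. V x * u x * u x \<partial>M)"
  proof (rule integral_mono_AE)
    show "AE x in M. H * (u x * u x) \<le> V x * u x * u x"
      using V_ge by eventually_elim (simp add: mult.assoc mult_right_mono)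
  qed (use L2_mult_integrable[OF u u] L2_mult_integrable[OF mV_L2[OF u] u] in auto)
  then show ?thesis by (simp add: L2_inner_def)
qed

lemma mV_upper:
  assumes u: "u \<in> L2sp" shows "ipL2 (mV u) u \<le> \<bar>B\<bar> * ipL2 u u"
proof -
  have "(\<integral>x. V x * u x * u x \<partial>M) \<le> (\<integral>x. \<bar>B\<bar> * (u x * u x) \<partial>M)"
  proof (rule integral_mono_AE)
    show "AE x in M. V x * u x * u x \<le> \<bar>B\<bar> * (u x * u x)"
      using V_bounded
    proof eventually_elim
      case (elim x)
      then have "V x \<le> \<bar>B\<bar>" by linarith
      then show ?case by (simp add: mult.assoc mult_right_mono)
    qed
  qed (use L2_mult_integrable[OF u u] L2_mult_integrable[OF mV_L2[OF u] u] in auto)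
  then show ?thesis by (simp add: L2_inner_def)
qed

text \<open>The bound H / 2 leaves enough damping after the term \<epsilon> (v, v) is absorbed. The
  other bound gives \<epsilon> P + \<epsilon> \<le> 1/2, which keeps the mixed term of the
  functional below a quarter of the squared energy norm.\<close>

definition \<epsilon> :: real where "\<epsilon> = min (H / 2) (1 / (2 * (P + 1)))"

lemma \<epsilon>: "\<epsilon> > 0" "\<epsilon> \<le> H / 2" "\<epsilon> * P \<le> 1 / 2" "\<epsilon> \<le> 1 / 2"
proof -
  show "\<epsilon> > 0" "\<epsilon> \<le> H / 2" using P_pos H_pos by (auto simp: \<epsilon>_def)
  then have "\<epsilon> * (P + 1) \<le> 1 / (2 * (P + 1)) * (P + 1)"
    using P_pos by (intro mult_right_mono) (auto simp: \<epsilon>_def)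
  also have "\<dots> = 1 / 2" using P_pos by simp
  finally have *: "\<epsilon> * P + \<epsilon> \<le> 1 / 2" by (simp add: distrib_left)
  moreover have "\<epsilon> * P > 0" using \<open>\<epsilon> > 0\<close> P_pos by simp
  ultimately show "\<epsilon> * P \<le> 1 / 2" "\<epsilon> \<le> 1 / 2" using \<open>\<epsilon> > 0\<close> by linarith+
qed

text \<open>The quadratic form of \<open>1/2 \<parallel>(u, v)\<parallel>\<^sup>2 + \<epsilon> ((u, v) + 1/2 (V u, u))\<close>. The last two terms have time
  derivative \<open>\<parallel>v\<parallel>\<^sup>2 - a(u, u)\<close> along the flow, which recovers the potential energy.\<close>

definition lyap :: "'n state \<Rightarrow> 'n state \<Rightarrow> real" where
  "lyap x y = ipE x y / 2 + \<epsilon> / 2 *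
     (ipL2 (fst x) (snd y) + ipL2 (snd x) (fst y) + ipL2 (mV (fst x)) (fst y))"

text \<open>The upper comparison constant: 1/2 from the energy and 1/4 from the mixed term are
  rounded up to 1, and the term with V adds at most the absolute value of B. P is absorbed by
  \<epsilon> P \<le> 1/2.\<close>

definition K :: real where "K = 1 + \<bar>B\<bar>"

lemma lyap_bounds:
  assumes x: "x \<in> energy"
  shows "ipE x x / 4 \<le> lyap x x" "lyap x x \<le> K * ipE x x"
proof -
  define u v where "u = fst x" and "v = snd x"
  have u: "u \<in> H10sp" and v: "v \<in> L2sp" using x by (auto simp: energy_space_iff u_def v_def)
  have u2: "u \<in> L2sp" using u by (rule H10w_in_L2)
  define a b p where "a = form u u" and "b = ipL2 v v" and "p = ipL2 u u"
  have pos: "a \<ge> 0" "b \<ge> 0" "p \<ge> 0" using u v u2 by (auto simp: a_def b_def p_def E.ip_nonneg L2.ip_nonneg)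
  have pa: "p \<le> P * a"
  proof -
    have "(L2.nrm u)\<^sup>2 \<le> (sqrt P * E.nrm u)\<^sup>2" using Poincare[OF u] L2.p_nonneg[OF u2] by (rule power_mono)
    then show ?thesis using P_pos pos by (simp add: power_mult_distrib a_def p_def)
  qed
  have cs: "\<bar>ipL2 u v\<bar> \<le> (p + b) / 2"
  proof -
    have "2 * \<bar>ipL2 u v\<bar> \<le> 2 * L2.nrm u * L2.nrm v" using L2.Cauchy_Schwarz[OF u2 v] by simp
    also have "\<dots> \<le> (L2.nrm u)\<^sup>2 + (L2.nrm v)\<^sup>2" by (rule sum_squares_bound)
    also have "\<dots> = p + b" using L2.nrm_sq[OF u2] L2.nrm_sq[OF v] by (simp add: p_def b_def)
    finally show ?thesis by simp
  qed
  have Vlo: "0 \<le> ipL2 (mV u) u" using mV_lower[OF u2] H_pos pos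
    by (metis less_imp_le mult_nonneg_nonneg order_trans p_def)
  have Vup: "ipL2 (mV u) u \<le> \<bar>B\<bar> * (P * a)"
    using mV_upper[OF u2] mult_left_mono[OF pa, of "\<bar>B\<bar>"] by (simp add: p_def)
  have eq: "lyap x x = (a + b) / 2 + \<epsilon> * ipL2 u v + \<epsilon> / 2 * ipL2 (mV u) u"
    using L2.ip_sym[OF u2 v] by (simp add: lyap_def energy_inner_def a_def b_def u_def v_def algebra_simps)
  have en: "ipE x x = a + b" by (simp add: energy_inner_def a_def b_def u_def v_def)
  have ePa: "\<epsilon> * (P * a) \<le> 1 / 2 * a" using mult_right_mono[OF \<epsilon>(3) pos(1)] by (simp add: mult.assoc)
  have eb: "\<epsilon> * b \<le> 1 / 2 * b" using mult_right_mono[OF \<epsilon>(4) pos(2)] .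
  have ep: "\<epsilon> * p \<le> 1 / 2 * a" using mult_left_mono[OF pa, of \<epsilon>] \<epsilon>(1) ePa by linarith
  \<comment> \<open>Of the half of the squared energy norm in the functional, the mixed term removes
    at most a quarter; the term with V is nonnegative, so at least a quarter remains.\<close>
  have ecs: "\<bar>\<epsilon> * ipL2 u v\<bar> \<le> (a + b) / 4"
  proof -
    have "\<bar>\<epsilon> * ipL2 u v\<bar> \<le> \<epsilon> * ((p + b) / 2)"
      using \<epsilon>(1) mult_left_mono[OF cs, of \<epsilon>] by (simp add: abs_mult)
    also have "\<dots> = (\<epsilon> * p + \<epsilon> * b) / 2" by (simp add: algebra_simps)
    also have "\<dots> \<le> (a + b) / 4" using ep eb by simp
    finally show ?thesis .
  qed
  have "0 \<le> \<epsilon> / 2 * ipL2 (mV u) u" using \<epsilon>(1) Vlo by simp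
  then show "ipE x x / 4 \<le> lyap x x" unfolding eq en using ecs by linarith
  have "\<epsilon> / 2 * ipL2 (mV u) u \<le> \<epsilon> / 2 * (\<bar>B\<bar> * (P * a))"
    using Vup \<epsilon>(1) by (intro mult_left_mono) auto
  also have "\<dots> = \<bar>B\<bar> / 2 * (\<epsilon> * (P * a))" by simp
  also have "\<dots> \<le> \<bar>B\<bar> / 2 * (1 / 2 * a)" using ePa by (intro mult_left_mono) auto
  also have "\<dots> \<le> \<bar>B\<bar> * (a + b)"
  proof -
    have "0 \<le> \<bar>B\<bar> * a" "0 \<le> \<bar>B\<bar> * b" using pos by auto
    then show ?thesis unfolding distrib_left by linarith
  qed
  finally show "lyap x x \<le> K * ipE x x"
    unfolding eq en K_def distrib_right using ecs pos by linarith
qed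

text \<open>The functional becomes a squared norm, to which \<open>exponential_decay\<close>
  applies. The two orderings of the mixed term, together with the symmetry of multiplication by V,
  make the polarised form symmetric.\<close>

sublocale Q: semi_inner "energy" lyap
proof
  show "subspace (energy)" by (rule X.sub)
  fix x y z :: "'n state" and c :: real
  assume x: "x \<in> energy"
  show "0 \<le> lyap x x" using lyap_bounds(1)[OF x] X.ip_nonneg[OF x] by linarith
  assume z: "z \<in> energy"
  have L: "fst w \<in> L2sp" "snd w \<in> L2sp" "mV (fst w) \<in> L2sp" if "w \<in> energy" for w
    using that H10w_in_L2 mV_L2 by (auto simp: energy_space_iff)
  show "lyap x z = lyap z x"
    using X.ip_sym[OF x z] L2.ip_sym[OF L(1)[OF x] L(2)[OF z]] L2.ip_sym[OF L(2)[OF x] L(1)[OF z]] mV_sym[of "fst x" "fst z"]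
    by (simp add: lyap_def)
  show "lyap (c *\<^sub>R x) z = c * lyap x z"
    using L[OF x] L[OF z] by (simp add: lyap_def X.ip_scale[OF x z] L2.ip_scale mV_scale algebra_simps)
  assume y: "y \<in> energy"
  note sums = X.ip_add[OF x y z] L2.ip_add[OF L(1)[OF x] L(1)[OF y] L(2)[OF z]]
    L2.ip_add[OF L(2)[OF x] L(2)[OF y] L(1)[OF z]] L2.ip_add[OF L(3)[OF x] L(3)[OF y] L(1)[OF z]]
  show "lyap (x + y) z = lyap x z + lyap y z"
    unfolding lyap_def fst_add snd_add mV_add sums by (simp add: algebra_simps add_divide_distrib)
qed

lemma op_wave_in_energy_space:
  assumes "x \<in> dom_wave l \<alpha> \<Omega>" shows "- op_wave l \<alpha> \<Omega> V x \<in> energy"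
proof -
  have u: "fst x \<in> domA" and v: "snd x \<in> H10sp" using assms by (auto simp: dom_wave_iff)
  have "op_A l \<alpha> \<Omega> (fst x) + mV (snd x) \<in> L2sp"
    using op_A(1)[OF u] mV_L2[OF H10w_in_L2[OF v]] by (rule L2.memX(2))
  then have "op_wave l \<alpha> \<Omega> V x \<in> energy"
    using v by (simp add: op_wave_def case_prod_beta energy_space_iff)
  then show ?thesis by (rule X.mem(5))
qed

lemma lyap_dissipation:
  assumes x: "x \<in> dom_wave l \<alpha> \<Omega>"
  shows "2 * lyap x (- op_wave l \<alpha> \<Omega> V x) \<le> - (\<epsilon> / K) * lyap x x"
proof -
  define u v where "u = fst x" and "v = snd x"
  have xX: "x \<in> energy" using x dom_wave_subset by blast
  have u: "u \<in> domA" and v: "v \<in> H10sp" using x by (auto simp: dom_wave_iff u_def v_def)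
  have u0: "u \<in> H10sp" using u by (rule dom_A_H10w)
  have u2: "u \<in> L2sp" and v2: "v \<in> L2sp" using u0 v H10w_in_L2 by auto
  define w where "w = op_A l \<alpha> \<Omega> u + mV v"
  have A2: "op_A l \<alpha> \<Omega> u \<in> L2sp" using u by (rule op_A(1))
  have w2: "w \<in> L2sp" unfolding w_def using A2 mV_L2[OF v2] by (rule L2.memX(2))
  have op: "- op_wave l \<alpha> \<Omega> V x = (v, - w)"
    by (simp add: op_wave_def case_prod_beta u_def v_def w_def)
  have zw: "ipL2 z (- w) = - (ipL2 z (op_A l \<alpha> \<Omega> u)) - ipL2 z (mV v)"
    if z: "z \<in> L2sp" for z
    using L2.ip_scale_right[OF w2 z, of "-1"] L2.ip_add_right[OF A2 mV_L2[OF v2] z] by (simp add: w_def)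
  define a b where "a = form u u" and "b = ipL2 v v"
  have 1: "ipL2 v (op_A l \<alpha> \<Omega> u) = form u v"
    using op_A(2)[OF u v] L2.ip_sym[OF v2 A2] by simp
  have 2: "ipL2 u (op_A l \<alpha> \<Omega> u) = a"
    using op_A(2)[OF u u0] L2.ip_sym[OF u2 A2] by (simp add: a_def)
  have 3: "ipL2 u (mV v) = ipL2 (mV u) v"
    using L2.ip_sym[OF u2 mV_L2[OF v2]] mV_sym[of v u] by simp
  have 4: "ipL2 v (mV v) = ipL2 (mV v) v"
    using L2.ip_sym[OF v2 mV_L2[OF v2]] .
  \<comment> \<open>Two cancellations follow: a(u, v) against (v, A u), where A is the operator, and
    (V u, v) against (u, V v).\<close>
  have "2 * lyap x (- op_wave l \<alpha> \<Omega> V x) = form u v + ipL2 v (- w)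
      + \<epsilon> * (ipL2 u (- w) + b + ipL2 (mV u) v)"
    unfolding op by (simp add: lyap_def energy_inner_def u_def[symmetric] v_def[symmetric] b_def distrib_left)
  also have "\<dots> = - ipL2 (mV v) v + \<epsilon> * (b - a)"
    unfolding zw[OF u2] zw[OF v2] 1 2 3 4 by (simp add: algebra_simps)
  \<comment> \<open>Damping contributes - H b. By \<epsilon> \<le> H / 2 one half absorbs \<epsilon>
    b and the other half leaves - \<epsilon> b.\<close>
  also have "\<dots> \<le> - \<epsilon> * (a + b)"
  proof -
    have "b \<ge> 0" unfolding b_def using v2 by (rule L2.ip_nonneg)
    then have "\<epsilon> * b \<le> H / 2 * b" using \<epsilon>(2) by (rule mult_right_mono[rotated])
    then show ?thesis using mV_lower[OF v2] by (simp add: b_def[symmetric] algebra_simps)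
  qed
  also have "a + b = ipE x x"
    by (simp add: energy_inner_def a_def b_def u_def v_def)
  \<comment> \<open>Dissipation of the energy becomes dissipation of the functional through the
    upper comparison; this gives the rate \<epsilon> / K.\<close>
  also have "- \<epsilon> * ipE x x \<le> - (\<epsilon> / K) * lyap x x"
  proof -
    have K: "K > 0" by (simp add: K_def add_pos_nonneg)
    have "\<epsilon> / K * lyap x x \<le> \<epsilon> / K * (K * ipE x x)"
      using lyap_bounds(2)[OF xX] \<epsilon>(1) K by (intro mult_left_mono) auto
    then show ?thesis using K by simp
  qed
  finally show ?thesis .
qed

text \<open>The factor 2 * sqrt K comes from the two changes of norm: after square roots the
  comparison constants are 1/2 and sqrt K.\<close>

theorem energy_decay:
  assumes S: "is_semigroup_generated_by (energy) (energy_norm l \<alpha> \<Omega>)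
      (dom_wave l \<alpha> \<Omega>) (\<lambda>x. - op_wave l \<alpha> \<Omega> V x) S"
    and x: "x \<in> energy" and t: "t \<ge> 0"
  shows "X.nrm (S t x) \<le> 2 * sqrt K * exp (- (\<epsilon> / K / 2) * t) * X.nrm x"
proof -
  let ?X = "energy"
  have C0: "C0_semigroup ?X X.nrm S"
    and gr: "generator_graph ?X X.nrm S
        = {(x, y). x \<in> dom_wave l \<alpha> \<Omega> \<and> y \<in> ?X \<and> X.nrm (y - (- op_wave l \<alpha> \<Omega> V x)) = 0}"
    using S unfolding is_semigroup_generated_by_def energy_norm_eq by blast+
  have K: "K > 0" by (simp add: K_def add_pos_nonneg)
  have low: "1 / 2 * X.nrm x \<le> Q.nrm x" if "x \<in> ?X" for x
    using real_sqrt_le_mono[OF lyap_bounds(1)[OF that]] by (simp add: real_sqrt_divide)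
  have up: "Q.nrm x \<le> sqrt K * X.nrm x" if "x \<in> ?X" for x
    using real_sqrt_le_mono[OF lyap_bounds(2)[OF that]] by (simp add: real_sqrt_mult)
  have half: "(1 / 2 :: real) > 0" and sK: "sqrt K \<ge> 0" using K by auto
  note equiv = X.sub half sK low up X.p_nonneg
  have QC0: "C0_semigroup ?X Q.nrm S" by (rule C0_semigroup_equiv[OF equiv C0])
  have Qcompl: "seminorm_complete ?X Q.nrm" by (rule seminorm_complete_equiv[OF equiv energy_complete])
  have Qgr: "generator_graph ?X Q.nrm S = generator_graph ?X X.nrm S"
    by (rule generator_graph_equiv[OF equiv C0])
  have "Q.nrm (S t x) \<le> exp (- (\<epsilon> / K / 2) * t) * Q.nrm x"
  proof (rule Q.exponential_decay[OF Qcompl QC0 _ _ x t])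
    fix x y assume "(x, y) \<in> generator_graph ?X Q.nrm S"
    then have xd: "x \<in> dom_wave l \<alpha> \<Omega>" and y: "y \<in> ?X" and yB: "X.nrm (y - (- op_wave l \<alpha> \<Omega> V x)) = 0"
      unfolding Qgr gr by auto
    have xX: "x \<in> ?X" using xd dom_wave_subset by blast
    have BX: "- op_wave l \<alpha> \<Omega> V x \<in> ?X" by (rule op_wave_in_energy_space[OF xd])
    have d: "y - (- op_wave l \<alpha> \<Omega> V x) \<in> ?X" using y BX by (rule X.memX(3))
    \<comment> \<open>The graph determines y only up to a vector of zero energy norm; by equivalence
      such a vector is also null for the functional and does not affect the pairing with x.\<close>
    have "\<bar>lyap x (y - (- op_wave l \<alpha> \<Omega> V x))\<bar> \<le> Q.nrm x * (sqrt K * X.nrm (y - (- op_wave l \<alpha> \<Omega> V x)))"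
      using Q.Cauchy_Schwarz[OF xX d] mult_left_mono[OF up[OF d] Q.p_nonneg[OF xX]] by linarith
    then have "lyap x (y - (- op_wave l \<alpha> \<Omega> V x)) = 0" unfolding yB by simp
    then have "lyap x y = lyap x (- op_wave l \<alpha> \<Omega> V x)" using Q.ip_diff_right[OF y BX xX] by linarith
    then show "2 * lyap x y \<le> - (\<epsilon> / K) * lyap x x" using lyap_dissipation[OF xd] by simp
  next
    fix x and e :: real assume x: "x \<in> ?X" and e: "e > 0"
    have "e / sqrt K > 0" using e K by simp
    then obtain d where d: "d \<in> dom_wave l \<alpha> \<Omega>" "X.nrm (x - d) < e / sqrt K"
      using dom_wave_dense[OF x] by blast
    have xd: "x - d \<in> ?X" using x d(1) dom_wave_subset X.memX(3) by blast
    have "sqrt K * X.nrm (x - d) < e" using d(2) K by (simp add: pos_less_divide_eq mult.commute)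
    then have "Q.nrm (x - d) < e" using up[OF xd] by linarith
    moreover have "(d, - op_wave l \<alpha> \<Omega> V d) \<in> generator_graph ?X Q.nrm S"
      unfolding Qgr gr using d(1) op_wave_in_energy_space X.p_zero[unfolded real_sqrt_eq_0_iff] by simp
    ultimately show "\<exists>d\<in>Domain (generator_graph ?X Q.nrm S). Q.nrm (x - d) < e" by blast
  qed
  moreover have "S t x \<in> ?X" using C0 x t by (simp add: C0_semigroup_def)
  ultimately have "1 / 2 * X.nrm (S t x) \<le> exp (- (\<epsilon> / K / 2) * t) * Q.nrm x"
    using low by (meson order_trans)
  also have "\<dots> \<le> exp (- (\<epsilon> / K / 2) * t) * (sqrt K * X.nrm x)"
    using up[OF x] by (intro mult_left_mono) auto
  finally show ?thesis by (simp add: mult_ac)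
qed

end

section \<open>From the hypotheses on the domain to the decay estimate\<close>

lemma half_space_interior:
  assumes "open \<Omega>" "\<Omega> \<subseteq> closure {x. x $ l > 0}" "x \<in> \<Omega>"
  shows "0 < (x :: real^'n::finite) $ l"
proof -
  obtain e where e: "e > 0" "ball x e \<subseteq> \<Omega>" using assms(1,3) open_contains_ball by blast
  \<comment> \<open>The closed half-space gives nonnegative l-th coordinates only. A point of
    \<Omega> shifted down by e / 2 is still in \<Omega>, which makes the coordinate of x strictly
    positive.\<close>
  define y where "y = x - (e / 2) *\<^sub>R axis l 1"
  have "y \<in> ball x e" using e(1) by (simp add: y_def dist_norm)
  then have "y \<in> closure {x. x $ l > 0}" using e(2) assms(2) by blast
  moreover have "closure {x::real^'n. x $ l > 0} \<subseteq> {x. x $ l \<ge> 0}"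
    by (intro closure_minimal) (auto intro: closed_halfspace_component_ge_cart)
  ultimately have "y $ l \<ge> 0" by blast
  then show ?thesis using e(1) by (simp add: y_def axis_def)
qed

theorem proposition2p5:
  fixes l :: "'n::finite" and \<Omega> :: "(real^'n) set" and \<alpha> H :: real
    and V :: "real^'n \<Rightarrow> real" and S :: "real \<Rightarrow> 'n state \<Rightarrow> 'n state"
  assumes "degenerate_domain l \<Omega>"
    and "0 < \<alpha>" and "\<alpha> < 1"
    and "V \<in> Linf_on \<Omega>"
    and "H > 0" and "AE x in lebesgue_on \<Omega>. V x \<ge> H"
    and "is_semigroup_generated_by (energy_space l \<alpha> \<Omega>) (energy_norm l \<alpha> \<Omega>)
           (dom_wave l \<alpha> \<Omega>) (\<lambda>x. - op_wave l \<alpha> \<Omega> V x) S"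
  shows "\<exists>C>0. \<exists>\<omega>>0. \<forall>\<Phi>\<^sub>0\<in>energy_space l \<alpha> \<Omega>. \<forall>\<Phi>.
           is_mild_solution (energy_space l \<alpha> \<Omega>) (energy_norm l \<alpha> \<Omega>) S \<Phi>\<^sub>0 \<Phi> \<longrightarrow>
           (\<forall>t\<ge>0. energy_norm l \<alpha> \<Omega> (\<Phi> t) \<le> C * exp (- \<omega> * t) * energy_norm l \<alpha> \<Omega> (\<Phi> 0))"
proof -
  obtain B where V: "V \<in> borel_measurable (lebesgue_on \<Omega>)" "AE x in lebesgue_on \<Omega>. \<bar>V x\<bar> \<le> B"
    using assms(4) by (auto simp: Linf_on_def)
  have "open \<Omega>" "bounded \<Omega>" "\<Omega> \<subseteq> closure {x. x $ l > 0}"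
    using assms(1) by (auto simp: degenerate_domain_def)
  then interpret damped_wave \<Omega> l \<alpha> V H B
    using assms(2,3,5,6) V half_space_interior by unfold_locales
  have K: "K > 0" by (simp add: K_def add_pos_nonneg)
  have C0: "C0_semigroup (energy_space l \<alpha> \<Omega>) X.nrm S"
    using assms(7) unfolding is_semigroup_generated_by_def energy_norm_eq by blast
  show ?thesis
  proof (intro exI conjI ballI allI impI)
    show "2 * sqrt K > 0" "\<epsilon> / K / 2 > 0" using K \<epsilon>(1) by auto
    fix \<Phi>\<^sub>0 \<Phi> and t :: real
    assume x: "\<Phi>\<^sub>0 \<in> energy_space l \<alpha> \<Omega>" and t: "0 \<le> t"
      and mild: "is_mild_solution (energy_space l \<alpha> \<Omega>) (energy_norm l \<alpha> \<Omega>) S \<Phi>\<^sub>0 \<Phi>"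
    interpret C0_semigroup_on "energy_space l \<alpha> \<Omega>" X.nrm S using C0 by unfold_locales
    \<comment> \<open>A mild solution is another representative of the orbit at each time, including
      time 0, so it has the same norms.\<close>
    have eq: "X.nrm (\<Phi> s) = X.nrm (S s \<Phi>\<^sub>0)" if "s \<ge> 0" for s
      using mild that S_mem[OF that x] unfolding is_mild_solution_def energy_norm_eq
      by (intro X.eqv_p) (simp add: X.eqv_def)
    have "X.nrm (\<Phi> 0) = X.nrm \<Phi>\<^sub>0" using eq[of 0] X.eqv_p[OF S_zero[OF x]] by simp
    then show "energy_norm l \<alpha> \<Omega> (\<Phi> t) \<le> 2 * sqrt K * exp (- (\<epsilon> / K / 2) * t) * energy_norm l \<alpha> \<Omega> (\<Phi> 0)"
      using energy_decay[OF assms(7) x t] eq[OF t] unfolding energy_norm_eq by simp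
  qed
qed

end
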